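(* For every integer $k\ge 1$, $gr_k(K_3, C_9) = 4\cdot 2^k+1$. That is, $4\cdot 2^k+1$ is the least positive integer $n$ such that every coloring of the edges of the complete graph $K_n$ with $k$ colors contains either a rainbow triangle or a monochromatic copy of the cycle $C_9$.
   Context: A rainbow triangle is a triangle whose three edges receive three distinct colors. For a graph $H$ and integer $k\ge1$, the Gallai-Ramsey number $gr_k(K_3,H)$ is the least positive integer $n$ such that every $k$-edge-coloring of $K_n$ contains either a rainbow triangle or a monochromatic copy of $H$. $C_9$ denotes the cycle on $9$ vertices. *)

theory Defs
  imports Main "HOL-Library.FuncSet" "HOL-Library.Ramsey"
begin

text \<open>
  A graph is a pair of a vertex set and an edge set, an edge being a two-element set of vertices.
\<close>

type_synonym 'a graph = "'a set \<times> 'a set set"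

abbreviation verts :: "'a graph \<Rightarrow> 'a set" where "verts \<equiv> fst"

abbreviation edges :: "'a graph \<Rightarrow> 'a set set" where "edges \<equiv> snd"

definition simple_graph :: "'a graph \<Rightarrow> bool" where
  "simple_graph H \<longleftrightarrow> finite (verts H) \<and> edges H \<subseteq> [verts H]\<^bsup>2\<^esup>"

definition complete_graph :: "nat \<Rightarrow> nat graph" where
  "complete_graph n = ({..<n}, [{..<n}]\<^bsup>2\<^esup>)"

text \<open>The cycle on \<open>n\<close> vertices; only meaningful for \<open>n \<ge> 3\<close>.\<close>

definition cycle_graph :: "nat \<Rightarrow> nat graph" where
  "cycle_graph n = ({..<n}, {{i, Suc i mod n} | i. i < n})"

text \<open>The \<open>k\<close> colors need not all be used, and adjacent edges may share a color.\<close>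

definition edge_coloring :: "nat \<Rightarrow> 'a graph \<Rightarrow> ('a set \<Rightarrow> nat) \<Rightarrow> bool" where
  "edge_coloring k G f \<longleftrightarrow> f \<in> edges G \<rightarrow> {..<k}"

definition has_rainbow_triangle :: "'a graph \<Rightarrow> ('a set \<Rightarrow> nat) \<Rightarrow> bool" where
  "has_rainbow_triangle G f \<longleftrightarrow>
     (\<exists>x y z. {x, y} \<in> edges G \<and> {y, z} \<in> edges G \<and> {x, z} \<in> edges G \<and>
        f {x, y} \<noteq> f {y, z} \<and> f {y, z} \<noteq> f {x, z} \<and> f {x, y} \<noteq> f {x, z})"

text \<open>
  A copy of \<open>H\<close> is a subgraph isomorphic to \<open>H\<close>, not necessarily induced: the image of \<open>H\<close> under
  an injective map \<open>\<phi>\<close> of the vertices that preserves edges.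
\<close>

definition has_mono_copy :: "nat \<Rightarrow> 'b graph \<Rightarrow> 'a graph \<Rightarrow> ('a set \<Rightarrow> nat) \<Rightarrow> bool" where
  "has_mono_copy k H G f \<longleftrightarrow>
     (\<exists>\<phi> c. \<phi> \<in> verts H \<rightarrow> verts G \<and> inj_on \<phi> (verts H) \<and> c < k \<and>
        (\<forall>e\<in>edges H. \<phi> ` e \<in> edges G \<and> f (\<phi> ` e) = c))"

definition gallai_ramsey_prop :: "nat \<Rightarrow> 'b graph \<Rightarrow> nat \<Rightarrow> bool" where
  "gallai_ramsey_prop k H n \<longleftrightarrow>
     (\<forall>f. edge_coloring k (complete_graph n) f \<longrightarrow>
        has_rainbow_triangle (complete_graph n) f \<or> has_mono_copy k H (complete_graph n) f)"

text \<open>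
  By lemma \<open>gallai_ramsey_prop_exists\<close> below, the minimum is taken over a nonempty set whenever
  \<open>k \<ge> 1\<close> and \<open>H\<close> is a finite simple graph.
\<close>

definition gallai_ramsey :: "nat \<Rightarrow> 'b graph \<Rightarrow> nat" where
  "gallai_ramsey k H = (LEAST n. n > 0 \<and> gallai_ramsey_prop k H n)"

lemma simple_graph_cycle_graph:
  assumes "n \<ge> 3"
  shows "simple_graph (cycle_graph n)"
proof -
  have "i \<noteq> Suc i mod n \<and> Suc i mod n < n" if "i < n" for i
    using that assms by (cases "Suc i = n") auto
  then show ?thesis
    unfolding simple_graph_def cycle_graph_def by auto
qed

lemma gallai_ramsey_prop_exists:
  fixes H :: "'b graph"
  assumes "k \<ge> 1" and "simple_graph H"
  shows "\<exists>n>0. gallai_ramsey_prop k H n"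
proof -
  define m where "m = card (verts H)"
  obtain N :: nat where N0: "partn_lst {..<N} (replicate k m) 2"
    using ramsey_full by blast
  have N: "partn_lst {..<Suc N} (replicate k m) 2"
    using partn_lst_greater_resource[OF N0] by simp
  have "has_mono_copy k H (complete_graph (Suc N)) f"
    if f: "edge_coloring k (complete_graph (Suc N)) f" for f
  proof -
    have f': "f \<in> [{..<Suc N}]\<^bsup>2\<^esup> \<rightarrow> {..<k}"
      using f by (simp add: edge_coloring_def complete_graph_def)
    obtain i K where i: "i < k" and K: "K \<in> [{..<Suc N}]\<^bsup>m\<^esup>" and mono: "f ` ([K]\<^bsup>2\<^esup>) \<subseteq> {i}"
      using N f' unfolding partn_lst_def monochromatic_def by force
    have "card K = card (verts H)" "finite K" "K \<subseteq> {..<Suc N}"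
      using K by (auto simp: nsets_def m_def)
    then obtain \<phi> where bij: "bij_betw \<phi> (verts H) K"
      using assms(2) finite_same_card_bij unfolding simple_graph_def by metis
    have copy: "\<phi> ` e \<in> [K]\<^bsup>2\<^esup>" if "e \<in> edges H" for e
    proof -
      have "e \<in> [verts H]\<^bsup>2\<^esup>"
        using that assms(2) by (auto simp: simple_graph_def)
      then show ?thesis
        using bij_betw_nsets[OF bij, of 2] by (auto simp: bij_betw_def)
    qed
    have "[K]\<^bsup>2\<^esup> \<subseteq> [{..<Suc N}]\<^bsup>2\<^esup>"
      using \<open>K \<subseteq> {..<Suc N}\<close> by (rule nsets_mono)
    moreover have "f (\<phi> ` e) = i" if "e \<in> edges H" for e
      using copy[OF that] mono by blast
    moreover have "\<phi> \<in> verts H \<rightarrow> {..<Suc N}" "inj_on \<phi> (verts H)"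
      using bij \<open>K \<subseteq> {..<Suc N}\<close> by (auto simp: bij_betw_def)
    ultimately show ?thesis
      using i copy unfolding has_mono_copy_def complete_graph_def fst_conv snd_conv by blast
  qed
  then show ?thesis
    unfolding gallai_ramsey_prop_def by blast
qed

end

theory Submission
  imports Defs
begin

text \<open>
  For the lower bound, color an edge \<open>{x, y}\<close> by the least \<open>j\<close> such that \<open>x\<close> and \<open>y\<close> lie in the
  same block of length \<open>2 ^ (j + 3)\<close>. This is an ultrametric, so there are no rainbow triangles;
  color \<open>0\<close> is a union of disjoint complete graphs on 8 vertices and every other color is bipartite.

  For the upper bound, a Gallai coloring has a nontrivial partition into parts that see each other
  in only two colors \<open>r\<close>, \<open>b\<close>, with one color between any two parts. The induction runs over a stronger
  statement, in which every color \<open>i\<close> comes with a set \<open>S i\<close> of vertices joined to all of \<open>V\<close> in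
  color \<open>i\<close>, and the bound is on \<open>card V + (\<Sum>i\<in>K. card (S i))\<close>. If the largest part has at least
  5 vertices, then each of the two colors either has at least 4 edges leaving every vertex of the part
  and hence is absent inside the part, or its at most 3 outer neighbors can be absorbed into the sets
  \<open>S r\<close>, \<open>S b\<close>. If all parts have at most 4 vertices, the two colors between the parts already
  force a cycle; this rests on the two-color case, where a monochromatic cycle is first enlarged
  to length 8 and the remaining vertices are then classified by their attachment to that cycle.
\<close>

section \<open>The lower bound\<close>

text \<open>Two mechanisms recur. A complete bipartite graph of color c with sides of 5 and 4
  vertices contains no C9, but any further c-edge inside the side of 5 closes one; this is the
  origin of the thresholds 4 and 5. Moreover, an outer vertex that cannot be inserted into a c-cycle
  has no two consecutive c-neighbors on it, so its d-neighbors form a vertex cover of the cycle. Up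
  to rotation there are few minimal covers, and vertices of equal type span a complete bipartite
  d-graph with part of the cycle; the steps that lengthen a cycle are counts of such types.

  The obstacle in the induction is that 4 * 2 ^ k leaves no slack. Discarding up to 3 outer
  neighbors per color in each reduction would lose the exact constant, so they are charged to the
  bound as universal vertices. A set of at most 3 universal vertices absorbs at most 3 more, hence
  the cap 6 in \<open>bounded\<close>; once a set has 4 vertices, its color is absent from V and the
  number of colors drops.\<close>

definition level :: "nat set \<Rightarrow> nat" where
  "level e = (LEAST j. card ((\<lambda>x. x div 2 ^ (j + 3)) ` e) = 1)"

lemma level_pair: "level {x, y} = (LEAST j. x div 2 ^ (j + 3) = y div 2 ^ (j + 3))"
proof -
  have "card {a, b} = 1 \<longleftrightarrow> a = b" for a b :: nat
    by (cases "a = b") auto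
  then show ?thesis
    unfolding level_def by simp
qed

lemma div_power_mono:
  fixes x y :: nat
  assumes "x div 2 ^ i = y div 2 ^ i" "i \<le> j"
  shows "x div 2 ^ j = y div 2 ^ j"
proof -
  have "z div 2 ^ j = z div 2 ^ i div 2 ^ (j - i)" for z :: nat
    using assms(2) by (simp add: div_mult2_eq[symmetric] power_add[symmetric])
  then show ?thesis using assms(1) by simp
qed

lemma level_le: "x div 2 ^ (j + 3) = y div 2 ^ (j + 3) \<Longrightarrow> level {x, y} \<le> j"
  unfolding level_pair by (rule Least_le)

lemma level_eq_div:
  assumes "level {x, y} \<le> j"
  shows "x div 2 ^ (j + 3) = y div 2 ^ (j + 3)"
proof -
  \<comment> \<open>A block of this length contains both numbers, so the LEAST in
    \<open>level\<close> is attained.\<close>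
  have "z < 2 ^ (max x y + 3)" if "z \<le> max x y" for z
    using that less_exp[of "max x y + 3"] by linarith
  then have "x < 2 ^ (max x y + 3)" "y < 2 ^ (max x y + 3)" by simp_all
  then have "x div 2 ^ (max x y + 3) = y div 2 ^ (max x y + 3)" by simp
  then have "x div 2 ^ (level {x, y} + 3) = y div 2 ^ (level {x, y} + 3)"
    unfolding level_pair by (rule LeastI)
  then show ?thesis by (rule div_power_mono) (use assms in simp)
qed

lemma level_ultrametric: "level {x, z} \<le> max (level {x, y}) (level {y, z})"
  by (rule level_le) (metis level_eq_div max.cobounded1 max.cobounded2)

lemma level_less:
  assumes "x < 2 ^ (k + 2)" "y < 2 ^ (k + 2)" "k \<ge> 1"
  shows "level {x, y} < k"
proof -
  have "x div 2 ^ (k - 1 + 3) = 0" "y div 2 ^ (k - 1 + 3) = 0"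
    using assms by (auto simp: numeral_3_eq_3)
  then have "level {x, y} \<le> k - 1" by (intro level_le) simp
  then show ?thesis using assms(3) by simp
qed

text \<open>Color \<open>Suc j\<close> joins the two halves of a block of length 2 ^ (j + 4): the
  quotients by 2 ^ (j + 3) differ but agree after halving. This is the bipartition of every positive
  color.\<close>

lemma level_Suc_parity:
  assumes "level {x, y} = Suc j"
  shows "even (x div 2 ^ (j + 3)) \<longleftrightarrow> odd (y div 2 ^ (j + 3))"
proof -
  let ?a = "x div 2 ^ (j + 3)" and ?b = "y div 2 ^ (j + 3)"
  have "?a \<noteq> ?b" using assms level_le[of x j y] by auto
  moreover have "?a div 2 = ?b div 2"
    using level_eq_div[of x y "Suc j"] assms
    by (simp add: div_mult2_eq[symmetric] power_add mult.commute mult.left_commute)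
  ultimately show ?thesis
    by (metis odd_two_times_div_two_succ even_two_times_div_two)
qed

lemma level_no_mono_C9:
  "\<not> has_mono_copy k (cycle_graph 9) (complete_graph n) level"
proof
  assume "has_mono_copy k (cycle_graph 9) (complete_graph n) level"
  then obtain \<phi> c where "inj_on \<phi> (verts (cycle_graph 9))"
    and edge: "\<forall>e\<in>edges (cycle_graph 9). level (\<phi> ` e) = c"
    unfolding has_mono_copy_def by metis
  then have inj: "inj_on \<phi> {..<9}" by (simp add: cycle_graph_def)
  have e: "level {\<phi> i, \<phi> (Suc i mod 9)} = c" if "i < 9" for i
  proof -
    have "{i, Suc i mod 9} \<in> edges (cycle_graph 9)"
      using that unfolding cycle_graph_def snd_conv by blast
    then have "level (\<phi> ` {i, Suc i mod 9}) = c" using edge by blast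
    then show ?thesis by simp
  qed
  show False
  proof (cases c)
    case 0
    have eq: "\<phi> i div 8 = \<phi> 0 div 8" if "i < 9" for i
      using that
    proof (induction i)
      case (Suc i)
      then show ?case using e[of i] 0 level_eq_div[of "\<phi> i" "\<phi> (Suc i)" 0] by simp
    qed simp
    have "\<phi> ` {..<9} \<subseteq> {8 * (\<phi> 0 div 8)..<8 * (\<phi> 0 div 8) + 8}"
    proof
      fix x assume "x \<in> \<phi> ` {..<9}"
      then have "x div 8 = \<phi> 0 div 8" using eq by blast
      moreover have "8 * (x div 8) \<le> x" "x < 8 * (x div 8) + 8" by linarith+
      ultimately show "x \<in> {8 * (\<phi> 0 div 8)..<8 * (\<phi> 0 div 8) + 8}" by simp
    qed
    then have "card (\<phi> ` {..<9}) \<le> card {8 * (\<phi> 0 div 8)..<8 * (\<phi> 0 div 8) + 8}"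
      by (rule card_mono[OF finite_atLeastLessThan])
    then show False using card_image[OF inj] by simp
  next
    case (Suc j)
    define P where "P i \<longleftrightarrow> even (\<phi> i div 2 ^ (j + 3))" for i
    have "P i \<longleftrightarrow> \<not> P (Suc i mod 9)" if "i < 9" for i
      using level_Suc_parity e[OF that] Suc unfolding P_def by blast
    from this[of 0] this[of 1] this[of 2] this[of 3] this[of 4] this[of 5] this[of 6]
      this[of 7] this[of 8] show False by (simp add: numeral_2_eq_2)
  qed
qed

text \<open>All n up to 4 * 2 ^ k are treated at once, so the minimality of the Ramsey number needs
  no monotonicity in n.\<close>

lemma not_gallai_ramsey_prop:
  assumes "k \<ge> 1" "n \<le> 4 * 2 ^ k"
  shows "\<not> gallai_ramsey_prop k (cycle_graph 9) n"
proof -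
  have n: "x < 2 ^ (k + 2)" if "x < n" for x
    using that assms(2) by simp
  have "edge_coloring k (complete_graph n) level"
    unfolding edge_coloring_def complete_graph_def
    by (auto simp: nsets_def card_2_iff intro!: level_less n assms(1))
  moreover have "\<not> has_rainbow_triangle (complete_graph n) level"
    unfolding has_rainbow_triangle_def
    using level_ultrametric by (smt (verit) insert_commute max_def nat_neq_iff order.trans leD)
  ultimately show ?thesis
    using level_no_mono_C9 unfolding gallai_ramsey_prop_def by blast
qed

section \<open>Gallai partitions\<close>

lemma distinct_list_of_card:
  assumes "n \<le> card A"
  shows "\<exists>xs. length xs = n \<and> distinct xs \<and> set xs \<subseteq> A"
proof -
  obtain T where "T \<subseteq> A" "card T = n" "finite T"
    using obtain_subset_with_card_n[OF assms] by metis
  then show ?thesis by (metis distinct_card finite_distinct_list)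
qed

lemma two_of_card:
  assumes "card A \<ge> 2"
  obtains a b where "a \<in> A" "b \<in> A" "a \<noteq> b"
  using obtain_subset_with_card_n[OF assms] by (metis card_2_iff' subsetD)

lemma three_of_card:
  assumes "card A \<ge> 3"
  obtains x y z where "distinct [x, y, z]" "{x, y, z} \<subseteq> A"
  using distinct_list_of_card[OF assms] by (auto simp: length_Suc_conv numeral_3_eq_3)

definition rainbow_free :: "('a set \<Rightarrow> nat) \<Rightarrow> 'a set \<Rightarrow> bool" where
  "rainbow_free f V \<longleftrightarrow> (\<forall>x\<in>V. \<forall>y\<in>V. \<forall>z\<in>V. x \<noteq> y \<longrightarrow> y \<noteq> z \<longrightarrow> x \<noteq> z \<longrightarrow>
     f {x, y} = f {y, z} \<or> f {y, z} = f {x, z} \<or> f {x, y} = f {x, z})"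

lemma rainbow_free_subset: "rainbow_free f V \<Longrightarrow> W \<subseteq> V \<Longrightarrow> rainbow_free f W"
  unfolding rainbow_free_def by blast

definition colors :: "('a set \<Rightarrow> nat) \<Rightarrow> 'a set \<Rightarrow> nat set" where
  "colors f V = {f {x, y} | x y. x \<in> V \<and> y \<in> V \<and> x \<noteq> y}"

lemma finite_colors: "finite V \<Longrightarrow> finite (colors f V)"
proof -
  assume "finite V"
  moreover have "colors f V \<subseteq> (\<lambda>(x, y). f {x, y}) ` (V \<times> V)"
    unfolding colors_def by auto
  ultimately show ?thesis by (meson finite_SigmaI finite_imageI finite_subset)
qed

definition conn :: "('a set \<Rightarrow> nat) \<Rightarrow> 'a set \<Rightarrow> nat \<Rightarrow> 'a \<Rightarrow> 'a \<Rightarrow> bool" where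
  "conn f V c = (\<lambda>x y. x \<in> V \<and> y \<in> V \<and> x \<noteq> y \<and> f {x, y} = c)\<^sup>*\<^sup>*"

lemma conn_refl: "conn f V c x x"
  unfolding conn_def by simp

lemma conn_trans: "conn f V c x y \<Longrightarrow> conn f V c y z \<Longrightarrow> conn f V c x z"
  unfolding conn_def by (rule rtranclp_trans)

lemma conn_edge: "x \<in> V \<Longrightarrow> y \<in> V \<Longrightarrow> f {x, y} = c \<Longrightarrow> conn f V c x y"
  unfolding conn_def by (cases "x = y") auto

lemma conn_sym: "conn f V c x y \<Longrightarrow> conn f V c y x"
proof -
  have "symp (\<lambda>x y. x \<in> V \<and> y \<in> V \<and> x \<noteq> y \<and> f {x, y} = c)"
    by (auto simp: symp_def insert_commute)
  from symp_rtranclp[OF this] show "conn f V c x y \<Longrightarrow> conn f V c y x"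
    unfolding conn_def by (rule sympD)
qed

lemma conn_closed:
  assumes "conn f V c x y" "x \<in> A"
    and "\<And>u v. u \<in> A \<Longrightarrow> u \<in> V \<Longrightarrow> v \<in> V \<Longrightarrow> u \<noteq> v \<Longrightarrow> f {u, v} = c \<Longrightarrow> v \<in> A"
  shows "y \<in> A"
  using assms(1) unfolding conn_def
  by (induction rule: rtranclp_induct) (use assms(2,3) in auto)

text \<open>For a c-edge uv of the component, neither uy nor vy has color c, so the triangle u, v, y
  forces their colors to agree; the equality travels through the component.\<close>

lemma conn_homogeneous:
  assumes "rainbow_free f V" "conn f V c x x'" "x \<in> V" "y \<in> V" "\<not> conn f V c x y"
  shows "f {x, y} = f {x', y}"
proof -
  let ?A = "{z. z \<in> V \<and> conn f V c x z \<and> f {x, y} = f {z, y}}"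
  have "x' \<in> ?A"
  proof (rule conn_closed[OF assms(2)])
    show "x \<in> ?A" using assms(3) by (simp add: conn_refl)
  next
    fix u v assume u: "u \<in> ?A" and uv: "u \<in> V" "v \<in> V" "u \<noteq> v" "f {u, v} = c"
    have xv: "conn f V c x v" using u uv conn_edge conn_trans by fastforce
    have "u \<noteq> y" "v \<noteq> y" using u xv assms(5) by auto
    moreover have "f {u, y} \<noteq> c" "f {v, y} \<noteq> c"
      using u uv xv assms(4,5) by (auto intro: conn_edge conn_trans)
    ultimately have "f {u, y} = f {v, y}"
      using assms(1,4) uv unfolding rainbow_free_def by metis
    then show "v \<in> ?A" using u uv xv by simp
  qed
  then show ?thesis by simp
qed

text \<open>The witness y is the vertex before the first visit of v on a c-path from x.\<close>

lemma conn_insert_edge: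
  assumes "v \<notin> V" "x \<in> V" "conn f (insert v V) c x v"
  obtains y where "y \<in> V" "conn f V c x y" "f {v, y} = c"
proof (rule ccontr)
  assume contr: "\<not> thesis"
  have "v \<in> {y \<in> V. conn f V c x y}"
  proof (rule conn_closed[OF assms(3)])
    show "x \<in> {y \<in> V. conn f V c x y}" using assms(2) by (simp add: conn_refl)
  next
    fix a b assume a: "a \<in> {y \<in> V. conn f V c x y}"
      and ab: "a \<in> insert v V" "b \<in> insert v V" "a \<noteq> b" "f {a, b} = c"
    have "b \<noteq> v" using a ab contr that[of a] by (auto simp: insert_commute)
    then show "b \<in> {y \<in> V. conn f V c x y}"
      using a ab conn_edge conn_trans by fastforce
  qed
  then show False using assms(1) by simp
qed

text \<open>Induction by removal of v. If every color were connected on the larger set, v would have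
  an edge of every color. Either two of these colors clash over a color c that disconnects V, or V
  has lost a color, which is then forced on all edges at v.\<close>

lemma exists_disconnected_color:
  assumes "finite V" "rainbow_free f V" "card (colors f V) \<ge> 3"
  shows "\<exists>c\<in>colors f V. \<exists>x\<in>V. \<exists>y\<in>V. \<not> conn f V c x y"
  using assms
proof (induction V rule: finite_induct)
  case empty
  then show ?case by (simp add: colors_def)
next
  case (insert v V)
  show ?case
  proof (rule ccontr)
    assume "\<not> ?thesis"
    then have con: "conn f (insert v V) c x y"
      if "c \<in> colors f (insert v V)" "x \<in> insert v V" "y \<in> insert v V" for c x y
      using that by blast
    have rf: "rainbow_free f V" using insert.prems(1) by (rule rainbow_free_subset) blast
    have sub: "colors f V \<subseteq> colors f (insert v V)" unfolding colors_def by blast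
    have fin: "finite (colors f (insert v V))" using insert.hyps by (simp add: finite_colors)
    have "V \<noteq> {}"
      using insert.prems(2) by (intro notI) (simp add: colors_def)
    have inc: "\<exists>y\<in>V. f {v, y} = c" if "c \<in> colors f (insert v V)" for c
      using \<open>V \<noteq> {}\<close> con[OF that] conn_insert_edge[OF insert.hyps(2)]
      by (metis all_not_in_conv insertI1 insertI2)
    show False
    proof (cases "card (colors f V) \<ge> 3")
      case True
      then obtain c x0 y0 where c: "c \<in> colors f V"
        and xy0: "x0 \<in> V" "y0 \<in> V" "\<not> conn f V c x0 y0"
        using insert.IH rf by blast
      have cc: "c \<in> colors f (insert v V)" using c sub by blast
      have "card (colors f (insert v V) - {c}) \<ge> 2" using insert.prems(2) cc fin by simp
      then obtain a b where ab: "a \<in> colors f (insert v V)" "b \<in> colors f (insert v V)"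
        "a \<noteq> c" "b \<noteq> c" "a \<noteq> b"
        by (rule two_of_card) blast
      \<comment> \<open>The component of x contains a c-neighbor x' of v. In the triangle v, y, x'
        the colors at v are d and c, and yx' is not c, so it has color d; homogeneity carries this
        to yx.\<close>
      have main: "f {y, x} = d"
        if m: "y \<in> V" "f {v, y} = d" "d \<noteq> c" "x \<in> V" "\<not> conn f V c y x" for x y d
      proof -
        obtain x' where x': "x' \<in> V" "conn f V c x x'" "f {v, x'} = c"
        proof (rule conn_insert_edge[OF insert.hyps(2) m(4)])
          show "conn f (insert v V) c x v" using con[OF cc] m(4) by blast
        qed
        have n: "\<not> conn f V c y x'" using m(5) x'(2) conn_sym conn_trans by metis
        have "f {y, x'} \<noteq> c" using n conn_edge m(1) x'(1) by metis
        moreover have "y \<noteq> x'" using n conn_refl by metis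
        ultimately have "f {y, x'} = d"
          using insert.prems(1) insert.hyps(2) m(1-3) x' unfolding rainbow_free_def
          by (metis insertCI)
        moreover have "f {x', y} = f {x, y}"
          using conn_homogeneous[OF rf x'(2) m(4,1)] m(5) conn_sym by metis
        ultimately show ?thesis by (simp add: insert_commute)
      qed
      obtain y z where y: "y \<in> V" "f {v, y} = a" and z: "z \<in> V" "f {v, z} = b"
        using inc ab by metis
      \<comment> \<open>In different components, the edge yz would have both colors a and b. In one
        component, a vertex x outside it sees y in a and z in b, against homogeneity.\<close>
      show False
      proof (cases "conn f V c y z")
        case False
        then show False
          using main[OF y ab(3) z(1)] main[OF z ab(4) y(1)] ab(5) conn_sym insert_commute by metis
      next
        case True
        obtain x where x: "x \<in> V" "\<not> conn f V c y x"
          using xy0 conn_sym conn_trans by metis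
        then have "\<not> conn f V c z x" using True conn_trans by metis
        then show False
          using main[OF y ab(3) x] main[OF z ab(4) x(1)] ab(5)
            conn_homogeneous[OF rf True y(1) x] by simp
      qed
    next
      case False
      then have "\<not> colors f (insert v V) \<subseteq> colors f V"
        using insert.prems(2)
          card_mono[OF finite_colors[OF insert.hyps(1)], of "colors f (insert v V)" f] by linarith
      then obtain g where g: "g \<in> colors f (insert v V)" "g \<notin> colors f V" by blast
      \<comment> \<open>The color g occurs only at v, so its components inside V are single
        vertices, and each needs its own g-edge to v.\<close>
      have all: "f {v, x} = g" if x: "x \<in> V" for x
      proof -
        obtain y where y: "y \<in> V" "conn f V g x y" "f {v, y} = g"
        proof (rule conn_insert_edge[OF insert.hyps(2) x])
          show "conn f (insert v V) g x v" using con[OF g(1)] x by blast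
        qed
        have "y \<in> {x}"
        proof (rule conn_closed[OF y(2)])
          fix u w assume "u \<in> {x}" "u \<in> V" "w \<in> V" "u \<noteq> w" "f {u, w} = g"
          then have "g \<in> colors f V" unfolding colors_def by blast
          then show "w \<in> {x}" using g(2) by simp
        qed simp
        then show ?thesis using y by simp
      qed
      have "card (colors f (insert v V) - {g}) \<ge> 2" using insert.prems(2) g fin by simp
      then obtain c where "c \<in> colors f (insert v V)" "c \<noteq> g"
        by (rule two_of_card) blast
      then show False using inc all by metis
    qed
  qed
qed

text \<open>Parts are the fibers of p. With at most two colors, singletons do. Otherwise the
  components of a disconnected color c are contracted to representatives: the contraction is well
  defined by homogeneity, smaller because c occurs, and has at least two vertices because c is
  disconnected. A partition of the representatives is pulled back.\<close>

theorem gallai_partition: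
  assumes "finite V" "card V \<ge> 2" "rainbow_free f V"
  shows "\<exists>(p :: 'a \<Rightarrow> 'a) c d. (\<exists>x\<in>V. \<exists>y\<in>V. p x \<noteq> p y) \<and>
    (\<forall>x\<in>V. \<forall>y\<in>V. p x \<noteq> p y \<longrightarrow> f {x, y} \<in> {c, d}) \<and>
    (\<forall>x\<in>V. \<forall>x'\<in>V. \<forall>y\<in>V. p x = p x' \<longrightarrow> p x \<noteq> p y \<longrightarrow> f {x, y} = f {x', y})"
  using assms
proof (induction "card V" arbitrary: V rule: less_induct)
  case less
  show ?case
  proof (cases "card (colors f V) \<ge> 3")
    case False
    have "\<exists>c d. colors f V \<subseteq> {c, d}"
    proof (cases "card (colors f V) = 2")
      case True
      then show ?thesis by (metis card_2_iff order_refl)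
    next
      case n2: False
      then have "card (colors f V) \<le> 1" using False by simp
      then show ?thesis
        using finite_colors[OF less.prems(1)] card_le_Suc0_iff_eq
        by (metis One_nat_def insertCI subsetI)
    qed
    then obtain c d where "colors f V \<subseteq> {c, d}" by blast
    then have "\<forall>x\<in>V. \<forall>y\<in>V. id x \<noteq> id y \<longrightarrow> f {x, y} \<in> {c, d}"
      unfolding colors_def id_def by blast
    moreover have "\<exists>x\<in>V. \<exists>y\<in>V. id x \<noteq> id y"
      using two_of_card[OF less.prems(2)] by (metis id_apply)
    ultimately show ?thesis by (intro exI[of _ id] exI[of _ c] exI[of _ d]) auto
  next
    case True
    then obtain c x0 y0 where c: "c \<in> colors f V"
      and xy0: "x0 \<in> V" "y0 \<in> V" "\<not> conn f V c x0 y0"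
      using exists_disconnected_color less.prems by metis
    define \<rho> where "\<rho> x = (SOME y. y \<in> V \<and> conn f V c x y)" for x
    have \<rho>: "\<rho> x \<in> V \<and> conn f V c x (\<rho> x)" if "x \<in> V" for x
      unfolding \<rho>_def by (rule someI[of _ x]) (simp add: that conn_refl)
    have \<rho>_eq: "\<rho> x = \<rho> y" if "conn f V c x y" for x y
    proof -
      have "conn f V c x z = conn f V c y z" for z using that conn_sym conn_trans by metis
      then show ?thesis unfolding \<rho>_def by simp
    qed
    have \<rho>_conn: "conn f V c x y" if "x \<in> V" "y \<in> V" "\<rho> x = \<rho> y" for x y
      using \<rho>[OF that(1)] \<rho>[OF that(2)] that(3) conn_sym conn_trans by metis
    have hom: "f {x, y} = f {\<rho> x, \<rho> y}" if "x \<in> V" "y \<in> V" "\<rho> x \<noteq> \<rho> y" for x y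
    proof -
      have n: "\<not> conn f V c x y" using \<rho>_eq that(3) by metis
      have n2: "\<not> conn f V c y (\<rho> x)" using n \<rho> that conn_sym conn_trans by metis
      have "f {x, y} = f {\<rho> x, y}"
        using conn_homogeneous[OF less.prems(3) _ that(1,2) n] \<rho>[OF that(1)] by blast
      also have "\<dots> = f {\<rho> y, \<rho> x}"
        using conn_homogeneous[OF less.prems(3) _ that(2) _ n2, of "\<rho> y"] \<rho> that
        by (metis insert_commute)
      finally show ?thesis by (simp add: insert_commute)
    qed
    let ?W = "\<rho> ` V"
    have WV: "?W \<subseteq> V" using \<rho> by blast
    have "\<rho> x0 \<noteq> \<rho> y0" using \<rho>_conn xy0 by blast
    then have "card ?W \<ge> 2"
      using xy0 less.prems(1) by (metis card_2_iff card_mono empty_subsetI finite_imageI imageI insert_subset)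
    obtain u w where "u \<in> V" "w \<in> V" "u \<noteq> w" "f {u, w} = c"
      using c unfolding colors_def by blast
    then have "\<not> inj_on \<rho> V" using \<rho>_eq conn_edge inj_onD by metis
    then have cW: "card ?W < card V"
      using less.prems(1) by (metis card_image_le eq_card_imp_inj_on le_neq_implies_less)
    have "\<exists>(p :: 'a \<Rightarrow> 'a) a b. (\<exists>x\<in>?W. \<exists>y\<in>?W. p x \<noteq> p y) \<and>
      (\<forall>x\<in>?W. \<forall>y\<in>?W. p x \<noteq> p y \<longrightarrow> f {x, y} \<in> {a, b}) \<and>
      (\<forall>x\<in>?W. \<forall>x'\<in>?W. \<forall>y\<in>?W. p x = p x' \<longrightarrow> p x \<noteq> p y \<longrightarrow> f {x, y} = f {x', y})"
      by (rule less.hyps[OF cW]) (use less.prems(1) \<open>card ?W \<ge> 2\<close> rainbow_free_subset[OF less.prems(3) WV] in auto)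
    then obtain p :: "'a \<Rightarrow> 'a" and a b where p: "\<exists>x\<in>?W. \<exists>y\<in>?W. p x \<noteq> p y"
      "\<forall>x\<in>?W. \<forall>y\<in>?W. p x \<noteq> p y \<longrightarrow> f {x, y} \<in> {a, b}"
      "\<forall>x\<in>?W. \<forall>x'\<in>?W. \<forall>y\<in>?W. p x = p x' \<longrightarrow> p x \<noteq> p y \<longrightarrow> f {x, y} = f {x', y}"
      by (elim exE conjE) (rule that; assumption)
    have 1: "\<exists>x\<in>V. \<exists>y\<in>V. (p \<circ> \<rho>) x \<noteq> (p \<circ> \<rho>) y" using p(1) by auto
    have 2: "f {x, y} \<in> {a, b}" if "x \<in> V" "y \<in> V" "(p \<circ> \<rho>) x \<noteq> (p \<circ> \<rho>) y" for x y
      using p(2) hom[OF that(1,2)] that by (metis comp_apply imageI)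
    have 3: "f {x, y} = f {x', y}"
      if "x \<in> V" "x' \<in> V" "y \<in> V" "(p \<circ> \<rho>) x = (p \<circ> \<rho>) x'" "(p \<circ> \<rho>) x \<noteq> (p \<circ> \<rho>) y" for x x' y
      using p(3) hom[OF that(1,3)] hom[OF that(2,3)] that by (metis comp_apply imageI)
    show ?thesis
      by (rule exI[of _ "p \<circ> \<rho>"], rule exI[of _ a], rule exI[of _ b]) (use 1 2 3 in blast)
  qed
qed

section \<open>Dense configurations that contain a cycle on 9 vertices\<close>

definition cyc :: "('a \<Rightarrow> 'a \<Rightarrow> bool) \<Rightarrow> 'a list \<Rightarrow> bool" where
  "cyc r xs \<longleftrightarrow> xs \<noteq> [] \<and> distinct xs \<and> successively r xs \<and> r (last xs) (hd xs)"

section \<open>Greedy choice of distinct representatives\<close>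

lemma two_distinct_representatives:
  assumes "card A \<ge> 1" "card B \<ge> 2"
  obtains a b where "a \<in> A" "b \<in> B" "a \<noteq> b"
proof -
  obtain a where a: "a \<in> A" using assms(1) by (metis card.empty equals0I not_one_le_zero)
  have "B - {a} \<noteq> {}"
    using assms(2) by (metis Diff_eq_empty_iff card_mono card.empty card_insert_le_m1
        card_1_singleton_iff finite.emptyI finite_insert is_singletonI is_singleton_altdef
        not_less_eq_eq numeral_2_eq_2)
  then show thesis using a that by blast
qed

lemma card_Diff_ge: "card B - card A \<le> card (B - A)" if "finite A"
  using diff_card_le_card_Diff[OF that] .

lemma card_Diff_one: "card B - 1 \<le> card (B - {x})"
  using card_Diff_ge[of "{x}" B] by simp

lemma card_Diff_two: "card B - 2 \<le> card (B - {x, y})"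
  using card_Diff_ge[of "{x, y}" B] card_length[of "[x, y]"] by simp

lemma ex_of_card: "card A \<ge> 1 \<Longrightarrow> \<exists>a. a \<in> A"
  by (metis card.empty equals0I not_one_le_zero)

lemma three_distinct_representatives:
  assumes "card A \<ge> 1" "card B \<ge> 2" "card C \<ge> 3"
  obtains a b c where "a \<in> A" "b \<in> B" "c \<in> C" "distinct [a, b, c]"
proof -
  obtain a b where ab: "a \<in> A" "b \<in> B" "a \<noteq> b"
    using two_distinct_representatives assms(1,2) by metis
  have "card (C - {a, b}) \<ge> 1"
    using card_Diff_ge[of "{a, b}" C] ab(3) assms(3) by simp
  then obtain c where "c \<in> C - {a, b}" using ex_of_card by blast
  then show thesis using that[of a b c] ab by auto
qed

lemma four_distinct_representatives:
  assumes "card A \<ge> 1" "card B \<ge> 2" "card C \<ge> 3" "card D \<ge> 4"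
  obtains a b c d where "a \<in> A" "b \<in> B" "c \<in> C" "d \<in> D" "distinct [a, b, c, d]"
proof -
  obtain a b c where abc: "a \<in> A" "b \<in> B" "c \<in> C" "distinct [a, b, c]"
    using three_distinct_representatives assms(1-3) by metis
  have "card (D - {a, b, c}) \<ge> 1"
    using card_Diff_ge[of "{a, b, c}" D] abc(4) assms(4) by simp
  then obtain d where "d \<in> D - {a, b, c}" using ex_of_card by blast
  then show thesis using that[of a b c d] abc by auto
qed

text \<open>Colors are abstracted to a family of graphs on one vertex type. The graphs may overlap
  and need not cover all pairs; disjointness enters only in \<open>gallai_c9_free\<close>.\<close>

locale c9_free =
  fixes ad :: "'c \<Rightarrow> 'a \<Rightarrow> 'a \<Rightarrow> bool"
  assumes ad_sym: "ad c x y \<Longrightarrow> ad c y x"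
    and ad_irrefl: "\<not> ad c x x"
    and no_C9: "length xs = 9 \<Longrightarrow> \<not> cyc (ad c) xs"
begin

lemma C9:
  assumes "ad c x0 x1" "ad c x1 x2" "ad c x2 x3" "ad c x3 x4" "ad c x4 x5" "ad c x5 x6"
    "ad c x6 x7" "ad c x7 x8" "ad c x8 x0" "distinct [x0, x1, x2, x3, x4, x5, x6, x7, x8]"
  shows False
  using no_C9[of "[x0, x1, x2, x3, x4, x5, x6, x7, x8]" c] assms unfolding cyc_def by simp

definition joined :: "'c \<Rightarrow> 'a set \<Rightarrow> 'a set \<Rightarrow> bool" where
  "joined c A B \<longleftrightarrow> (\<forall>a\<in>A. \<forall>b\<in>B. ad c a b)"

lemma joinedD: "joined c A B \<Longrightarrow> a \<in> A \<Longrightarrow> b \<in> B \<Longrightarrow> ad c a b"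
  unfolding joined_def by blast

lemma joined_sym: "joined c A B \<Longrightarrow> joined c B A"
  unfolding joined_def by (blast intro: ad_sym)

lemma joined_neq: "joined c A B \<Longrightarrow> a \<in> A \<Longrightarrow> b \<in> B \<Longrightarrow> a \<noteq> b"
  unfolding joined_def using ad_irrefl by blast

lemma ad_neq: "ad c x y \<Longrightarrow> x \<noteq> y"
  using ad_irrefl by blast

text \<open>Five vertices of A and four of B alternate around a 9-cycle except at the edge
  xy.\<close>

lemma joined_no_edge:
  assumes j: "joined c A B" and "card A \<ge> 5" "card B \<ge> 4" "x \<in> A" "y \<in> A"
  shows "\<not> ad c x y"
proof
  assume xy: "ad c x y"
  have "card (A - {x, y}) \<ge> 3"
    using card_Diff_ge[of "{x, y}" A] assms(2) ad_neq[OF xy] by simp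
  then obtain p q r where pqr: "distinct [p, q, r]" "{p, q, r} \<subseteq> A - {x, y}"
    using distinct_list_of_card[of 3 "A - {x, y}"] by (auto simp: length_Suc_conv numeral_3_eq_3)
  obtain b1 b2 b3 b4 where b: "distinct [b1, b2, b3, b4]" "{b1, b2, b3, b4} \<subseteq> B"
    using distinct_list_of_card[OF assms(3)] by (auto simp: length_Suc_conv numeral_eq_Suc)
  have e: "ad c a b" "ad c b a" "a \<noteq> b" "b \<noteq> a" if "a \<in> A" "b \<in> B" for a b
    using joinedD[OF j that] ad_sym ad_neq by blast+
  show False
    by (rule C9[of c x y b1 p b2 q b3 r b4]) (use pqr b assms(4,5) xy e ad_neq[OF xy] in auto)
qed

lemma joined_universal_vertex:
  assumes j: "joined c A B" and "card A \<ge> 4" "card B \<ge> 4" "joined c {s} A" "joined c {s} B"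
  shows False
proof -
  obtain a1 a2 a3 a4 where a: "distinct [a1, a2, a3, a4]" "{a1, a2, a3, a4} \<subseteq> A"
    using distinct_list_of_card[OF assms(2)] by (auto simp: length_Suc_conv numeral_eq_Suc)
  obtain b1 b2 b3 b4 where b: "distinct [b1, b2, b3, b4]" "{b1, b2, b3, b4} \<subseteq> B"
    using distinct_list_of_card[OF assms(3)] by (auto simp: length_Suc_conv numeral_eq_Suc)
  have e: "ad c a b" "ad c b a" "a \<noteq> b" "b \<noteq> a" if "a \<in> A" "b \<in> B" for a b
    using joinedD[OF j that] ad_sym ad_neq by blast+
  have s: "ad c s a" "ad c a s" "a \<noteq> s" "s \<noteq> a" if "a \<in> A \<union> B" for a
    using that assms(4,5) ad_sym ad_neq unfolding joined_def by blast+
  show False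
    by (rule C9[of c a1 b1 a2 b2 a3 b3 a4 b4 s]) (use a b e s in auto)
qed

text \<open>Sort nine vertices by part. Parts have at most 4 vertices, so positions at distance 4 or
  more lie in different parts. The order 0, 4, 8, 3, 7, 2, 6, 1, 5 of the multiples of 4 modulo 9
  makes only jumps of 4 and 5.\<close>

lemma no_multipartite:
  fixes p :: "'a \<Rightarrow> 'b"
  assumes "card U \<ge> 9"
    and edge: "\<And>x y. x \<in> U \<Longrightarrow> y \<in> U \<Longrightarrow> p x \<noteq> p y \<Longrightarrow> ad c x y"
    and small: "\<And>x. x \<in> U \<Longrightarrow> card {y \<in> U. p y = p x} \<le> 4"
  shows False
proof -
  obtain ys where ys: "length ys = 9" "distinct ys" "set ys \<subseteq> U"
    using distinct_list_of_card[OF assms(1)] by blast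
  \<comment> \<open>The labels carry no order; g turns them into sort keys.\<close>
  obtain g :: "'b \<Rightarrow> nat" where g: "inj_on g (p ` set ys)"
    using finite_imp_inj_to_nat_seg[of "p ` set ys"] by auto
  define xs where "xs = sort_key (g \<circ> p) ys"
  have xs: "length xs = 9" "distinct xs" "set xs \<subseteq> U" and sorted: "sorted (map (g \<circ> p) xs)"
    using ys unfolding xs_def by simp_all
  have inU: "finite U" using assms(1) by (metis card.infinite not_numeral_le_zero)
  have ad: "ad c (xs ! i) (xs ! j)" if ij: "i + 4 \<le> j" "j < 9" for i j
  proof (rule edge)
    show "xs ! i \<in> U" "xs ! j \<in> U" using xs ij by (auto intro: nth_mem)
    show "p (xs ! i) \<noteq> p (xs ! j)"
    proof
      assume eq: "p (xs ! i) = p (xs ! j)"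
      have "p (xs ! m) = p (xs ! i)" if m: "m \<in> {i..i + 4}" for m
      proof -
        have "(g \<circ> p) (xs ! i) \<le> (g \<circ> p) (xs ! m)" "(g \<circ> p) (xs ! m) \<le> (g \<circ> p) (xs ! j)"
          using sorted_nth_mono[OF sorted, of i m] sorted_nth_mono[OF sorted, of m j] m ij xs(1)
          by simp_all
        then have "g (p (xs ! m)) = g (p (xs ! i))" using eq by simp
        moreover have "xs ! m \<in> set ys" "xs ! i \<in> set ys"
          using nth_mem[of m xs] nth_mem[of i xs] m ij xs(1) unfolding xs_def by simp_all
        ultimately show ?thesis using g by (simp add: inj_on_eq_iff)
      qed
      moreover have "xs ! m \<in> U" if "m \<in> {i..i + 4}" for m
        using that xs ij nth_mem[of m xs] by auto
      ultimately have "(!) xs ` {i..i + 4} \<subseteq> {y \<in> U. p y = p (xs ! i)}" by blast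
      then have "card ((!) xs ` {i..i + 4}) \<le> card {y \<in> U. p y = p (xs ! i)}"
        using inU by (intro card_mono) auto
      moreover have "card ((!) xs ` {i..i + 4}) = 5"
        using xs ij by (subst card_image) (auto intro!: inj_on_nth)
      ultimately show False using small[OF \<open>xs ! i \<in> U\<close>] by simp
    qed
  qed
  then have ad': "ad c (xs ! j) (xs ! i)" if "i + 4 \<le> j" "j < 9" for i j
    using that ad_sym by blast
  have d: "xs ! i \<noteq> xs ! j" if "i < 9" "j < 9" "i \<noteq> j" for i j
    using xs that by (simp add: nth_eq_iff_index_eq)
  show False
    by (rule C9[of c "xs ! 0" "xs ! 4" "xs ! 8" "xs ! 3" "xs ! 7" "xs ! 2" "xs ! 6" "xs ! 1"
        "xs ! 5"]) (use ad ad' d in simp_all)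
qed

lemma no_clique: "card U \<ge> 9 \<Longrightarrow> (\<And>x y. x \<in> U \<Longrightarrow> y \<in> U \<Longrightarrow> x \<noteq> y \<Longrightarrow> ad c x y) \<Longrightarrow> False"
proof (rule no_multipartite[of U id c])
  fix x assume "x \<in> U"
  then have "{y \<in> U. id y = id x} = {x}" by auto
  then show "card {y \<in> U. id y = id x} \<le> 4" by simp
qed auto

text \<open>Three vertices of S link any three disjoint c-paths with 6 vertices of R in total into a
  C9. If R has two disjoint c-edges xy and zu, a c-edge that avoids x, y, z is either disjoint from
  u, giving paths of orders 2, 2, 2, or it contains u, giving orders 3, 2, 1; the single vertex t of
  the latter is where 6 vertices are needed.\<close>

lemma three_universal_vertices:
  assumes j: "joined c S R" and "card S \<ge> 3" "card R \<ge> 6"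
  obtains R' where "R' \<subseteq> R" "card R' \<ge> card R - 3" "\<And>x y. x \<in> R' \<Longrightarrow> y \<in> R' \<Longrightarrow> \<not> ad c x y"
proof -
  obtain s1 s2 s3 where s: "distinct [s1, s2, s3]" "{s1, s2, s3} \<subseteq> S"
    using distinct_list_of_card[OF assms(2)] by (auto simp: length_Suc_conv numeral_eq_Suc)
  have e: "ad c a b" "ad c b a" "a \<noteq> b" "b \<noteq> a" if "a \<in> S" "b \<in> R" for a b
    using joinedD[OF j that] ad_sym ad_neq by blast+
  show thesis
  proof (cases "\<exists>x y z u. {x, y, z, u} \<subseteq> R \<and> distinct [x, y, z, u] \<and> ad c x y \<and> ad c z u")
    case False
    show thesis
    proof (cases "\<exists>x\<in>R. \<exists>y\<in>R. ad c x y")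
      case True
      then obtain x y where xy: "x \<in> R" "y \<in> R" "ad c x y" by blast
      have "\<not> ad c z u" if "z \<in> R - {x, y}" "u \<in> R - {x, y}" for z u
      proof
        assume zu: "ad c z u"
        have "{x, y, z, u} \<subseteq> R \<and> distinct [x, y, z, u]"
          using that xy ad_neq[OF xy(3)] ad_neq[OF zu] by auto
        then show False using False xy(3) zu by blast
      qed
      moreover have "card (R - {x, y}) \<ge> card R - 3"
        using card_Diff_ge[of "{x, y}" R] ad_neq[OF xy(3)] by simp
      ultimately show thesis using that[of "R - {x, y}"] by blast
    next
      case False
      then show thesis using that[of R] by auto
    qed
  next
    case True
    then obtain x y z u where xyzu: "{x, y, z, u} \<subseteq> R" "distinct [x, y, z, u]"
      and xy: "ad c x y" and zu: "ad c z u" by blast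
    have "\<not> ad c v w" if v: "v \<in> R - {x, y, z}" and w: "w \<in> R - {x, y, z}" for v w
    proof
      assume vw: "ad c v w"
      have P: False if "ad c u w" "w \<in> R - {x, y, z, u}" for w
      proof -
        have "card (R - {x, y, z, u, w}) \<ge> 1"
          using card_Diff_ge[of "{x, y, z, u, w}" R] card_length[of "[x, y, z, u, w]"] assms(3) by simp
        then obtain t where t: "t \<in> R - {x, y, z, u, w}" using ex_of_card by blast
        show False
          by (rule C9[of c z u w s1 x y s2 t s3]) (use s e xyzu xy zu that t in auto)
      qed
      consider "v = u" | "w = u" | "v \<noteq> u" "w \<noteq> u" by blast
      then show False
      proof cases
        case 1
        then show False using P[of w] vw w ad_neq[OF vw] by auto
      next
        case 2
        then show False using P[of v] ad_sym[OF vw] v ad_neq[OF vw] by auto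
      next
        case 3
        show False
          by (rule C9[of c x y s1 z u s2 v w s3])
            (use s e xyzu xy zu vw v w 3 ad_neq[OF vw] in auto)
      qed
    qed
    moreover have "card (R - {x, y, z}) \<ge> card R - 3"
      using card_Diff_ge[of "{x, y, z}" R] xyzu(2) by simp
    ultimately show thesis using that[of "R - {x, y, z}"] by blast
  qed
qed

text \<open>The path b, p, q, b' has both ends in B; three vertices of W and two more of B lead back
  from b' to b, which makes 4 + 3 + 2 = 9.\<close>

lemma no_disjoint_attachments:
  assumes j: "joined c W B" and "card W \<ge> 3" "card B \<ge> 4"
    and p: "ad c p q" "p \<notin> W" "q \<notin> W" "p \<notin> B" "q \<notin> B"
    and b: "b \<in> B" "ad c p b" "b' \<in> B" "ad c q b'" "b \<noteq> b'"
  shows False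
proof -
  obtain w1 w2 w3 where w: "distinct [w1, w2, w3]" "{w1, w2, w3} \<subseteq> W"
    using distinct_list_of_card[OF assms(2)] by (auto simp: length_Suc_conv numeral_eq_Suc)
  have "card (B - {b, b'}) \<ge> 2"
    using card_Diff_ge[of "{b, b'}" B] assms(3) b(5) by simp
  then obtain b1 b2 where b12: "b1 \<in> B - {b, b'}" "b2 \<in> B - {b, b'}" "b1 \<noteq> b2"
    by (rule two_of_card)
  have e: "ad c x y" "ad c y x" "x \<noteq> y" "y \<noteq> x" if "x \<in> W" "y \<in> B" for x y
    using joinedD[OF j that] ad_sym ad_neq by blast+
  show False
    by (rule C9[of c p q b' w1 b1 w2 b2 w3 b])
      (use w b12 e p b ad_sym[OF b(2)] ad_neq[OF p(1)] in auto)
qed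

end

section \<open>Enlarging a monochromatic cycle to length 8\<close>

text \<open>A cycle is a map of period n on all naturals, so that rotations become shifts and arcs
  become index intervals without wrap-around.\<close>

definition periodic_cycle :: "('a \<Rightarrow> 'a \<Rightarrow> bool) \<Rightarrow> nat \<Rightarrow> (nat \<Rightarrow> 'a) \<Rightarrow> bool" where
  "periodic_cycle r n g \<longleftrightarrow>
     (\<forall>i. r (g i) (g (Suc i))) \<and> (\<forall>i j. g i = g j \<longleftrightarrow> i mod n = j mod n)"

lemma periodic_cycle_of_list:
  assumes "cyc r xs"
  shows "periodic_cycle r (length xs) (\<lambda>i. xs ! (i mod length xs))"
proof -
  let ?n = "length xs"
  have n: "?n > 0" and d: "distinct xs" using assms unfolding cyc_def by auto
  have "r (xs ! (i mod ?n)) (xs ! (Suc i mod ?n))" for i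
  proof (cases "Suc (i mod ?n) = ?n")
    case True
    then have "Suc i mod ?n = 0" by (simp add: mod_Suc)
    moreover have "i mod ?n = ?n - 1" using True by simp
    ultimately show ?thesis
      using assms last_conv_nth[of xs] hd_conv_nth[of xs] n unfolding cyc_def by auto
  next
    case False
    then have "Suc i mod ?n = Suc (i mod ?n)" by (simp add: mod_Suc)
    moreover have "Suc (i mod ?n) < ?n" using False n by (simp add: Suc_lessI)
    ultimately show ?thesis
      using assms unfolding cyc_def successively_conv_nth by simp
  qed
  then show ?thesis
    unfolding periodic_cycle_def using n d by (simp add: nth_eq_iff_index_eq)
qed

lemma periodic_cycle_shift:
  assumes "periodic_cycle r n g"
  shows "periodic_cycle r n (\<lambda>i. g (i + k))"
proof -
  have "(i + k) mod n = (j + k) mod n \<longleftrightarrow> i mod n = j mod n" for i j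
    unfolding nat_mod_eq_iff by (simp add: ac_simps)
  then show ?thesis using assms unfolding periodic_cycle_def by simp
qed

context c9_free
begin

definition two_colored :: "'c \<Rightarrow> 'c \<Rightarrow> 'a set \<Rightarrow> bool" where
  "two_colored c d V \<longleftrightarrow> (\<forall>x\<in>V. \<forall>y\<in>V. x \<noteq> y \<longrightarrow> ad c x y \<or> ad d x y)"

definition mono_cycle :: "'c \<Rightarrow> 'c \<Rightarrow> 'a set \<Rightarrow> nat \<Rightarrow> bool" where
  "mono_cycle c d V n \<longleftrightarrow> (\<exists>e\<in>{c, d}. \<exists>xs. cyc (ad e) xs \<and> length xs = n \<and> set xs \<subseteq> V)"

lemma two_coloredD: "two_colored c d V \<Longrightarrow> x \<in> V \<Longrightarrow> y \<in> V \<Longrightarrow> x \<noteq> y \<Longrightarrow> \<not> ad c x y \<Longrightarrow> ad d x y"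
  unfolding two_colored_def by blast

lemma two_colored_sym: "two_colored c d V \<longleftrightarrow> two_colored d c V"
  unfolding two_colored_def by blast

lemma mono_sym: "mono_cycle c d V n \<longleftrightarrow> mono_cycle d c V n"
  unfolding mono_cycle_def by blast

lemma mono1: "cyc (ad c) xs \<Longrightarrow> set xs \<subseteq> V \<Longrightarrow> length xs = n \<Longrightarrow> mono_cycle c d V n"
  unfolding mono_cycle_def by blast

lemma mono2: "cyc (ad d) xs \<Longrightarrow> set xs \<subseteq> V \<Longrightarrow> length xs = n \<Longrightarrow> mono_cycle c d V n"
  unfolding mono_cycle_def by blast

lemma mono_cases:
  assumes "mono_cycle c d V n"
  obtains g where "periodic_cycle (ad c) n g" "range g \<subseteq> V"
  | g where "periodic_cycle (ad d) n g" "range g \<subseteq> V"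
proof -
  obtain e xs where e: "e = c \<or> e = d" and xs: "cyc (ad e) xs" "length xs = n" "set xs \<subseteq> V"
    using assms unfolding mono_cycle_def by blast
  have "n > 0" using xs unfolding cyc_def by auto
  then have "range (\<lambda>i. xs ! (i mod length xs)) \<subseteq> V" using xs by fastforce
  then show thesis using e xs periodic_cycle_of_list[OF xs(1)] that by blast
qed

lemma card_range_cycle:
  assumes "periodic_cycle r n g" "n > 0"
  shows "finite (range g)" "card (range g) = n"
proof -
  have eq: "g i = g j \<longleftrightarrow> i mod n = j mod n" for i j
    using assms unfolding periodic_cycle_def by blast
  have "g i \<in> g ` {..<n}" for i
    using assms(2) eq[of i "i mod n"] by (intro image_eqI[of _ _ "i mod n"]) auto
  then have "range g = g ` {..<n}" by blast
  moreover have "inj_on g {..<n}" by (rule inj_onI) (simp add: eq)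
  ultimately show "finite (range g)" "card (range g) = n" by (simp_all add: card_image)
qed

lemma joined_even_cycle:
  assumes j: "joined c A B" and AB: "A \<subseteq> V" "B \<subseteq> V"
  shows "card A \<ge> 3 \<Longrightarrow> card B \<ge> 3 \<Longrightarrow> mono_cycle c d V 6"
    and "card A \<ge> 4 \<Longrightarrow> card B \<ge> 4 \<Longrightarrow> mono_cycle c d V 8"
proof -
  have e: "ad c a b" "ad c b a" "a \<noteq> b" "b \<noteq> a" if "a \<in> A" "b \<in> B" for a b
    using joinedD[OF j that] ad_sym ad_neq by blast+
  {
    assume "card A \<ge> 3" "card B \<ge> 3"
    then obtain a1 a2 a3 b1 b2 b3 where "distinct [a1, a2, a3]" "{a1, a2, a3} \<subseteq> A"
      "distinct [b1, b2, b3]" "{b1, b2, b3} \<subseteq> B"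
      using distinct_list_of_card[of 3 A] distinct_list_of_card[of 3 B]
      by (auto simp: length_Suc_conv numeral_eq_Suc)
    then show "mono_cycle c d V 6"
      by (intro mono1[of c "[a1, b1, a2, b2, a3, b3]"]) (use e AB in \<open>auto simp: cyc_def\<close>)
  next
    assume "card A \<ge> 4" "card B \<ge> 4"
    then obtain a1 a2 a3 a4 b1 b2 b3 b4 where "distinct [a1, a2, a3, a4]" "{a1, a2, a3, a4} \<subseteq> A"
      "distinct [b1, b2, b3, b4]" "{b1, b2, b3, b4} \<subseteq> B"
      using distinct_list_of_card[of 4 A] distinct_list_of_card[of 4 B]
      by (auto simp: length_Suc_conv numeral_eq_Suc)
    then show "mono_cycle c d V 8"
      by (intro mono1[of c "[a1, b1, a2, b2, a3, b3, a4, b4]"]) (use e AB in \<open>auto simp: cyc_def\<close>)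
  }
qed

section \<open>Monochromatic cycles of length 3, 4 and 5\<close>

lemma triangle_of_three_neighbours:
  assumes tc: "two_colored c d V" and v: "v \<in> V" and A: "A \<subseteq> V" "joined c {v} A" "card A \<ge> 3"
  shows "mono_cycle c d V 3"
proof (rule ccontr)
  assume no: "\<not> mono_cycle c d V 3"
  obtain x y z where xyz: "distinct [x, y, z]" "{x, y, z} \<subseteq> A"
    using distinct_list_of_card[OF A(3)] by (auto simp: length_Suc_conv numeral_eq_Suc)
  have v': "ad c v a" "ad c a v" "v \<noteq> a" "a \<noteq> v" if "a \<in> A" for a
    using A(2) that ad_sym ad_neq unfolding joined_def by blast+
  have d: "ad d a b" if "a \<in> A" "b \<in> A" "a \<noteq> b" for a b
  proof (rule two_coloredD[OF tc])
    show "\<not> ad c a b"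
    proof
      assume "ad c a b"
      then have "cyc (ad c) [v, a, b]" using v' that unfolding cyc_def by auto
      then show False using no mono1[of c "[v, a, b]" V 3 d] that v A(1) by auto
    qed
  qed (use that A in auto)
  have "cyc (ad d) [x, y, z]" using d xyz unfolding cyc_def by auto
  then show False using no mono2[of d "[x, y, z]" V 3 c] xyz A(1) by auto
qed

lemma mono3:
  assumes tc: "two_colored c d V" and "card V \<ge> 6"
  shows "mono_cycle c d V 3"
proof -
  obtain v where v: "v \<in> V" using assms(2) ex_of_card[of V] by auto
  let ?A = "{x \<in> V. ad c v x}" and ?B = "{x \<in> V. ad d v x}"
  have finV: "finite V" using assms(2) by (metis card.infinite not_numeral_le_zero)
  have "V - {v} \<subseteq> ?A \<union> ?B" using two_coloredD[OF tc v] by fastforce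
  then have "card (V - {v}) \<le> card ?A + card ?B"
    using finV by (intro order.trans[OF card_mono card_Un_le]) auto
  then have "card ?A \<ge> 3 \<or> card ?B \<ge> 3" using assms(2) v finV by auto
  then show ?thesis
  proof
    assume "card ?A \<ge> 3"
    then show ?thesis
      by (intro triangle_of_three_neighbours[OF tc v, of ?A]) (auto simp: joined_def)
  next
    assume "card ?B \<ge> 3"
    then have "mono_cycle d c V 3"
      by (intro triangle_of_three_neighbours[OF _ v, of d c ?B])
        (use tc two_colored_sym in \<open>auto simp: joined_def\<close>)
    then show ?thesis using mono_sym by blast
  qed
qed

text \<open>An outer vertex with two c-neighbors on the triangle gives a c-square, so each is
  d-joined to two of the three triangle vertices. Four outer vertices and three pairs: two of them
  share a pair, which gives a d-square.\<close>

lemma mono4_of_triangle: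
  assumes tc: "two_colored c d V" and V: "card V \<ge> 7"
    and g: "periodic_cycle (ad c) 3 g" "range g \<subseteq> V"
  shows "mono_cycle c d V 4"
proof (rule ccontr)
  assume no: "\<not> mono_cycle c d V 4"
  let ?W = "V - range g"
  have ge: "ad c (g i) (g (Suc i))" and [simp]: "g i = g j \<longleftrightarrow> i mod 3 = j mod 3" for i j
    using g(1) unfolding periodic_cycle_def by blast+
  have gV: "g i \<in> V" for i using g(2) by blast
  have "card ?W \<ge> 4"
    using card_range_cycle[OF g(1)] card_Diff_ge[of "range g" V] V by simp
  have wg: "w \<noteq> g i" "g i \<noteq> w" "w \<in> V" if "w \<in> ?W" for w i using that by auto
  have W: "ad d w (g i) \<or> ad d w (g (Suc i))" if w: "w \<in> ?W" for w i
  proof (rule ccontr)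
    assume "\<not> ?thesis"
    then have "ad c w (g i)" "ad c w (g (Suc i))"
      using w wg gV tc unfolding two_colored_def by metis+
    moreover have "g (Suc (Suc (Suc i))) = g i" by simp
    then have "ad c (g (Suc (Suc i))) (g i)" using ge[of "Suc (Suc i)"] by metis
    ultimately have "cyc (ad c) [g i, w, g (Suc i), g (Suc (Suc i))]"
      using wg[OF w] ge ad_sym unfolding cyc_def by (auto simp: mod_Suc)
    then show False
      using no mono1[of c "[g i, w, g (Suc i), g (Suc (Suc i))]" V 4 d] gV wg(3)[OF w] by simp
  qed
  \<comment> \<open>The default 2 stands for the pair \<open>g 2\<close>, \<open>g 0\<close>, the
    only one left.\<close>
  define m :: "'a \<Rightarrow> nat" where "m w = (if ad d w (g 0) \<and> ad d w (g 1) then 0 else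
     if ad d w (g 1) \<and> ad d w (g 2) then 1 else 2)" for w
  have "m ` ?W \<subseteq> {0, 1, 2}" unfolding m_def by auto
  then have "card (m ` ?W) \<le> card {0 :: nat, 1, 2}" by (intro card_mono) auto
  then have "\<not> inj_on m ?W" using \<open>card ?W \<ge> 4\<close> card_image by fastforce
  then obtain w w' where w: "w \<in> ?W" "w' \<in> ?W" "w \<noteq> w'" "m w = m w'"
    unfolding inj_on_def by blast
  have "\<exists>i j. g i \<noteq> g j \<and> ad d w (g i) \<and> ad d w (g j) \<and> ad d w' (g i) \<and> ad d w' (g j)"
  proof -
    have "ad d x (g 0) \<and> ad d x (g 1) \<and> m x = 0 \<or> ad d x (g 1) \<and> ad d x (g 2) \<and> m x = 1
      \<or> ad d x (g 2) \<and> ad d x (g 0) \<and> m x = 2" if "x \<in> ?W" for x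
    proof -
      have "ad d x (g i) \<or> ad d x (g j)" if "g j = g (Suc i)" for i j
        using W[OF \<open>x \<in> ?W\<close>, of i] that by metis
      from this[of 1 0] this[of 2 1] this[of 0 2] show ?thesis unfolding m_def by simp blast
    qed
    from this[OF w(1)] this[OF w(2)] w(4) have
      "ad d w (g 0) \<and> ad d w (g 1) \<and> ad d w' (g 0) \<and> ad d w' (g 1) \<or>
       ad d w (g 1) \<and> ad d w (g 2) \<and> ad d w' (g 1) \<and> ad d w' (g 2) \<or>
       ad d w (g 2) \<and> ad d w (g 0) \<and> ad d w' (g 2) \<and> ad d w' (g 0)" by auto
    moreover have "g 0 \<noteq> g 1" "g 1 \<noteq> g 2" "g 2 \<noteq> g 0" by simp_all
    ultimately show ?thesis by metis
  qed
  then obtain a b where ab: "a \<in> range g" "b \<in> range g" "a \<noteq> b"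
    and e: "ad d w a" "ad d w b" "ad d w' a" "ad d w' b" by blast
  then have "cyc (ad d) [w, a, w', b]"
    using w(1-3) ad_sym[OF e(2)] ad_sym[OF e(3)] unfolding cyc_def by auto
  then show False using no mono2[of d "[w, a, w', b]" V 4 c] g(2) ab w(1,2) by auto
qed

text \<open>A vertex cover of a square contains one of its two diagonals. Of 13 - 4 = 9 outer
  vertices, five share a diagonal; a d-edge among them gives a d-pentagon through the diagonal, and
  otherwise the five form a c-clique.\<close>

lemma mono5_of_square:
  assumes tc: "two_colored c d V" and V: "card V \<ge> 13"
    and g: "periodic_cycle (ad c) 4 g" "range g \<subseteq> V"
  shows "mono_cycle c d V 5"
proof (rule ccontr)
  assume no: "\<not> mono_cycle c d V 5"
  let ?W = "V - range g"
  have ge: "ad c (g i) (g (Suc i))" and [simp]: "g i = g j \<longleftrightarrow> i mod 4 = j mod 4" for i j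
    using g(1) unfolding periodic_cycle_def by blast+
  have gV: "g i \<in> V" for i using g(2) by blast
  have cW: "card ?W \<ge> 9"
    using card_range_cycle[OF g(1)] card_Diff_ge[of "range g" V] V by simp
  have finV: "finite V" using V by (metis card.infinite not_numeral_le_zero)
  have wg: "w \<noteq> g i" "g i \<noteq> w" "w \<in> V" if "w \<in> ?W" for w i using that by auto
  have W: "ad d w (g i) \<or> ad d w (g (Suc i))" if w: "w \<in> ?W" for w i
  proof (rule ccontr)
    assume "\<not> ?thesis"
    then have r: "ad c w (g i)" "ad c w (g (Suc i))"
      using w wg gV tc unfolding two_colored_def by metis+
    have "g (Suc (Suc (Suc (Suc i)))) = g i" by simp
    then have "ad c (g (Suc (Suc (Suc i)))) (g i)" using ge[of "Suc (Suc (Suc i))"] by metis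
    then have "cyc (ad c) [g i, w, g (Suc i), g (Suc (Suc i)), g (Suc (Suc (Suc i)))]"
      using wg[OF w] ge ad_sym r unfolding cyc_def by (auto simp: mod_Suc)
    then show False
      using no mono1[of c "[g i, w, g (Suc i), g (Suc (Suc i)), g (Suc (Suc (Suc i)))]" V 5 d]
        gV wg(3)[OF w] by simp
  qed
  have small: "card T < 5"
    if T: "T \<subseteq> ?W" and ab: "a \<in> range g" "b \<in> range g" "a \<noteq> b" and j: "joined d T {a, b}" for T a b
  proof (rule ccontr)
    assume "\<not> card T < 5"
    then obtain t1 t2 t3 t4 t5 where t: "distinct [t1, t2, t3, t4, t5]" "{t1, t2, t3, t4, t5} \<subseteq> T"
      using distinct_list_of_card[of 5 T] by (auto simp: length_Suc_conv numeral_eq_Suc)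
    have e: "ad d x y" "ad d y x" "x \<noteq> y" "y \<noteq> x" if "x \<in> T" "y \<in> {a, b}" for x y
      using joinedD[OF j that] ad_sym ad_neq by blast+
    have r: "ad c x y" if xy: "x \<in> T" "y \<in> T" "x \<noteq> y" for x y
    proof (rule ccontr)
      assume "\<not> ad c x y"
      then have b: "ad d x y" using two_coloredD[OF tc] xy T by blast
      have "card (T - {x, y}) \<ge> 1"
        using card_Diff_ge[of "{x, y}" T] \<open>\<not> card T < 5\<close> card_length[of "[x, y]"] by simp
      then obtain z where z: "z \<in> T - {x, y}" using ex_of_card by blast
      then have "cyc (ad d) [x, y, a, z, b]"
        using xy b e ab unfolding cyc_def by auto
      then show False
        using no mono2[of d "[x, y, a, z, b]" V 5 c] xy z T ab g(2) by auto
    qed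
    then have "cyc (ad c) [t1, t2, t3, t4, t5]" using t unfolding cyc_def by auto
    then show False using no mono1[of c "[t1, t2, t3, t4, t5]" V 5 d] t T by auto
  qed
  let ?E = "{w \<in> ?W. ad d w (g 1) \<and> ad d w (g 3)}" and ?O = "{w \<in> ?W. ad d w (g 0) \<and> ad d w (g 2)}"
  have "?W \<subseteq> ?E \<union> ?O"
  proof
    fix w assume w: "w \<in> ?W"
    have "ad d w (g i) \<or> ad d w (g j)" if "g j = g (Suc i)" for i j
      using W[OF w, of i] that by metis
    from this[of 1 0] this[of 2 1] this[of 3 2] this[of 0 3] show "w \<in> ?E \<union> ?O"
      using w by simp blast
  qed
  then have "card ?W \<le> card ?E + card ?O"
    using finV by (intro order.trans[OF card_mono card_Un_le]) auto
  moreover have "card ?E < 5"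
    by (rule small[of _ "g 1" "g 3"]) (auto simp: joined_def)
  moreover have "card ?O < 5"
    by (rule small[of _ "g 0" "g 2"]) (auto simp: joined_def)
  ultimately show False using cW by simp
qed

end

text \<open>The arc from \<open>g i\<close> to \<open>g (i + l)\<close> is replaced by the path ws,
  so the new length is n - l + 1 plus the length of ws. The index interval ends at i + n, which
  denotes \<open>g i\<close> again.\<close>

lemma cyc_reroute:
  assumes g: "periodic_cycle r n g" and ws: "ws \<noteq> []" "distinct ws" "set ws \<inter> range g = {}"
    "successively r ws" and r: "r (g i) (hd ws)" "r (last ws) (g (i + l))"
    and l: "1 \<le> l" "l \<le> n"
  shows "cyc r (ws @ map g [i + l..<Suc (i + n)])"
proof -
  have ge: "r (g i) (g (Suc i))" and gm: "g i = g j \<longleftrightarrow> i mod n = j mod n" for i j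
    using g unfolding periodic_cycle_def by blast+
  have inj: "x = y" if "g x = g y" "x \<le> y" "i + l \<le> x" "y < Suc (i + n)" for x y
  proof -
    have "n dvd y - x" using that gm mod_eq_dvd_iff_nat[OF that(2), of n] by metis
    moreover have "y - x < n" using that l by linarith
    ultimately have "y - x = 0" by (metis dvd_imp_le gr0I not_le)
    then show ?thesis using that(2) by simp
  qed
  have "inj_on g {i + l..<Suc (i + n)}"
    by (rule inj_onI) (metis atLeastLessThan_iff inj nle_le)
  moreover have "successively r (map g [i + l..<Suc (i + n)])"
    unfolding successively_conv_nth using ge by (simp del: upt_Suc)
  moreover have "map g [i + l..<Suc (i + n)] \<noteq> []" using l by simp
  moreover have "last (map g [i + l..<Suc (i + n)]) = g i"
    using l gm[of "i + n" i] by simp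
  moreover have "hd (map g [i + l..<Suc (i + n)]) = g (i + l)"
    using l by (simp del: upt_Suc add: hd_map)
  ultimately show ?thesis
    using ws r unfolding cyc_def
    by (auto simp: distinct_map successively_append_iff simp del: upt_Suc map_append)
qed

context c9_free
begin

lemma mono_reroute:
  assumes g: "periodic_cycle (ad c) n g" "range g \<subseteq> V"
    and ws: "ws \<noteq> []" "distinct ws" "set ws \<subseteq> V - range g" "successively (ad c) ws"
    and r: "ad c (hd ws) (g i)" "ad c (last ws) (g (i + l))"
    and l: "1 \<le> l" "l \<le> n" "length ws + n + 1 = m + l"
  shows "mono_cycle c d V m"
proof (rule mono1[OF cyc_reroute[OF g(1) ws(1,2) _ ws(4) _ r(2) l(1,2)]])
  show "set ws \<inter> range g = {}" "set (ws @ map g [i + l..<Suc (i + n)]) \<subseteq> V"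
    using ws(3) g(2) by (auto simp del: upt_Suc)
  show "ad c (g i) (hd ws)" using r(1) by (rule ad_sym)
  show "length (ws @ map g [i + l..<Suc (i + n)]) = m" using l by simp
qed

text \<open>Two consecutive c-neighbors would let w be inserted between them. The index j is kept
  apart from \<open>Suc i\<close> so that the closing edge of the cycle can be named by small
  indices.\<close>

lemma cycle_vertex_cover:
  assumes tc: "two_colored c d V" and no: "\<not> mono_cycle c d V (Suc n)" and n: "n \<ge> 1"
    and g: "periodic_cycle (ad c) n g" "range g \<subseteq> V" and w: "w \<in> V - range g"
    and j: "g j = g (Suc i)"
  shows "ad d w (g i) \<or> ad d w (g j)"
proof (rule ccontr)
  assume contr: "\<not> ?thesis"
  have "w \<in> V" "g i \<in> V" "w \<noteq> g i" for i using g(2) w by auto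
  then have "ad c w (g i)" "ad c w (g (i + 1))"
    using contr j tc unfolding two_colored_def by auto
  then have "mono_cycle c d V (Suc n)"
    using w n by (intro mono_reroute[OF g, of "[w]" i 1]) auto
  then show False using no by blast
qed

lemma card_cycle_complement:
  assumes "periodic_cycle r n g" "n > 0" "card V \<ge> m + n" "m > 0"
  shows "card (V - range g) \<ge> m" "finite (V - range g)"
proof -
  show "card (V - range g) \<ge> m"
    using card_range_cycle[OF assms(1,2)] card_Diff_ge[of "range g" V] assms(3) by simp
  then show "finite (V - range g)" using assms(4) by (metis card.infinite not_le)
qed

text \<open>The minimal vertex covers of a pentagon are the rotations of {1, 3, 4}, so each outer
  vertex has a type t with \<open>blue t\<close>. At most two share a type, since K_{3,3} contains a
  hexagon. Eight vertices repeat some type t, and then a vertex of type t + 2 or t + 3 would close a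
  d-hexagon; the three types left hold at most six vertices.\<close>

lemma mono6_of_pentagon:
  assumes tc: "two_colored c d V" and V: "card V \<ge> 13"
    and g: "periodic_cycle (ad c) 5 g" "range g \<subseteq> V"
  shows "mono_cycle c d V 6"
proof (rule ccontr)
  assume no: "\<not> mono_cycle c d V 6"
  let ?W = "V - range g"
  have gm: "g i = g j \<longleftrightarrow> i mod 5 = j mod 5" for i j
    using g(1) unfolding periodic_cycle_def by blast
  have gs: "g (t + i) = g (t + j) \<longleftrightarrow> i mod 5 = j mod 5" for t i j
    unfolding gm nat_mod_eq_iff by (simp add: ac_simps)
  have cW: "card ?W \<ge> 8" and finW: "finite ?W"
    using card_cycle_complement[OF g(1), of 8 V] V by simp_all
  define blue where "blue t w \<longleftrightarrow> ad d w (g (t + 1)) \<and> ad d w (g (t + 3)) \<and> ad d w (g (t + 4))"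
    for t w
  have blue_mod: "blue (t mod 5) w \<longleftrightarrow> blue t w" for t w
  proof -
    have "g (t mod 5 + k) = g (t + k)" for k unfolding gm by (simp add: mod_add_left_eq)
    then show ?thesis unfolding blue_def by (simp only:)
  qed
  have "\<exists>t<5. blue t w" if w: "w \<in> ?W" for w
  proof -
    have "ad d w (g i) \<or> ad d w (g j)" if "j mod 5 = Suc i mod 5" for i j
      by (rule cycle_vertex_cover[OF tc _ _ g w]) (use no that gm in auto)
    from this[of 1 0] this[of 2 1] this[of 3 2] this[of 4 3] this[of 0 4]
    have "(ad d w (g 1) \<and> ad d w (g 3) \<and> ad d w (g 4)) \<or>
      (ad d w (g 2) \<and> ad d w (g 4) \<and> ad d w (g 0)) \<or>
      (ad d w (g 3) \<and> ad d w (g 0) \<and> ad d w (g 1)) \<or>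
      (ad d w (g 4) \<and> ad d w (g 1) \<and> ad d w (g 2)) \<or>
      (ad d w (g 0) \<and> ad d w (g 2) \<and> ad d w (g 3))" by simp blast
    moreover have "g 5 = g 0" "g 6 = g 1" "g 7 = g 2" "g 8 = g 3" unfolding gm by simp_all
    ultimately have "blue 0 w \<or> blue 1 w \<or> blue 2 w \<or> blue 3 w \<or> blue 4 w"
      unfolding blue_def by (auto simp: numeral_2_eq_2[symmetric])
    then have "\<exists>t\<in>{0, 1, 2, 3, 4}. blue t w" by simp
    then obtain t where "t \<in> {0, 1, 2, 3, 4}" "blue t w" by blast
    then show ?thesis by (intro exI[of _ t]) auto
  qed
  then obtain \<tau> where \<tau>: "\<And>w. w \<in> ?W \<Longrightarrow> \<tau> w < 5 \<and> blue (\<tau> w) w" by metis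
  let ?A = "\<lambda>t. {w \<in> ?W. \<tau> w = t}"
  have A3: "card (?A t) < 3" for t
  proof (rule ccontr)
    assume "\<not> ?thesis"
    have "mono_cycle d c V 6"
    proof (rule joined_even_cycle(1))
      show "joined d (?A t) {g (t + 1), g (t + 3), g (t + 4)}"
        using \<tau> unfolding joined_def blue_def by auto
      have "distinct [g (t + 1), g (t + 3), g (t + 4)]"
        using gs[of t 1 3] gs[of t 1 4] gs[of t 3 4] by simp
      then show "3 \<le> card {g (t + 1), g (t + 3), g (t + 4)}" by simp
    qed (use \<open>\<not> card (?A t) < 3\<close> g(2) in auto)
    then show False using no mono_sym by blast
  qed
  have "\<not> inj_on \<tau> ?W"
  proof
    assume "inj_on \<tau> ?W"
    then have "card ?W = card (\<tau> ` ?W)" by (simp add: card_image)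
    also have "\<dots> \<le> card {..<5::nat}" using \<tau> by (intro card_mono) auto
    finally show False using cW by simp
  qed
  then obtain w w' where w: "w \<in> ?W" "w' \<in> ?W" "w \<noteq> w'" "\<tau> w = \<tau> w'"
    unfolding inj_on_def by blast
  define t where "t = \<tau> w"
  have bw: "blue t w" "blue t w'" "t < 5" using \<tau> w unfolding t_def by metis+
  have wg: "x \<noteq> g i" "g i \<noteq> x" "x \<in> V" if "x \<in> ?W" for x i using that by auto
  have gV: "g i \<in> V" for i using g(2) by blast
  have g61: "g (t + 6) = g (t + 1)" using gs[of t 6 1] by simp
  have mod5: "u = t \<or> u = (t + 1) mod 5 \<or> u = (t + 4) mod 5 \<or> u = (t + 2) mod 5 \<or> u = (t + 3) mod 5"
    if "u < 5" for u
  proof -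
    have "t = 0 \<or> t = 1 \<or> t = 2 \<or> t = 3 \<or> t = 4" using bw(3) by linarith
    moreover have "u = 0 \<or> u = 1 \<or> u = 2 \<or> u = 3 \<or> u = 4" using that by linarith
    ultimately show ?thesis by auto
  qed
  have "\<tau> x = t \<or> \<tau> x = (t + 1) mod 5 \<or> \<tau> x = (t + 4) mod 5" if x: "x \<in> ?W" for x
  proof (rule ccontr)
    assume contr: "\<not> ?thesis"
    have "x \<noteq> w" "x \<noteq> w'" using contr w unfolding t_def by auto
    have "\<tau> x = (t + 2) mod 5 \<or> \<tau> x = (t + 3) mod 5" using contr \<tau>[OF x] bw(3) mod5 by blast
    then have "blue (t + 2) x \<or> blue (t + 3) x" using \<tau>[OF x] blue_mod by metis
    then show False
    proof
      assume b: "blue (t + 2) x"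
      have m: "g (t + 2 + 4) = g (t + 1)" "g (t + 2 + 1) = g (t + 3)"
        using g61 by (simp_all add: eval_nat_numeral)
      have b': "ad d x (g (t + 1))" "ad d x (g (t + 3))" using b m unfolding blue_def by simp_all
      have ne: "distinct [g (t + 4), g (t + 1), g (t + 3)]"
        using gs[of t 4 1] gs[of t 1 3] gs[of t 4 3] by simp
      have s: "ad d (g (t + 4)) w'" "ad d (g (t + 1)) x" "ad d (g (t + 3)) w"
        using bw b' unfolding blue_def by (blast intro: ad_sym)+
      have "cyc (ad d) [w, g (t + 4), w', g (t + 1), x, g (t + 3)]"
        using s bw(1,2) b' w(3) wg(1,2)[OF w(1)] wg(1,2)[OF w(2)] wg(1,2)[OF x] ne \<open>x \<noteq> w\<close> \<open>x \<noteq> w'\<close> unfolding cyc_def blue_def by simp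
      then show False
        using no mono2[of d "[w, g (t + 4), w', g (t + 1), x, g (t + 3)]" V 6 c] wg(3) w(1,2) x gV by simp
    next
      assume b: "blue (t + 3) x"
      have m: "g (t + 3 + 3) = g (t + 1)" "g (t + 3 + 1) = g (t + 4)"
        using g61 by (simp_all add: eval_nat_numeral)
      have b': "ad d x (g (t + 1))" "ad d x (g (t + 4))" using b m unfolding blue_def by simp_all
      have ne: "distinct [g (t + 3), g (t + 1), g (t + 4)]"
        using gs[of t 3 1] gs[of t 1 4] gs[of t 3 4] by simp
      have s: "ad d (g (t + 3)) w'" "ad d (g (t + 1)) x" "ad d (g (t + 4)) w"
        using bw b' unfolding blue_def by (blast intro: ad_sym)+
      have "cyc (ad d) [w, g (t + 3), w', g (t + 1), x, g (t + 4)]"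
        using s bw(1,2) b' w(3) wg(1,2)[OF w(1)] wg(1,2)[OF w(2)] wg(1,2)[OF x] ne \<open>x \<noteq> w\<close> \<open>x \<noteq> w'\<close> unfolding cyc_def blue_def by simp
      then show False
        using no mono2[of d "[w, g (t + 3), w', g (t + 1), x, g (t + 4)]" V 6 c] wg(3) w(1,2) x gV by simp
    qed
  qed
  then have "?W \<subseteq> ?A t \<union> (?A ((t + 1) mod 5) \<union> ?A ((t + 4) mod 5))" by blast
  then have "card ?W \<le> card (?A t \<union> (?A ((t + 1) mod 5) \<union> ?A ((t + 4) mod 5)))"
    using finW by (intro card_mono finite_UnI) (auto intro: rev_finite_subset)
  also have "\<dots> \<le> card (?A t) + (card (?A ((t + 1) mod 5)) + card (?A ((t + 4) mod 5)))"
    by (meson add_left_mono card_Un_le le_trans)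
  finally show False using cW A3[of t] A3[of "(t + 1) mod 5"] A3[of "(t + 4) mod 5"] by linarith
qed

end

text \<open>The complement of \<open>{t, t + 2, t + 4}\<close>, a maximal independent set of the 7-cycle.\<close>

definition hept :: "nat \<Rightarrow> nat set" where
  "hept t = {(t + 1) mod 7, (t + 3) mod 7, (t + 5) mod 7, (t + 6) mod 7}"

lemma card_hept: "card (hept t) = 4"
proof -
  have "inj_on (\<lambda>i. (t + i) mod 7) {1, 3, 5, 6}"
  proof (rule inj_onI)
    fix i j :: nat assume ij: "i \<in> {1, 3, 5, 6}" "j \<in> {1, 3, 5, 6}" "(t + i) mod 7 = (t + j) mod 7"
    have "i mod 7 = j mod 7" using ij(3) unfolding nat_mod_eq_iff by (simp add: ac_simps)
    then show "i = j" using ij(1,2) by auto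
  qed
  moreover have "hept t = (\<lambda>i. (t + i) mod 7) ` {1, 3, 5, 6}" unfolding hept_def by simp
  ultimately show ?thesis by (simp add: card_image)
qed

text \<open>For four vertices of types 0, 0, s, u in cyclic order these are distinct common
  d-neighbors of consecutive ones, that is, a d-octagon. The 28 cases are evaluated.\<close>

lemma hept_representatives:
  "\<forall>s\<in>{2, 3, 4, 5}. \<forall>u\<in>{0, 1, 2, 3, 4, 5, 6}.
     \<exists>a\<in>hept 0. \<exists>b\<in>hept s. \<exists>e\<in>hept u. \<exists>h\<in>hept 0.
       b \<in> hept 0 \<and> e \<in> hept s \<and> h \<in> hept u \<and> distinct [a, b, e, h]"
  by code_simp

context c9_free
begin

text \<open>P is a vertex cover of the 7-cycle. The maximal independent sets of that cycle are the
  seven rotations of a single one, and P contains the complement of one of them.\<close>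

lemma heptagon_type:
  assumes "\<And>i j. j mod 7 = Suc i mod 7 \<Longrightarrow> P i \<or> P j"
  shows "\<exists>t<7. \<forall>i\<in>hept t. P i"
proof -
  have "P 0 \<or> P 1" "P 1 \<or> P 2" "P 2 \<or> P 3" "P 3 \<or> P 4" "P 4 \<or> P 5" "P 5 \<or> P 6" "P 6 \<or> P 0"
    by (rule assms; simp)+
  then have "(P 1 \<and> P 3 \<and> P 5 \<and> P 6) \<or> (P 2 \<and> P 4 \<and> P 6 \<and> P 0) \<or> (P 3 \<and> P 5 \<and> P 0 \<and> P 1) \<or>
    (P 4 \<and> P 6 \<and> P 1 \<and> P 2) \<or> (P 5 \<and> P 0 \<and> P 2 \<and> P 3) \<or> (P 6 \<and> P 1 \<and> P 3 \<and> P 4) \<or>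
    (P 0 \<and> P 2 \<and> P 4 \<and> P 5)" by argo
  then have "\<exists>t\<in>{0, 1, 2, 3, 4, 5, 6}. \<forall>i\<in>hept t. P i"
    unfolding hept_def by (simp add: numeral_2_eq_2[symmetric])
  then obtain t where "t \<in> {0, 1, 2, 3, 4, 5, 6}" "\<forall>i\<in>hept t. P i" by blast
  then show ?thesis by (intro exI[of _ t]) auto
qed

text \<open>There are at least seven outer vertices and seven types. If the types are distinct, four
  of them close a d-octagon. If a type repeats, rotate it to 0: the others are confined to types 0,
  1, 6, types 1 and 6 exclude each other, and a class has at most three vertices because K_{4,4}
  contains an octagon. That leaves room for six.\<close>

lemma mono8_of_heptagon:
  assumes tc: "two_colored c d V" and V: "card V \<ge> 14"
    and g: "periodic_cycle (ad c) 7 g" "range g \<subseteq> V"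
  shows "mono_cycle c d V 8"
proof (rule ccontr)
  assume no: "\<not> mono_cycle c d V 8"
  let ?W = "V - range g"
  have gm: "g i = g j \<longleftrightarrow> i mod 7 = j mod 7" for i j
    using g(1) unfolding periodic_cycle_def by blast
  have finV: "finite V" using V by (metis card.infinite not_numeral_le_zero)
  have cW: "card ?W \<ge> 7"
    using card_cycle_complement[OF g(1), of 7 V] V by simp
  have four: False
    if w: "distinct [w1, w2, w3, w4]" "{w1, w2, w3, w4} \<subseteq> ?W"
      and v: "distinct [v1, v2, v3, v4]" "{v1, v2, v3, v4} \<subseteq> range g"
      and e: "ad d w1 v1" "ad d w2 v1" "ad d w2 v2" "ad d w3 v2" "ad d w3 v3" "ad d w4 v3"
        "ad d w4 v4" "ad d w1 v4" for w1 w2 w3 w4 v1 v2 v3 v4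
  proof -
    have "\<forall>x\<in>{w1, w2, w3, w4}. x \<notin> range g" "\<forall>y\<in>{v1, v2, v3, v4}. y \<in> range g"
      using w(2) v(2) by simp_all
    then have "\<forall>x\<in>{w1, w2, w3, w4}. \<forall>y\<in>{v1, v2, v3, v4}. x \<noteq> y" by metis
    then have "distinct [w1, v1, w2, v2, w3, v3, w4, v4]" using w(1) v(1) by auto
    then have "cyc (ad d) [w1, v1, w2, v2, w3, v3, w4, v4]"
      using e(1,3,5,7) e(2,4,6,8)[THEN ad_sym] unfolding cyc_def by simp
    then show False
      using no mono2[of d "[w1, v1, w2, v2, w3, v3, w4, v4]" V 8 c] w(2) v(2) g(2) by auto
  qed
  have type: "\<exists>t<7. \<forall>i\<in>hept t. ad d w (g (i + k))" if w: "w \<in> ?W" for w k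
  proof (rule heptagon_type)
    fix i j :: nat assume ij: "j mod 7 = Suc i mod 7"
    show "ad d w (g (i + k)) \<or> ad d w (g (j + k))"
    proof (rule cycle_vertex_cover[OF tc _ _ g w])
      have "(j + k) mod 7 = (Suc i + k) mod 7" using ij by (metis mod_add_left_eq)
      then show "g (j + k) = g (Suc (i + k))" unfolding gm by simp
    qed (use no in auto)
  qed
  from type[of _ 0] obtain \<tau> where
    \<tau>: "\<And>w. w \<in> ?W \<Longrightarrow> \<tau> w < 7 \<and> (\<forall>i\<in>hept (\<tau> w). ad d w (g i))" by (simp, metis)
  have "\<not> inj_on \<tau> ?W"
  proof
    assume inj: "inj_on \<tau> ?W"
    have "\<tau> ` ?W = {..<7}"
    proof (rule card_subset_eq)
      show "\<tau> ` ?W \<subseteq> {..<7}" using \<tau> by blast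
      then have "card (\<tau> ` ?W) \<le> card {..<7::nat}" by (intro card_mono) auto
      then show "card (\<tau> ` ?W) = card {..<7::nat}" using card_image[OF inj] cW by simp
    qed simp
    then have "\<exists>x\<in>?W. \<tau> x = t" if "t < 7" for t using that by (metis imageE lessThan_iff)
    \<comment> \<open>Types 0, 2, 4, 6 in this cyclic order have the distinct common vertices 1, 3,
      2, 5.\<close>
    from this[of 0] this[of 2] this[of 4] this[of 6]
    obtain w0 w2 w4 w6 where w: "w0 \<in> ?W" "\<tau> w0 = 0" "w2 \<in> ?W" "\<tau> w2 = 2"
      "w4 \<in> ?W" "\<tau> w4 = 4" "w6 \<in> ?W" "\<tau> w6 = 6" by (simp, blast)
    have "\<forall>i\<in>hept 0. ad d w0 (g i)" "\<forall>i\<in>hept 2. ad d w2 (g i)" "\<forall>i\<in>hept 4. ad d w4 (g i)"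
      "\<forall>i\<in>hept 6. ad d w6 (g i)" using \<tau> w by metis+
    then show False
      by (intro four[of w0 w2 w4 w6 "g 1" "g 3" "g 2" "g 5"])
        (use w in \<open>auto simp: hept_def gm\<close>)
  qed
  then obtain w w' where w: "w \<in> ?W" "w' \<in> ?W" "w \<noteq> w'" "\<tau> w = \<tau> w'"
    unfolding inj_on_def by blast
  \<comment> \<open>The rotation gives w and w' type 0. The types \<sigma> of the rotated cycle are
    chosen afresh, since a vertex may admit several.\<close>
  define h where "h i = g (i + \<tau> w)" for i
  have hinj: "inj_on h {..<7}"
  proof (rule inj_onI)
    fix i j :: nat assume ij: "i \<in> {..<7}" "j \<in> {..<7}" "h i = h j"
    have "(i + \<tau> w) mod 7 = (j + \<tau> w) mod 7" using ij(3) unfolding h_def gm .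
    then have "i mod 7 = j mod 7" unfolding nat_mod_eq_iff by (simp add: ac_simps)
    then show "i = j" using ij(1,2) by simp
  qed
  have h7: "i < 7" if "i \<in> hept t" for i t using that unfolding hept_def by auto
  have h_ne: "h i \<noteq> h j" if "i < 7" "j < 7" "i \<noteq> j" for i j
    using that hinj by (metis inj_onD lessThan_iff)
  have hg: "h i \<in> range g" for i unfolding h_def by blast
  have w0: "\<forall>i\<in>hept 0. ad d x (h i)" if x: "x \<in> ?W" "\<tau> x = \<tau> w" for x
  proof
    fix i assume "i \<in> hept 0"
    then have "(i + \<tau> w) mod 7 \<in> hept (\<tau> w)" unfolding hept_def by (auto simp: ac_simps)
    then have "ad d x (g ((i + \<tau> w) mod 7))" using \<tau>[OF x(1)] x(2) by simp
    moreover have "g ((i + \<tau> w) mod 7) = h i" unfolding h_def gm by simp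
    ultimately show "ad d x (h i)" by simp
  qed
  from type[of _ "\<tau> w"] obtain \<sigma> where
    \<sigma>: "\<And>x. x \<in> ?W \<Longrightarrow> \<sigma> x < 7 \<and> (\<forall>i\<in>hept (\<sigma> x). ad d x (h i))"
    unfolding h_def by metis
  have ww: "\<forall>i\<in>hept 0. ad d w (h i)" "\<forall>i\<in>hept 0. ad d w' (h i)" using w0 w by auto
  let ?W' = "?W - {w, w'}"
  have cW': "card ?W' \<ge> 5"
    using card_Diff_ge[of "{w, w'}" ?W] cW card_length[of "[w, w']"] by simp
  have small: "\<sigma> y \<in> {0, 1, 6}" if y: "y \<in> ?W'" for y
  proof (rule ccontr)
    assume "\<sigma> y \<notin> {0, 1, 6}"
    then have sy: "\<sigma> y \<in> {2, 3, 4, 5}" using \<sigma>[of y] y by auto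
    have "card (?W' - {y}) \<ge> 1" using card_Diff_ge[of "{y}" ?W'] cW' by simp
    then obtain z where z: "z \<in> ?W' - {y}" using ex_of_card by blast
    have sz: "\<sigma> z \<in> {0, 1, 2, 3, 4, 5, 6}" using \<sigma>[of z] z by auto
    obtain a b e k where a: "a \<in> hept 0" "b \<in> hept (\<sigma> y)" "e \<in> hept (\<sigma> z)" "k \<in> hept 0"
      "b \<in> hept 0" "e \<in> hept (\<sigma> y)" "k \<in> hept (\<sigma> z)" "distinct [a, b, e, k]"
      using hept_representatives[rule_format, OF sy sz] by metis
    show False
    proof (rule four[of w w' y z "h a" "h b" "h e" "h k"])
      show "distinct [h a, h b, h e, h k]" using a h7 h_ne by simp
      show "distinct [w, w', y, z]" "{w, w', y, z} \<subseteq> ?W" using w y z by auto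
      show "{h a, h b, h e, h k} \<subseteq> range g" using hg by blast
    qed (use a ww \<sigma> y z in blast)+
  qed
  have not16: False if y: "y \<in> ?W'" "\<sigma> y = 1" and z: "z \<in> ?W'" "\<sigma> z = 6" for y z
  proof -
    have "\<forall>i\<in>hept 1. ad d y (h i)" "\<forall>i\<in>hept 6. ad d z (h i)" using \<sigma> y z by (metis DiffD1)+
    then have "ad d y (h 2)" "ad d y (h 6)" "ad d z (h 2)" "ad d z (h 5)"
      "ad d w (h 5)" "ad d w (h 1)" "ad d w' (h 1)" "ad d w' (h 6)"
      using ww unfolding hept_def by (simp_all add: numeral_2_eq_2[symmetric])
    moreover have "h 1 \<noteq> h 6" "h 1 \<noteq> h 2" "h 1 \<noteq> h 5" "h 6 \<noteq> h 2" "h 6 \<noteq> h 5" "h 2 \<noteq> h 5"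
      by (rule h_ne; simp)+
    moreover have "y \<noteq> z" using y z by auto
    ultimately show False
      using w y z hg by (intro four[of w w' y z "h 1" "h 6" "h 2" "h 5"]) auto
  qed
  have few_of_type: "card T < 4" if T: "T \<subseteq> ?W" "\<forall>x\<in>T. \<forall>i\<in>hept t. ad d x (h i)" for T t
  proof (rule ccontr)
    assume "\<not> card T < 4"
    have "mono_cycle d c V 8"
    proof (rule joined_even_cycle(2))
      show "joined d T (h ` hept t)" using T unfolding joined_def by blast
      have "inj_on h (hept t)" using hinj h7 by (meson inj_on_subset lessThan_iff subsetI)
      then show "4 \<le> card (h ` hept t)" using card_hept[of t] by (simp add: card_image)
    qed (use \<open>\<not> card T < 4\<close> T hg g(2) in auto)
    then show False using no mono_sym by blast
  qed
  let ?A = "insert w (insert w' {x \<in> ?W'. \<sigma> x = 0})" and ?B = "\<lambda>t. {x \<in> ?W'. \<sigma> x = t}"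
  have A: "card ?A < 4" by (rule few_of_type[of _ 0]) (use w ww \<sigma> in auto)
  have B: "card (?B t) < 4" for t by (rule few_of_type[of _ t]) (use \<sigma> in auto)
  obtain t where "?W \<subseteq> ?A \<union> ?B t"
  proof (cases "\<exists>y\<in>?W'. \<sigma> y = 1")
    case True
    then show thesis using small not16 by (intro that[of 1]) blast
  next
    case False
    then show thesis using small by (intro that[of 6]) blast
  qed
  then have "card ?W \<le> card (?A \<union> ?B t)" using finV by (intro card_mono) auto
  also have "\<dots> \<le> card ?A + card (?B t)" by (rule card_Un_le)
  finally show False using A B[of t] cW by linarith
qed

text \<open>Suppose T has four vertices. A d-edge inside T gives a d-heptagon, so T is a c-clique;
  two vertices of T with a common d-neighbor \<open>g 0\<close> or \<open>g 2\<close> give a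
  d-octagon. Hence there are distinct a, b in T with c-edges to \<open>g 0\<close> and
  \<open>g 2\<close>, and the c-path a, b replaces the arc between these: a c-heptagon.\<close>

lemma hexagon_alternating_class:
  assumes tc: "two_colored c d V" and no7: "\<not> mono_cycle c d V 7" and no8: "\<not> mono_cycle c d V 8"
    and g: "periodic_cycle (ad c) 6 g" "range g \<subseteq> V"
    and T: "T \<subseteq> V - range g" "joined d T {g 1, g 3, g 5}"
  shows "card T < 4"
proof (rule ccontr)
  assume "\<not> card T < 4"
  then have cT: "card T \<ge> 4" by simp
  have gm: "g i = g j \<longleftrightarrow> i mod 6 = j mod 6" for i j
    using g(1) unfolding periodic_cycle_def by blast
  have gV: "g i \<in> V" for i using g(2) by blast
  have dist: "distinct [g 0, g 1, g 2, g 3, g 4, g 5]" by (simp add: gm)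
  have tg: "t \<noteq> g i" "g i \<noteq> t" "t \<in> V" if "t \<in> T" for t i using that T(1) by auto
  have e: "ad d t (g 1)" "ad d t (g 3)" "ad d t (g 5)" "ad d (g 1) t" "ad d (g 3) t" "ad d (g 5) t"
    if "t \<in> T" for t
    using that T(2) ad_sym unfolding joined_def by blast+
  have rest: "\<exists>x y. x \<in> T \<and> y \<in> T \<and> distinct [a, b, x, y]" if "a \<noteq> b" for a b
  proof -
    have "card (T - {a, b}) \<ge> 2" using card_Diff_ge[of "{a, b}" T] cT that by simp
    then obtain x y where "x \<in> T - {a, b}" "y \<in> T - {a, b}" "x \<noteq> y" by (rule two_of_card)
    then show ?thesis using that by (intro exI[of _ x] exI[of _ y]) auto
  qed
  have red: "ad c a b" if ab: "a \<in> T" "b \<in> T" "a \<noteq> b" for a b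
  proof (rule ccontr)
    assume "\<not> ad c a b"
    then have ad: "ad d a b" using two_coloredD[OF tc] ab tg by metis
    obtain x y where xy: "x \<in> T" "y \<in> T" "distinct [a, b, x, y]" using rest[OF ab(3)] by blast
    have "distinct [a, b, g 1, x, g 3, y, g 5]"
      using dist xy tg(1,2)[OF ab(1)] tg(1,2)[OF ab(2)] tg(1,2)[OF xy(1)] tg(1,2)[OF xy(2)] by simp
    then have "cyc (ad d) [a, b, g 1, x, g 3, y, g 5]"
      using ad e[OF ab(1)] e[OF ab(2)] e[OF xy(1)] e[OF xy(2)] unfolding cyc_def by simp
    then show False
      using no7 mono2[of d "[a, b, g 1, x, g 3, y, g 5]" V 7 c] gV tg(3) ab xy by simp
  qed
  have blue2: False if ab: "a \<in> T" "b \<in> T" "a \<noteq> b" "ad d a (g i)" "ad d b (g i)" "i \<in> {0, 2}" for a b i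
  proof -
    obtain x y where xy: "x \<in> T" "y \<in> T" "distinct [a, b, x, y]" using rest[OF ab(3)] by blast
    have "distinct [g i, g 1, g 3, g 5]" using dist ab(6) by auto
    then have "distinct [a, g i, b, g 1, x, g 3, y, g 5]"
      using xy tg(1,2)[OF ab(1)] tg(1,2)[OF ab(2)] tg(1,2)[OF xy(1)] tg(1,2)[OF xy(2)] by simp
    then have "cyc (ad d) [a, g i, b, g 1, x, g 3, y, g 5]"
      using ab(4) ad_sym[OF ab(5)] e[OF ab(1)] e[OF ab(2)] e[OF xy(1)] e[OF xy(2)]
      unfolding cyc_def by simp
    then show False
      using no8 mono2[of d "[a, g i, b, g 1, x, g 3, y, g 5]" V 8 c] gV tg(3) ab xy by simp
  qed
  have few: "card {t \<in> T. ad d t (g i)} < 2" if "i \<in> {0, 2}" for i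
  proof (rule ccontr)
    assume "\<not> ?thesis"
    then have "card {t \<in> T. ad d t (g i)} \<ge> 2" by simp
    then obtain a b where "a \<in> {t \<in> T. ad d t (g i)}" "b \<in> {t \<in> T. ad d t (g i)}" "a \<noteq> b"
      by (rule two_of_card)
    then show False using blue2[of a b i] that by blast
  qed
  have "finite T" using cT by (metis card.infinite not_numeral_le_zero)
  have R: "card {t \<in> T. \<not> ad d t (g i)} \<ge> 3" if "i \<in> {0, 2}" for i
  proof -
    have "T = {t \<in> T. ad d t (g i)} \<union> {t \<in> T. \<not> ad d t (g i)}" by blast
    then have "card T \<le> card {t \<in> T. ad d t (g i)} + card {t \<in> T. \<not> ad d t (g i)}"
      by (metis card_Un_le)
    then show ?thesis using few[OF that] cT by linarith
  qed
  obtain a where a: "a \<in> {t \<in> T. \<not> ad d t (g 0)}"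
    using R[of 0] ex_of_card[of "{t \<in> T. \<not> ad d t (g 0)}"] by auto
  have "card ({t \<in> T. \<not> ad d t (g 2)} - {a}) \<ge> 1"
    using R[of 2] card_Diff_ge[of "{a}" "{t \<in> T. \<not> ad d t (g 2)}"] by simp
  then obtain b where b: "b \<in> {t \<in> T. \<not> ad d t (g 2)} - {a}" using ex_of_card by blast
  have r: "ad c t (g i)" if "t \<in> T" "\<not> ad d t (g i)" for t i
    using tc tg(1,3)[OF that(1)] gV that(2) unfolding two_colored_def by blast
  have "mono_cycle c d V 7"
  proof (rule mono_reroute[OF g, of "[a, b]" 0 2])
    show "ad c (hd [a, b]) (g 0)" using r[of a 0] a by simp
    show "ad c (last [a, b]) (g (0 + 2))" using r[of b 2] b by (subst add_0_left) simp
  qed (use a b T(1) red in auto)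
  then show False using no7 by blast
qed

text \<open>The c-neighbors of w0 outside the hexagon are d-joined to all of it but
  \<open>g 0\<close> and \<open>g 3\<close>; two of them would give a d-heptagon, so w0 has at least
  five outer d-neighbors. At most one outer vertex besides w0 is d-joined to all odd hexagon
  vertices, and at most one to all even ones. Three of the five remain, each d-joined to two
  antipodal pairs, as is w0, and these four close a d-heptagon.\<close>

lemma hexagon_antipodal_neighbours:
  assumes tc: "two_colored c d V" and V: "card V \<ge> 13"
    and no7: "\<not> mono_cycle c d V 7" and no8: "\<not> mono_cycle c d V 8"
    and g: "periodic_cycle (ad c) 6 g" "range g \<subseteq> V"
    and w0: "w0 \<in> V - range g" "\<not> ad d w0 (g 0)" "\<not> ad d w0 (g 3)"
  shows False
proof -
  let ?W = "V - range g"
  have gm: "g i = g j \<longleftrightarrow> i mod 6 = j mod 6" for i j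
    using g(1) unfolding periodic_cycle_def by blast
  have gV: "g i \<in> V" for i using g(2) by blast
  have g_dist: "distinct [g 0, g 1, g 2, g 3, g 4, g 5]" by (simp add: gm)
  have finV: "finite V" using V by (metis card.infinite not_numeral_le_zero)
  have cW: "card ?W \<ge> 7"
    using card_cycle_complement[OF g(1), of 7 V] V by simp
  have wV: "w \<in> V" "w \<noteq> g i" "w \<notin> range g" if "w \<in> ?W" for w i using that by auto
  have cover: "ad d w (g i) \<or> ad d w (g j)" if "w \<in> ?W" "j mod 6 = Suc i mod 6" for w i j
  proof (rule cycle_vertex_cover[OF tc _ _ g that(1)])
    have "\<not> mono_cycle c d V (Suc 6)" using no7 by simp
    then show "\<not> mono_cycle c d V (Suc 6)" .
  qed (use that gm in auto)
  have red: "ad c w (g i)" if "w \<in> ?W" "\<not> ad d w (g i)" for w i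
    using tc wV[OF that(1)] gV that(2) unfolding two_colored_def by blast
  \<comment> \<open>Otherwise the c-path y, x replaces an arc of length 1 or 2 and gives a c-cycle
    of length 8 or 7.\<close>
  have red_edge: "ad d x (g j)"
    if x: "x \<in> ?W" "y \<in> ?W" "ad c y x" "\<not> ad d y (g i)"
      and j: "j mod 6 = (i + 1) mod 6 \<or> j mod 6 = (i + 2) mod 6" for x y i j
  proof (rule ccontr)
    assume contr: "\<not> ad d x (g j)"
    have r: "ad c y (g i)" "ad c x (g j)" using red x contr by blast+
    have "y \<noteq> x" using x(3) ad_irrefl by blast
    from j show False
    proof
      assume "j mod 6 = (i + 1) mod 6"
      then have "g j = g (i + 1)" unfolding gm .
      then have "mono_cycle c d V 8"
        using x r \<open>y \<noteq> x\<close> by (intro mono_reroute[OF g, of "[y, x]" i 1]) auto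
      then show False using no8 by blast
    next
      assume "j mod 6 = (i + 2) mod 6"
      then have "g j = g (i + 2)" unfolding gm .
      then have "mono_cycle c d V 7"
        using x r \<open>y \<noteq> x\<close> by (intro mono_reroute[OF g, of "[y, x]" i 2]) auto
      then show False using no7 by blast
    qed
  qed
  have c7: False
    if w: "distinct [w0, y, u, u']" "{y, u, u'} \<subseteq> ?W" "ad d w0 y"
      and v: "distinct [v1, v2, v3]" "{v1, v2, v3} \<subseteq> range g"
      and e: "ad d y v1" "ad d u v1" "ad d u v2" "ad d u' v2" "ad d u' v3" "ad d w0 v3"
    for y u u' v1 v2 v3
  proof -
    have "\<forall>x\<in>{w0, y, u, u'}. x \<notin> range g" "\<forall>y\<in>{v1, v2, v3}. y \<in> range g"
      using w(2) v(2) w0(1) by simp_all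
    then have "\<forall>x\<in>{w0, y, u, u'}. \<forall>y\<in>{v1, v2, v3}. x \<noteq> y" by metis
    then have "distinct [w0, y, v1, u, v2, u', v3]" using w(1) v(1) by auto
    then have "cyc (ad d) [w0, y, v1, u, v2, u', v3]"
      using w(3) e(1,3,5) e(2,4,6)[THEN ad_sym] unfolding cyc_def by simp
    then show False
      using no7 mono2[of d "[w0, y, v1, u, v2, u', v3]" V 7 c] w(2) v(2) g(2) w0(1) by auto
  qed
  have b0: "ad d w0 (g 1)" "ad d w0 (g 2)" "ad d w0 (g 4)" "ad d w0 (g 5)"
    using cover[OF w0(1), of 1 0] cover[OF w0(1), of 3 2] cover[OF w0(1), of 4 3]
      cover[OF w0(1), of 0 5] w0(2,3) by simp_all
  let ?X = "{x \<in> ?W - {w0}. \<not> ad d w0 x}" and ?Y = "{x \<in> ?W - {w0}. ad d w0 x}"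
  have X: "ad d x (g 1) \<and> ad d x (g 2) \<and> ad d x (g 4) \<and> ad d x (g 5)" if x: "x \<in> ?X" for x
  proof -
    have x': "x \<in> ?W" "x \<noteq> w0" "\<not> ad d w0 x" using x by auto
    have "ad c w0 x" using two_coloredD[OF tc wV(1)[OF w0(1)] wV(1)[OF x'(1)]] x'(2,3) by metis
    then show ?thesis
      using red_edge[OF x'(1) w0(1), of 0 1] red_edge[OF x'(1) w0(1), of 0 2]
        red_edge[OF x'(1) w0(1), of 3 4] red_edge[OF x'(1) w0(1), of 3 5] w0(2,3) by simp
  qed
  have "?X \<union> ?Y = ?W - {w0}" by blast
  then have "card (?W - {w0}) \<le> card ?X + card ?Y" using card_Un_le[of ?X ?Y] by (simp only:)
  moreover have "card ?W - card {w0} \<le> card (?W - {w0})" by (rule card_Diff_ge) simp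
  moreover have "card {w0} = 1" by simp
  ultimately have XY: "card ?X + card ?Y \<ge> 6" using cW by linarith
  have "card ?X < 4"
  proof (rule ccontr)
    assume "\<not> ?thesis"
    have "mono_cycle d c V 8"
    proof (rule joined_even_cycle(2))
      show "joined d ?X {g 1, g 2, g 4, g 5}" using X unfolding joined_def by blast
      show "4 \<le> card {g 1, g 2, g 4, g 5}" using g_dist by simp
    qed (use \<open>\<not> card ?X < 4\<close> g(2) in auto)
    then show False using no8 mono_sym by blast
  qed
  have "card ?X < 2"
  proof (rule ccontr)
    assume "\<not> ?thesis"
    then have "card ?X \<ge> 2" by simp
    then obtain u u' where u: "u \<in> ?X" "u' \<in> ?X" "u \<noteq> u'" by (rule two_of_card)
    obtain y where y: "y \<in> ?Y" using XY \<open>card ?X < 4\<close> ex_of_card[of ?Y] by force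
    have yW: "y \<in> ?W" using y by blast
    have d: "distinct [w0, y, u, u']" "{y, u, u'} \<subseteq> ?W" "ad d w0 y" using u y by auto
    have "ad d y (g 1) \<or> ad d y (g 2)" using cover[OF yW, of 2 1] by simp
    then show False
    proof
      assume "ad d y (g 1)"
      then show False
        by (intro c7[OF d, of "g 1" "g 4" "g 5"]) (use X[OF u(1)] X[OF u(2)] b0 g_dist in auto)
    next
      assume "ad d y (g 2)"
      then show False
        by (intro c7[OF d, of "g 2" "g 4" "g 5"]) (use X[OF u(1)] X[OF u(2)] b0 g_dist in auto)
    qed
  qed
  then have cY: "card ?Y \<ge> 5" using XY by linarith
  let ?E = "{x \<in> ?W - {w0}. ad d x (g 1) \<and> ad d x (g 3) \<and> ad d x (g 5)}"
  let ?O = "{x \<in> ?W - {w0}. ad d x (g 0) \<and> ad d x (g 2) \<and> ad d x (g 4)}"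
  \<comment> \<open>In \<open>c7\<close> the links are v between y and u, one of \<open>g 1\<close>,
    \<open>g 5\<close> between u' and w0, and the third odd vertex between u and u'.\<close>
  have EE: False if u: "u \<in> ?E" "u' \<in> ?E" "u \<noteq> u'" and y: "y \<in> ?Y - {u, u'}"
    and v: "v \<in> {g 1, g 3, g 5}" "ad d y v" for u u' y v
  proof -
    obtain v1 v2 v3 where vs: "v1 \<in> {v}" "v2 \<in> {g 1, g 5}" "v3 \<in> {g 1, g 3, g 5}" "distinct [v1, v2, v3]"
      by (rule three_distinct_representatives[of "{v}" "{g 1, g 5}" "{g 1, g 3, g 5}"])
        (use g_dist in auto)
    show False
    proof (rule c7[of y u u' v1 v3 v2])
      show "distinct [w0, y, u, u']" "{y, u, u'} \<subseteq> ?W" "ad d w0 y" using u y by auto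
      show "distinct [v1, v3, v2]" using vs(4) by auto
      show "{v1, v3, v2} \<subseteq> range g" using vs v(1) by auto
    qed (use u y v b0 vs in auto)
  qed
  have OO: False if u: "u \<in> ?O" "u' \<in> ?O" "u \<noteq> u'" and y: "y \<in> ?Y - {u, u'}"
    and v: "v \<in> {g 0, g 2, g 4}" "ad d y v" for u u' y v
  proof -
    obtain v1 v2 v3 where vs: "v1 \<in> {v}" "v2 \<in> {g 2, g 4}" "v3 \<in> {g 0, g 2, g 4}" "distinct [v1, v2, v3]"
      by (rule three_distinct_representatives[of "{v}" "{g 2, g 4}" "{g 0, g 2, g 4}"])
        (use g_dist in auto)
    show False
    proof (rule c7[of y u u' v1 v3 v2])
      show "distinct [w0, y, u, u']" "{y, u, u'} \<subseteq> ?W" "ad d w0 y" using u y by auto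
      show "distinct [v1, v3, v2]" using vs(4) by auto
      show "{v1, v3, v2} \<subseteq> range g" using vs v(1) by auto
    qed (use u y v b0 vs in auto)
  qed
  have rest: "\<exists>y1 y2 y3. distinct [y1, y2, y3] \<and> {y1, y2, y3} \<subseteq> ?Y - {u, u'}" for u u'
  proof -
    have "card (?Y - {u, u'}) \<ge> 3"
      using card_Diff_ge[of "{u, u'}" ?Y] cY card_length[of "[u, u']"] by simp
    then obtain y1 y2 y3 where "distinct [y1, y2, y3]" "{y1, y2, y3} \<subseteq> ?Y - {u, u'}"
      by (rule three_of_card)
    then show ?thesis by blast
  qed
  have cov: "(ad d w (g 0) \<or> ad d w (g 1)) \<and> (ad d w (g 1) \<or> ad d w (g 2)) \<and> (ad d w (g 2) \<or> ad d w (g 3)) \<and>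
      (ad d w (g 3) \<or> ad d w (g 4)) \<and> (ad d w (g 4) \<or> ad d w (g 5)) \<and> (ad d w (g 5) \<or> ad d w (g 0))"
    if "w \<in> ?W" for w
    by (intro conjI cover[OF that]) simp_all
  have "card ?E < 2"
  proof (rule ccontr)
    assume "\<not> ?thesis"
    then have "card ?E \<ge> 2" by simp
    then obtain u u' where u: "u \<in> ?E" "u' \<in> ?E" "u \<noteq> u'" by (rule two_of_card)
    obtain y1 y2 y3 where y: "distinct [y1, y2, y3]" "{y1, y2, y3} \<subseteq> ?Y - {u, u'}" using rest by blast
    have "y \<in> ?O" if "y \<in> {y1, y2, y3}" for y
    proof -
      have yY: "y \<in> ?Y - {u, u'}" using that y(2) by blast
      then have "\<not> ad d y (g 1)" "\<not> ad d y (g 3)" "\<not> ad d y (g 5)" using EE[OF u yY] by blast+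
      then show ?thesis using cov[of y] yY by blast
    qed
    then have O: "y1 \<in> ?O" "y2 \<in> ?O" "y3 \<in> ?O" by simp_all
    have "y3 \<in> ?Y - {y1, y2}" using y by auto
    then show False using OO[OF O(1,2), of y3 "g 0"] y(1) O(3) by simp
  qed
  have "card ?O < 2"
  proof (rule ccontr)
    assume "\<not> ?thesis"
    then have "card ?O \<ge> 2" by simp
    then obtain u u' where u: "u \<in> ?O" "u' \<in> ?O" "u \<noteq> u'" by (rule two_of_card)
    obtain y1 y2 y3 where y: "distinct [y1, y2, y3]" "{y1, y2, y3} \<subseteq> ?Y - {u, u'}" using rest by blast
    have "y \<in> ?E" if "y \<in> {y1, y2, y3}" for y
    proof -
      have yY: "y \<in> ?Y - {u, u'}" using that y(2) by blast
      then have "\<not> ad d y (g 0)" "\<not> ad d y (g 2)" "\<not> ad d y (g 4)" using OO[OF u yY] by blast+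
      then show ?thesis using cov[of y] yY by blast
    qed
    then have E: "y1 \<in> ?E" "y2 \<in> ?E" "y3 \<in> ?E" by simp_all
    have "y3 \<in> ?Y - {y1, y2}" using y by auto
    then show False using EE[OF E(1,2), of y3 "g 1"] y(1) E(3) by simp
  qed
  define M where "M = ?Y - (?E \<union> ?O)"
  have "card (?E \<union> ?O) \<le> 2"
    using card_Un_le[of ?E ?O] \<open>card ?E < 2\<close> \<open>card ?O < 2\<close> by linarith
  moreover have "finite (?E \<union> ?O)"
    using finV by auto
  ultimately have "card M \<ge> 3" unfolding M_def using card_Diff_ge[of "?E \<union> ?O" ?Y] cY by linarith
  then obtain y1 y2 y3 where y: "distinct [y1, y2, y3]" "{y1, y2, y3} \<subseteq> M"
    by (rule three_of_card)
  have MW: "M \<subseteq> ?W" "w0 \<notin> M" unfolding M_def by auto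
  have Mad: "ad d w0 x" if "x \<in> M" for x using that unfolding M_def by blast
  \<comment> \<open>A vertex cover of the hexagon that contains neither alternating triple contains
    two of the three antipodal pairs; \<tau> is the index of the remaining one. For w0 the index
    would be 0.\<close>
  define P :: "nat \<Rightarrow> 'a set" where "P t = {g t, g (t + 3)}" for t
  have "\<exists>t\<in>{0, 1, 2}. \<forall>s\<in>{0, 1, 2} - {t}. \<forall>v\<in>P s. ad d x v" if "x \<in> M" for x
  proof -
    have "\<not> (ad d x (g 1) \<and> ad d x (g 3) \<and> ad d x (g 5))"
      "\<not> (ad d x (g 0) \<and> ad d x (g 2) \<and> ad d x (g 4))" "x \<in> ?W" using that unfolding M_def by auto
    then have "(ad d x (g 1) \<and> ad d x (g 2) \<and> ad d x (g 4) \<and> ad d x (g 5)) \<or>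
      (ad d x (g 0) \<and> ad d x (g 2) \<and> ad d x (g 3) \<and> ad d x (g 5)) \<or>
      (ad d x (g 0) \<and> ad d x (g 1) \<and> ad d x (g 3) \<and> ad d x (g 4))"
      using cov[of x] by blast
    then show ?thesis unfolding P_def by auto
  qed
  then have "\<forall>x\<in>M. \<exists>t. t \<in> {0, 1, 2} \<and> (\<forall>s\<in>{0, 1, 2} - {t}. \<forall>v\<in>P s. ad d x v)" by blast
  from bchoice[OF this] obtain \<tau> where
    ta: "\<forall>x\<in>M. \<tau> x \<in> {0, 1, 2} \<and> (\<forall>s\<in>{0, 1, 2} - {\<tau> x}. \<forall>v\<in>P s. ad d x v)" by blast
  have \<tau>: "\<tau> x \<in> {0, 1, 2}" "s \<in> {0, 1, 2} \<Longrightarrow> s \<noteq> \<tau> x \<Longrightarrow> v \<in> P s \<Longrightarrow> ad d x v"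
    if "x \<in> M" for x s v using ta that by blast+
  have P0: "ad d w0 v" if "s \<in> {1, 2}" "v \<in> P s" for s v
    using that b0 unfolding P_def by auto
  have Pg: "P s \<subseteq> range g" for s unfolding P_def by auto
  have "distinct [g 5, g 4, g 3, g 2, g 1, g 0]" by (simp add: gm)
  then have cP: "card (P 0) = 2" "card (P 1) = 2" "card (P 2) = 2"
    "card (P 1 \<union> P 2) = 4" "card (P 0 \<union> P 2) = 4" "card (P 0 \<union> P 1) = 4"
    using g_dist unfolding P_def by (simp_all add: numeral_2_eq_2[symmetric])
  have fin: False
    if "distinct [y, u, u']" "{y, u, u'} \<subseteq> M" and ABC: "card A \<ge> 1" "card B \<ge> 2" "card C \<ge> 3"
      "A \<union> B \<union> C \<subseteq> range g"
      and e: "\<And>v. v \<in> A \<Longrightarrow> ad d y v \<and> ad d u v" "\<And>v. v \<in> C \<Longrightarrow> ad d u v \<and> ad d u' v"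
      "\<And>v. v \<in> B \<Longrightarrow> ad d u' v \<and> ad d w0 v" for y u u' A B C
  proof -
    obtain v1 v2 v3 where v: "v1 \<in> A" "v2 \<in> B" "v3 \<in> C" "distinct [v1, v2, v3]"
      using three_distinct_representatives[OF ABC(1-3)] by metis
    show False
    proof (rule c7[of y u u' v1 v3 v2])
      show "distinct [w0, y, u, u']" using that(1,2) MW(2) by auto
      show "{y, u, u'} \<subseteq> ?W" using that(2) MW(1) by blast
      show "ad d w0 y" using that(2) Mad by blast
      show "distinct [v1, v3, v2]" using v(4) by auto
      show "{v1, v3, v2} \<subseteq> range g" using v ABC(4) by blast
    qed (use v e in blast)+
  qed
  \<comment> \<open>Vertices u, u' of equal type have four common d-neighbors, enough for a link
    after one common to y and u and one common to u' and w0 are chosen.\<close>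
  have same: False if d: "distinct [y, u, u']" "{y, u, u'} \<subseteq> M" and t: "\<tau> u = \<tau> u'" for y u u'
  proof -
    have M: "y \<in> M" "u \<in> M" "u' \<in> M" using d(2) by auto
    obtain r where r: "r \<in> {0, 1, 2}" "r \<noteq> \<tau> y" "r \<noteq> \<tau> u"
    proof (cases "\<tau> y \<noteq> 0 \<and> \<tau> u \<noteq> 0")
      case True then show thesis using that[of 0] by auto
    next
      case False
      then show thesis using that[of 1] that[of 2] \<tau>(1)[OF M(1)] \<tau>(1)[OF M(2)] by auto
    qed
    obtain r' where r': "r' \<in> {1, 2}" "r' \<noteq> \<tau> u"
    proof (cases "\<tau> u = 1")
      case True then show thesis using that[of 2] by simp
    next
      case False then show thesis using that[of 1] by simp
    qed
    define C where "C = \<Union> (P ` ({0, 1, 2} - {\<tau> u}))"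
    have "\<tau> u = 0 \<or> \<tau> u = 1 \<or> \<tau> u = 2" using \<tau>(1)[OF M(2)] by simp
    then have "{0, 1, 2} - {\<tau> u} = {1, 2} \<or> {0, 1, 2} - {\<tau> u} = {0, 2} \<or> {0, 1, 2} - {\<tau> u} = {0, 1}"
      by (elim disjE) (simp_all add: insert_Diff_if)
    then have "C = P 1 \<union> P 2 \<or> C = P 0 \<union> P 2 \<or> C = P 0 \<union> P 1"
      unfolding C_def by (elim disjE) simp_all
    then have "card C \<ge> 3" using cP by auto
    moreover have "card (P r) \<ge> 1" "card (P r') \<ge> 2" using r r' cP by auto
    ultimately show False
    proof (intro fin[OF d, of "P r" "P r'" C])
      show "P r \<union> P r' \<union> C \<subseteq> range g" using Pg unfolding C_def by blast
      show "ad d y v \<and> ad d u v" if "v \<in> P r" for v using \<tau>(2)[OF M(1)] \<tau>(2)[OF M(2)] r that by blast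
      show "ad d u v \<and> ad d u' v" if "v \<in> C" for v
        using \<tau>(2)[OF M(2)] \<tau>(2)[OF M(3)] t that unfolding C_def by auto
      show "ad d u' v \<and> ad d w0 v" if "v \<in> P r'" for v
        using \<tau>(2)[OF M(3), of r' v] P0[OF r'(1)] r' t that by auto
    qed auto
  qed
  \<comment> \<open>Types 1, 2, 0 for y, u, u', followed by w0 of type 0: consecutive vertices share
    the pairs \<open>P 0\<close>, \<open>P 1\<close>, \<open>P 2\<close>.\<close>
  have diff: False
    if d: "distinct [y, u, u']" "{y, u, u'} \<subseteq> M" and t: "\<tau> y = 1" "\<tau> u = 2" "\<tau> u' = 0" for y u u'
  proof -
    have M: "y \<in> M" "u \<in> M" "u' \<in> M" using d(2) by auto
    have "g 0 \<in> P 0" "g 1 \<in> P 1" "g 2 \<in> P 2" unfolding P_def by auto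
    then have e: "ad d y (g 0)" "ad d u (g 0)" "ad d u (g 1)" "ad d u' (g 1)" "ad d u' (g 2)"
      using \<tau>(2)[OF M(1), of 0] \<tau>(2)[OF M(2), of 0] \<tau>(2)[OF M(2), of 1]
        \<tau>(2)[OF M(3), of 1] \<tau>(2)[OF M(3), of 2] t by simp_all
    show False
    proof (rule c7[of y u u' "g 0" "g 1" "g 2"])
      show "distinct [w0, y, u, u']" using d MW(2) by auto
      show "{y, u, u'} \<subseteq> ?W" using d(2) MW(1) by blast
      show "ad d w0 y" using d(2) Mad by blast
    qed (use e b0 g_dist in auto)
  qed
  have d: "distinct [a, b, e]" "{a, b, e} \<subseteq> M"
    if "{a, b, e} = {y1, y2, y3}" for a b e
  proof -
    have "card {y1, y2, y3} = 3" using y(1) by simp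
    then have "card (set [a, b, e]) = length [a, b, e]" using that by simp
    then show "distinct [a, b, e]" by (rule card_distinct)
    show "{a, b, e} \<subseteq> M" using that y(2) by simp
  qed
  have "\<tau> y1 \<in> {0, 1, 2}" "\<tau> y2 \<in> {0, 1, 2}" "\<tau> y3 \<in> {0, 1, 2}" using \<tau>(1) y(2) by blast+
  moreover have "\<tau> y1 \<noteq> \<tau> y2" using same[of y3 y1 y2] d[of y3 y1 y2] by blast
  moreover have "\<tau> y1 \<noteq> \<tau> y3" using same[of y2 y1 y3] d[of y2 y1 y3] by blast
  moreover have "\<tau> y2 \<noteq> \<tau> y3" using same[of y1 y2 y3] d[of y1 y2 y3] by blast
  ultimately have "(\<tau> y1 = 1 \<and> \<tau> y2 = 2 \<and> \<tau> y3 = 0) \<or>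
    (\<tau> y1 = 1 \<and> \<tau> y3 = 2 \<and> \<tau> y2 = 0) \<or>
    (\<tau> y2 = 1 \<and> \<tau> y1 = 2 \<and> \<tau> y3 = 0) \<or>
    (\<tau> y2 = 1 \<and> \<tau> y3 = 2 \<and> \<tau> y1 = 0) \<or>
    (\<tau> y3 = 1 \<and> \<tau> y1 = 2 \<and> \<tau> y2 = 0) \<or>
    (\<tau> y3 = 1 \<and> \<tau> y2 = 2 \<and> \<tau> y1 = 0)"
    by (simp only: insert_iff empty_iff simp_thms) presburger
  then show False
  proof (elim disjE conjE)
    assume "\<tau> y1 = 1" "\<tau> y2 = 2" "\<tau> y3 = 0"
    then show False using diff[of y1 y2 y3] d[of y1 y2 y3] by blast
  next
    assume "\<tau> y1 = 1" "\<tau> y3 = 2" "\<tau> y2 = 0"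
    then show False using diff[of y1 y3 y2] d[of y1 y3 y2] by blast
  next
    assume "\<tau> y2 = 1" "\<tau> y1 = 2" "\<tau> y3 = 0"
    then show False using diff[of y2 y1 y3] d[of y2 y1 y3] by blast
  next
    assume "\<tau> y2 = 1" "\<tau> y3 = 2" "\<tau> y1 = 0"
    then show False using diff[of y2 y3 y1] d[of y2 y3 y1] by blast
  next
    assume "\<tau> y3 = 1" "\<tau> y1 = 2" "\<tau> y2 = 0"
    then show False using diff[of y3 y1 y2] d[of y3 y1 y2] by blast
  next
    assume "\<tau> y3 = 1" "\<tau> y2 = 2" "\<tau> y1 = 0"
    then show False using diff[of y3 y2 y1] d[of y3 y2 y1] by blast
  qed
qed

text \<open>Each alternating class has at most three of the seven outer vertices. The cover given by
  a vertex outside both classes omits an antipodal pair, which a shift moves to \<open>g 0\<close>,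
  \<open>g 3\<close>.\<close>

lemma mono7_or_8_of_hexagon:
  assumes tc: "two_colored c d V" and V: "card V \<ge> 13"
    and g: "periodic_cycle (ad c) 6 g" "range g \<subseteq> V"
  shows "mono_cycle c d V 7 \<or> mono_cycle c d V 8"
proof (rule ccontr)
  assume "\<not> ?thesis"
  then have no7: "\<not> mono_cycle c d V 7" and no8: "\<not> mono_cycle c d V 8" by blast+
  let ?W = "V - range g"
  have gm: "g i = g j \<longleftrightarrow> i mod 6 = j mod 6" for i j
    using g(1) unfolding periodic_cycle_def by blast
  have finV: "finite V" using V by (metis card.infinite not_numeral_le_zero)
  have cW: "card ?W \<ge> 7"
    using card_cycle_complement[OF g(1), of 7 V] V by simp
  have cover: "ad d w (g i) \<or> ad d w (g j)" if "w \<in> ?W" "j mod 6 = Suc i mod 6" for w i j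
  proof (rule cycle_vertex_cover[OF tc _ _ g that(1)])
    have "\<not> mono_cycle c d V (Suc 6)" using no7 by simp
    then show "\<not> mono_cycle c d V (Suc 6)" .
  qed (use that gm in auto)
  have shift: "periodic_cycle (ad c) 6 (\<lambda>i. g (i + k))" "range (\<lambda>i. g (i + k)) = range g" for k
  proof -
    show "periodic_cycle (ad c) 6 (\<lambda>i. g (i + k))" by (rule periodic_cycle_shift[OF g(1)])
    have "g i \<in> range (\<lambda>i. g (i + k))" for i
    proof -
      have "(i + 5 * k + k) mod 6 = i mod 6" by (simp add: add.assoc)
      then have "g i = g ((i + 5 * k) + k)" unfolding gm by simp
      then show ?thesis by blast
    qed
    then show "range (\<lambda>i. g (i + k)) = range g" by blast
  qed
  let ?E = "{x \<in> ?W. ad d x (g 1) \<and> ad d x (g 3) \<and> ad d x (g 5)}"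
  let ?O = "{x \<in> ?W. ad d x (g 0) \<and> ad d x (g 2) \<and> ad d x (g 4)}"
  have "card ?E < 4"
    by (rule hexagon_alternating_class[OF tc no7 no8 g]) (auto simp: joined_def)
  moreover have "card ?O < 4"
  proof (rule hexagon_alternating_class[OF tc no7 no8 shift(1)[of 1]])
    have "g 6 = g 0" unfolding gm by simp
    then show "joined d ?O {g (1 + 1), g (3 + 1), g (5 + 1)}"
      unfolding joined_def by (simp add: numeral_2_eq_2[symmetric])
  qed (use g(2) shift(2)[of 1] in auto)
  ultimately have "card (?E \<union> ?O) < 7" using card_Un_le[of ?E ?O] by linarith
  moreover have "finite (?E \<union> ?O)"
    using finV by auto
  ultimately have "\<not> ?W \<subseteq> ?E \<union> ?O"
    using cW card_mono by (metis (no_types, lifting) leD order.trans)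
  then obtain w where w: "w \<in> ?W" "w \<notin> ?E" "w \<notin> ?O" by blast
  have "(ad d w (g 0) \<or> ad d w (g 1)) \<and> (ad d w (g 1) \<or> ad d w (g 2)) \<and> (ad d w (g 2) \<or> ad d w (g 3)) \<and>
      (ad d w (g 3) \<or> ad d w (g 4)) \<and> (ad d w (g 4) \<or> ad d w (g 5)) \<and> (ad d w (g 5) \<or> ad d w (g 0))"
    by (intro conjI cover[OF w(1)]) simp_all
  then have "(\<not> ad d w (g 0) \<and> \<not> ad d w (g 3)) \<or> (\<not> ad d w (g 1) \<and> \<not> ad d w (g 4)) \<or>
      (\<not> ad d w (g 2) \<and> \<not> ad d w (g 5))" using w by blast
  then obtain k where "\<not> ad d w (g (0 + k))" "\<not> ad d w (g (3 + k))"
  proof (elim disjE)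
    assume "\<not> ad d w (g 0) \<and> \<not> ad d w (g 3)" then show thesis using that[of 0] by simp
  next
    assume "\<not> ad d w (g 1) \<and> \<not> ad d w (g 4)" then show thesis using that[of 1] by simp
  next
    assume "\<not> ad d w (g 2) \<and> \<not> ad d w (g 5)" then show thesis using that[of 2] by (simp add: numeral_2_eq_2[symmetric])
  qed
  then show False
    using hexagon_antipodal_neighbours[OF tc V no7 no8 shift(1)[of k], of w] shift(2)[of k] g(2) w(1)
    by simp
qed

end

section \<open>Attachment to a cycle of length 8\<close>

context c9_free
begin

text \<open>Only the edges between W and the cycle are constrained: W will also receive universal
  vertices, whose mutual edges can have any color.\<close>

definition octagon :: "'c \<Rightarrow> 'c \<Rightarrow> (nat \<Rightarrow> 'a) \<Rightarrow> 'a set \<Rightarrow> bool" where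
  "octagon c d g W \<longleftrightarrow> periodic_cycle (ad c) 8 g \<and> W \<inter> range g = {} \<and>
     (\<forall>w\<in>W. \<forall>i. ad c w (g i) \<or> ad d w (g i))"

definition blue_odd :: "'c \<Rightarrow> (nat \<Rightarrow> 'a) \<Rightarrow> 'a \<Rightarrow> bool" where
  "blue_odd d g x \<longleftrightarrow> ad d x (g 1) \<and> ad d x (g 3) \<and> ad d x (g 5) \<and> ad d x (g 7)"

definition blue_even :: "'c \<Rightarrow> (nat \<Rightarrow> 'a) \<Rightarrow> 'a \<Rightarrow> bool" where
  "blue_even d g x \<longleftrightarrow> ad d x (g 0) \<and> ad d x (g 2) \<and> ad d x (g 4) \<and> ad d x (g 6)"

lemma octagon_eq: "octagon c d g W \<Longrightarrow> g i = g j \<longleftrightarrow> i mod 8 = j mod 8"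
  unfolding octagon_def periodic_cycle_def by blast

lemma octagon_distinct:
  assumes "octagon c d g W"
  shows "distinct [g 0, g 1, g 2, g 3, g 4, g 5, g 6, g 7]"
    "distinct [g 7, g 6, g 5, g 4, g 3, g 2, g 1, g 0]"
  by (simp_all add: octagon_eq[OF assms])

lemma octagon_range:
  assumes o: "octagon c d g W"
  shows "range g = {g 0, g 1, g 2, g 3, g 4, g 5, g 6, g 7}"
proof -
  have "g i \<in> {g 0, g 1, g 2, g 3, g 4, g 5, g 6, g 7}" for i
  proof -
    have "g i = g (i mod 8)" by (simp add: octagon_eq[OF o])
    moreover have "i mod 8 \<in> {0, 1, 2, 3, 4, 5, 6, 7}"
      using mod_less_divisor[of 8 i] by (simp only: insert_iff empty_iff) linarith
    ultimately show ?thesis by auto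
  qed
  then show ?thesis by blast
qed

lemma octagon_shift: "octagon c d g W \<Longrightarrow> octagon c d (\<lambda>i. g (i + k)) W"
  unfolding octagon_def using periodic_cycle_shift by blast

lemma blue_shift:
  assumes "octagon c d g W"
  shows "blue_odd d (\<lambda>i. g (i + 1)) x \<longleftrightarrow> blue_even d g x"
    "blue_even d (\<lambda>i. g (i + 1)) x \<longleftrightarrow> blue_odd d g x"
proof -
  have "g (1 + 1) = g 2" "g (3 + 1) = g 4" "g (5 + 1) = g 6" "g (7 + 1) = g 0"
    "g (0 + 1) = g 1" "g (2 + 1) = g 3" "g (4 + 1) = g 5" "g (6 + 1) = g 7"
    by (simp_all add: octagon_eq[OF assms])
  then show "blue_odd d (\<lambda>i. g (i + 1)) x \<longleftrightarrow> blue_even d g x"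
    "blue_even d (\<lambda>i. g (i + 1)) x \<longleftrightarrow> blue_odd d g x"
    unfolding blue_odd_def blue_even_def by metis+
qed

lemma octagon_cover:
  assumes o: "octagon c d g W" and w: "w \<in> W" and j: "j mod 8 = Suc i mod 8"
  shows "ad d w (g i) \<or> ad d w (g j)"
proof (rule ccontr)
  assume contr: "\<not> ?thesis"
  have "g j = g (i + 1)" using octagon_eq[OF o] j by simp
  then have "ad c w (g i)" "ad c w (g (i + 1))" using o w contr unfolding octagon_def by metis+
  then have "cyc (ad c) ([w] @ map g [i + 1..<Suc (i + 8)])"
    using o w by (intro cyc_reroute) (auto simp: octagon_def intro: ad_sym)
  then show False using no_C9[of "[w] @ map g [i + 1..<Suc (i + 8)]" c] by simp
qed

lemma octagon_covers:
  assumes "octagon c d g W" "w \<in> W"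
  shows "(ad d w (g 0) \<or> ad d w (g 1)) \<and> (ad d w (g 1) \<or> ad d w (g 2)) \<and> (ad d w (g 2) \<or> ad d w (g 3)) \<and>
    (ad d w (g 3) \<or> ad d w (g 4)) \<and> (ad d w (g 4) \<or> ad d w (g 5)) \<and> (ad d w (g 5) \<or> ad d w (g 6)) \<and>
    (ad d w (g 6) \<or> ad d w (g 7)) \<and> (ad d w (g 7) \<or> ad d w (g 0))"
  by (intro conjI octagon_cover[OF assms]) simp_all

text \<open>Otherwise the c-path y, x replaces an arc of length 2, and 8 - 2 + 1 + 2 = 9.\<close>

lemma octagon_red_edge:
  assumes o: "octagon c d g W" and w: "x \<in> W" "y \<in> W" "ad c y x" "\<not> ad d y (g i)"
    and j: "j mod 8 = (i + 2) mod 8"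
  shows "ad d x (g j)"
proof (rule ccontr)
  assume contr: "\<not> ?thesis"
  have gj: "g j = g (i + 2)" using octagon_eq[OF o] j by simp
  have "ad c y (g i)" "ad c x (g (i + 2))" using o w(1,2,4) contr gj unfolding octagon_def by metis+
  then have "cyc (ad c) ([y, x] @ map g [i + 2..<Suc (i + 8)])"
    using o w(1-3) ad_neq[OF w(3)]
    by (intro cyc_reroute) (auto simp: octagon_def intro: ad_sym)
  then show False using no_C9[of "[y, x] @ map g [i + 2..<Suc (i + 8)]" c] by simp
qed

text \<open>Five vertices of W and four of the cycle alternate, and the d-edge w w' inside W
  supplies the odd parity.\<close>

lemma octagon_path:
  assumes o: "octagon c d g W"
    and w: "distinct [w, u1, u2, u3, w']" "{w, u1, u2, u3, w'} \<subseteq> W" "ad d w w'"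
    and v: "distinct [v1, v2, v3, v4]" "{v1, v2, v3, v4} \<subseteq> range g"
    and e: "ad d w v1" "ad d u1 v1" "ad d u1 v2" "ad d u2 v2" "ad d u2 v3" "ad d u3 v3"
      "ad d u3 v4" "ad d w' v4"
  shows False
proof -
  have "\<forall>x\<in>{w, u1, u2, u3, w'}. x \<notin> range g" "\<forall>y\<in>{v1, v2, v3, v4}. y \<in> range g"
    using o w(2) v(2) unfolding octagon_def by (blast, simp)
  then have "\<forall>x\<in>{w, u1, u2, u3, w'}. \<forall>y\<in>{v1, v2, v3, v4}. x \<noteq> y" by metis
  then have "distinct [w, v1, u1, v2, u2, v3, u3, v4, w']" using w(1) v(1) by auto
  then show False
    using C9[of d w v1 u1 v2 u2 v3 u3 v4 w'] e(1,3,5,7) e(2,4,6,8)[THEN ad_sym] ad_sym[OF w(3)]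
    by blast
qed

text \<open>Applied at distance 2 on both sides of \<open>g 0\<close> and \<open>g 3\<close>,
  \<open>octagon_red_edge\<close> makes u1, u2, u3 d-joined to all of Q. As Q consists of two
  disjoint octagon edges, every vertex of W has two d-neighbors in Q, and
  \<open>octagon_path\<close> applies. The vertex w0 may itself be w or w'.\<close>

lemma octagon_three_red_neighbours:
  assumes o: "octagon c d g W"
    and w0: "w0 \<in> W" "\<not> ad d w0 (g 0)" "\<not> ad d w0 (g 3)"
    and u: "ad c w0 u1" "ad c w0 u2" "ad c w0 u3"
    and w: "distinct [w, u1, u2, u3, w']" "{w, u1, u2, u3, w'} \<subseteq> W" "ad d w w'"
  shows False
proof -
  let ?Q = "{g 1, g 2, g 5, g 6}"
  have Q: "ad d u v" if u: "u \<in> {u1, u2, u3}" and v: "v \<in> ?Q" for u v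
  proof -
    have r: "ad c w0 u" "u \<in> W" using that(1) u w(2) assms(5-7) by auto
    have "ad d u (g 2)" using octagon_red_edge[OF o r(2) w0(1) r(1) w0(2), of 2] by simp
    moreover have "ad d u (g 5)" using octagon_red_edge[OF o r(2) w0(1) r(1) w0(3), of 5] by simp
    moreover have "ad d u (g 6)"
      using octagon_red_edge[OF o w0(1) r(2) ad_sym[OF r(1)], of 6 0] w0(2) by auto
    moreover have "ad d u (g 1)"
      using octagon_red_edge[OF o w0(1) r(2) ad_sym[OF r(1)], of 1 3] w0(3) by auto
    ultimately show ?thesis using v by blast
  qed
  have two: "card {v \<in> ?Q. ad d x v} \<ge> 2" if x: "x \<in> W" for x
  proof -
    obtain a b where ab: "a \<in> {g 1, g 2}" "b \<in> {g 5, g 6}" "ad d x a" "ad d x b"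
      using octagon_covers[OF o x] by blast
    have "a \<noteq> b" using ab octagon_distinct[OF o] by auto
    then have "card {a, b} = 2" by simp
    moreover have "{a, b} \<subseteq> {v \<in> ?Q. ad d x v}" using ab by blast
    ultimately show ?thesis using card_mono[of "{v \<in> ?Q. ad d x v}" "{a, b}"] by simp
  qed
  have "card ?Q = 4" using octagon_distinct[OF o] by simp
  then have cQ: "card ?Q \<ge> 3" "card ?Q \<ge> 4" by linarith+
  have "w \<in> W" "w' \<in> W" using w(2) by auto
  then have c: "card {v \<in> ?Q. ad d w v} \<ge> 1" "card {v \<in> ?Q. ad d w' v} \<ge> 2"
    using two[of w] two[of w'] by linarith+
  obtain v1 v4 v2 v3 where v: "v1 \<in> {v \<in> ?Q. ad d w v}" "v4 \<in> {v \<in> ?Q. ad d w' v}"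
    "v2 \<in> ?Q" "v3 \<in> ?Q" "distinct [v1, v4, v2, v3]"
    by (rule four_distinct_representatives[OF c cQ])
  show False
  proof (rule octagon_path[OF o w])
    show "distinct [v1, v2, v3, v4]" using v(5) by auto
    show "{v1, v2, v3, v4} \<subseteq> range g" using v by auto
    show "ad d w v1" "ad d w' v4" using v by blast+
    have "v1 \<in> ?Q" "v4 \<in> ?Q" using v by blast+
    then show "ad d u1 v1" "ad d u1 v2" "ad d u2 v2" "ad d u2 v3" "ad d u3 v3" "ad d u3 v4"
      using Q v(3,4) by blast+
  qed
qed

definition mixed :: "'c \<Rightarrow> (nat \<Rightarrow> 'a) \<Rightarrow> 'a \<Rightarrow> bool" where
  "mixed d g x \<longleftrightarrow> \<not> blue_odd d g x \<and> \<not> blue_even d g x"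

lemma mixed_shift: "octagon c d g W \<Longrightarrow> mixed d (\<lambda>i. g (i + 1)) x \<longleftrightarrow> mixed d g x"
  unfolding mixed_def using blue_shift by blast

text \<open>The octagon vertices that a mixed vertex misses in d form an independent set with both
  parities, so two of them are at distance 3. The indices 8, 9, 10 spare a reduction modulo
  8.\<close>

lemma mixed_three_red_neighbours:
  assumes o: "octagon c d g W"
    and w0: "w0 \<in> W" "mixed d g w0"
    and u: "ad c w0 u1" "ad c w0 u2" "ad c w0 u3"
    and w: "distinct [w, u1, u2, u3, w']" "{w, u1, u2, u3, w'} \<subseteq> W" "ad d w w'"
  shows False
proof -
  have g8: "g 8 = g 0" "g 9 = g 1" "g 10 = g 2" by (simp_all add: octagon_eq[OF o])
  have k: False if "\<not> ad d w0 (g (0 + k))" "\<not> ad d w0 (g (3 + k))" for k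
    using octagon_three_red_neighbours[OF octagon_shift[OF o, of k] w0(1) _ _ u w] that by simp
  have "(\<not> ad d w0 (g 0) \<and> \<not> ad d w0 (g 3)) \<or> (\<not> ad d w0 (g 1) \<and> \<not> ad d w0 (g 4)) \<or>
    (\<not> ad d w0 (g 2) \<and> \<not> ad d w0 (g 5)) \<or> (\<not> ad d w0 (g 3) \<and> \<not> ad d w0 (g 6)) \<or>
    (\<not> ad d w0 (g 4) \<and> \<not> ad d w0 (g 7)) \<or> (\<not> ad d w0 (g 5) \<and> \<not> ad d w0 (g 8)) \<or>
    (\<not> ad d w0 (g 6) \<and> \<not> ad d w0 (g 9)) \<or> (\<not> ad d w0 (g 7) \<and> \<not> ad d w0 (g 10))"
    using octagon_covers[OF o w0(1)] w0(2)
    unfolding mixed_def blue_odd_def blue_even_def g8 by argo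
  moreover have "\<not> (\<not> ad d w0 (g i) \<and> \<not> ad d w0 (g j))" if "j = i + 3" for i j
    using k[of i] that by (metis add.commute add.left_neutral)
  ultimately show False by simp
qed

text \<open>A maximal independent set of the 8-cycle with both parities is a rotation of {0, 2, 5};
  the eight disjuncts list the complements.\<close>

lemma mixed_card_not_blue:
  assumes o: "octagon c d g W" and x: "x \<in> W" "mixed d g x"
  shows "\<exists>I\<subseteq>range g. card I \<le> 3 \<and> (\<forall>v\<in>range g - I. ad d x v)"
proof -
  have r: "range g = {g 0, g 1, g 2, g 3, g 4, g 5, g 6, g 7}"
    by (rule octagon_range[OF o])
  have k: ?thesis if "\<And>v. v \<in> {g 0, g 1, g 2, g 3, g 4, g 5, g 6, g 7} - {a, b, e} \<Longrightarrow> ad d x v"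
    "{a, b, e} \<subseteq> {g 0, g 1, g 2, g 3, g 4, g 5, g 6, g 7}" for a b e
    unfolding r using that card_length[of "[a, b, e]"] by (intro exI[of _ "{a, b, e}"]) auto
  have "(ad d x (g 1) \<and> ad d x (g 3) \<and> ad d x (g 4) \<and> ad d x (g 6) \<and> ad d x (g 7)) \<or>
    (ad d x (g 2) \<and> ad d x (g 4) \<and> ad d x (g 5) \<and> ad d x (g 7) \<and> ad d x (g 0)) \<or>
    (ad d x (g 3) \<and> ad d x (g 5) \<and> ad d x (g 6) \<and> ad d x (g 0) \<and> ad d x (g 1)) \<or>
    (ad d x (g 4) \<and> ad d x (g 6) \<and> ad d x (g 7) \<and> ad d x (g 1) \<and> ad d x (g 2)) \<or>
    (ad d x (g 5) \<and> ad d x (g 7) \<and> ad d x (g 0) \<and> ad d x (g 2) \<and> ad d x (g 3)) \<or>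
    (ad d x (g 6) \<and> ad d x (g 0) \<and> ad d x (g 1) \<and> ad d x (g 3) \<and> ad d x (g 4)) \<or>
    (ad d x (g 7) \<and> ad d x (g 1) \<and> ad d x (g 2) \<and> ad d x (g 4) \<and> ad d x (g 5)) \<or>
    (ad d x (g 0) \<and> ad d x (g 2) \<and> ad d x (g 3) \<and> ad d x (g 5) \<and> ad d x (g 6))"
    using octagon_covers[OF o x(1)] x(2) unfolding mixed_def blue_odd_def blue_even_def by argo
  then show ?thesis
  proof (elim disjE)
    assume "ad d x (g 1) \<and> ad d x (g 3) \<and> ad d x (g 4) \<and> ad d x (g 6) \<and> ad d x (g 7)"
    then show ?thesis by (intro k[of "g 0" "g 2" "g 5"]) blast+
  next
    assume "ad d x (g 2) \<and> ad d x (g 4) \<and> ad d x (g 5) \<and> ad d x (g 7) \<and> ad d x (g 0)"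
    then show ?thesis by (intro k[of "g 1" "g 3" "g 6"]) blast+
  next
    assume "ad d x (g 3) \<and> ad d x (g 5) \<and> ad d x (g 6) \<and> ad d x (g 0) \<and> ad d x (g 1)"
    then show ?thesis by (intro k[of "g 2" "g 4" "g 7"]) blast+
  next
    assume "ad d x (g 4) \<and> ad d x (g 6) \<and> ad d x (g 7) \<and> ad d x (g 1) \<and> ad d x (g 2)"
    then show ?thesis by (intro k[of "g 3" "g 5" "g 0"]) blast+
  next
    assume "ad d x (g 5) \<and> ad d x (g 7) \<and> ad d x (g 0) \<and> ad d x (g 2) \<and> ad d x (g 3)"
    then show ?thesis by (intro k[of "g 4" "g 6" "g 1"]) blast+
  next
    assume "ad d x (g 6) \<and> ad d x (g 0) \<and> ad d x (g 1) \<and> ad d x (g 3) \<and> ad d x (g 4)"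
    then show ?thesis by (intro k[of "g 5" "g 7" "g 2"]) blast+
  next
    assume "ad d x (g 7) \<and> ad d x (g 1) \<and> ad d x (g 2) \<and> ad d x (g 4) \<and> ad d x (g 5)"
    then show ?thesis by (intro k[of "g 6" "g 0" "g 3"]) blast+
  next
    assume "ad d x (g 0) \<and> ad d x (g 2) \<and> ad d x (g 3) \<and> ad d x (g 5) \<and> ad d x (g 6)"
    then show ?thesis by (intro k[of "g 7" "g 1" "g 4"]) blast+
  qed
qed

text \<open>Some even vertex is missed, and then both of its neighbors on the octagon must be
  d-neighbors.\<close>

lemma mixed_blue_odd_neighbours:
  assumes o: "octagon c d g W" and x: "x \<in> W" "\<not> blue_even d g x"
  shows "card {v \<in> {g 1, g 3, g 5, g 7}. ad d x v} \<ge> 2"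
proof -
  have "(ad d x (g 7) \<and> ad d x (g 1)) \<or> (ad d x (g 1) \<and> ad d x (g 3)) \<or>
    (ad d x (g 3) \<and> ad d x (g 5)) \<or> (ad d x (g 5) \<and> ad d x (g 7))"
    using octagon_covers[OF o x(1)] x(2) unfolding blue_even_def by argo
  then obtain a b where ab: "{a, b} \<subseteq> {v \<in> {g 1, g 3, g 5, g 7}. ad d x v}" "a \<noteq> b"
    using octagon_distinct[OF o] by auto
  have "card {a, b} = 2" using ab(2) by simp
  then show ?thesis using card_mono[OF _ ab(1)] by simp
qed

text \<open>Two mixed vertices miss at most three each, and 8 - 3 - 3 = 2; if x is d-joined to a
  whole parity class, m has two d-neighbors in that class.\<close>

lemma mixed_common_neighbours:
  assumes o: "octagon c d g W" and m: "m \<in> W" "mixed d g m" and x: "x \<in> W"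
  shows "card {v \<in> range g. ad d m v \<and> ad d x v} \<ge> 2"
proof -
  have fin: "finite (range g)" and c8: "card (range g) = 8"
    using card_range_cycle[of "ad c" 8 g] o unfolding octagon_def by simp_all
  then have finI: "finite {v \<in> range g. ad d m v \<and> ad d x v}" by simp
  consider "blue_odd d g x" | "blue_even d g x" | "mixed d g x" unfolding mixed_def by blast
  then show ?thesis
  proof cases
    case 1
    have "{v \<in> {g 1, g 3, g 5, g 7}. ad d m v} \<subseteq> {v \<in> range g. ad d m v \<and> ad d x v}"
      using 1 unfolding blue_odd_def by auto
    then show ?thesis
      using mixed_blue_odd_neighbours[OF o m(1)] m(2) card_mono[OF finI] unfolding mixed_def
      by (meson order.trans)
  next
    case 2
    let ?h = "\<lambda>i. g (i + 1)"
    have b: "blue_odd d ?h x" "\<not> blue_even d ?h m"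
      using 2 m(2) blue_shift[OF o] unfolding mixed_def by blast+
    have "{v \<in> {?h 1, ?h 3, ?h 5, ?h 7}. ad d m v} \<subseteq> {v \<in> range g. ad d m v \<and> ad d x v}"
      using b(1) unfolding blue_odd_def by auto
    then show ?thesis
      using mixed_blue_odd_neighbours[OF octagon_shift[OF o] m(1) b(2)] card_mono[OF finI]
      by (meson order.trans)
  next
    case 3
    obtain I where I: "I \<subseteq> range g" "card I \<le> 3" "\<forall>v\<in>range g - I. ad d m v"
      using mixed_card_not_blue[OF o m] by blast
    obtain J where J: "J \<subseteq> range g" "card J \<le> 3" "\<forall>v\<in>range g - J. ad d x v"
      using mixed_card_not_blue[OF o x 3] by blast
    have "card (range g) - card (I \<union> J) \<le> card (range g - (I \<union> J))"
      by (rule card_Diff_ge) (meson I(1) J(1) Un_least fin finite_subset)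
    moreover have "card (I \<union> J) \<le> 6" using card_Un_le[of I J] I(2) J(2) by linarith
    moreover have "card (range g - (I \<union> J)) \<le> card {v \<in> range g. ad d m v \<and> ad d x v}"
      by (rule card_mono[OF finI]) (use I(3) J(3) in blast)
    ultimately show ?thesis using c8 by linarith
  qed
qed

text \<open>The odd vertices u1, u2, y can be linked through any odd octagon vertices, so only the
  links of z are scarce: one common d-neighbor with w0 and one odd d-neighbor, chosen first.\<close>

lemma mixed_three_odd_neighbours:
  assumes o: "octagon c d g W" and w0: "mixed d g w0"
    and w: "distinct [w0, z, u1, u2, y]" "{w0, z, u1, u2, y} \<subseteq> W" "ad d w0 y"
    and b: "blue_odd d g y" "blue_odd d g u1" "blue_odd d g u2" "blue_odd d g z \<or> mixed d g z"
  shows False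
proof -
  let ?Od = "{g 1, g 3, g 5, g 7}"
  have W: "w0 \<in> W" "z \<in> W" using w(2) by auto
  have "card ?Od = 4" using octagon_distinct[OF o] by simp
  then have c34: "card ?Od \<ge> 3" "card ?Od \<ge> 4" by linarith+
  have c2: "card {v \<in> ?Od. ad d z v} \<ge> 2"
  proof (cases "blue_odd d g z")
    case True
    then have "{v \<in> ?Od. ad d z v} = ?Od" unfolding blue_odd_def by blast
    then show ?thesis using \<open>card ?Od = 4\<close> by (simp only:)
  next
    case False
    then show ?thesis using mixed_blue_odd_neighbours[OF o W(2)] b(4) unfolding mixed_def by blast
  qed
  have c1: "card {v \<in> range g. ad d w0 v \<and> ad d z v} \<ge> 1"
    using mixed_common_neighbours[OF o W(1) w0 W(2)] by linarith
  obtain v1 v2 v3 v4 where v: "v1 \<in> {v \<in> range g. ad d w0 v \<and> ad d z v}"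
    "v2 \<in> {v \<in> ?Od. ad d z v}" "v3 \<in> ?Od" "v4 \<in> ?Od" "distinct [v1, v2, v3, v4]"
    by (rule four_distinct_representatives[OF c1 c2 c34])
  have od: "ad d u v" if "v \<in> ?Od" "u \<in> {y, u1, u2}" for u v
    using that b(1-3) unfolding blue_odd_def by blast
  show False
  proof (rule octagon_path[OF o w v(5)])
    show "{v1, v2, v3, v4} \<subseteq> range g" using v(1-4) by blast
    show "ad d w0 v1" "ad d z v1" "ad d z v2" using v(1,2) by blast+
    have "v2 \<in> ?Od" using v(2) by blast
    then show "ad d u1 v2" "ad d u1 v3" "ad d u2 v3" "ad d u2 v4" "ad d y v4"
      using od v(3,4) by blast+
  qed
qed

text \<open>Three odd vertices, one of them a d-neighbor of w0, force all other vertices of W except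
  w0 to be even by \<open>mixed_three_odd_neighbours\<close>. At least five even vertices then
  repeat the argument on the octagon shifted by one, where the parities are exchanged.\<close>

lemma mixed_few_odd:
  assumes o: "octagon c d g W" and cW: "card W \<ge> 9" and w0: "w0 \<in> W" "mixed d g w0"
    and X: "card {x \<in> W - {w0}. \<not> ad d w0 x} \<le> 2"
  shows "card {x \<in> W - {w0}. blue_odd d g x} \<le> 2"
proof (rule ccontr)
  define Xs where "Xs = {x \<in> W - {w0}. \<not> ad d w0 x}"
  define Es where "Es = {x \<in> W - {w0}. blue_odd d g x}"
  assume "\<not> ?thesis"
  then have cE: "card Es \<ge> 3" unfolding Es_def by linarith
  have finW: "finite W" using cW by (metis card.infinite not_numeral_le_zero)
  have finX: "finite Xs" and cX: "card Xs \<le> 2" unfolding Xs_def using finW X by auto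
  have "card (Es - Xs) \<ge> 1" using card_Diff_ge[OF finX, of Es] cE cX by linarith
  then obtain y where y: "y \<in> Es" "y \<notin> Xs" using ex_of_card by blast
  have "card (Es - {y}) \<ge> 2" using card_Diff_one[of Es y] cE by linarith
  then obtain u1 u2 where u: "u1 \<in> Es - {y}" "u2 \<in> Es - {y}" "u1 \<noteq> u2" by (rule two_of_card)
  have E: "x \<in> W" "x \<noteq> w0" "blue_odd d g x" if "x \<in> Es" for x using that unfolding Es_def by auto
  have nX: "ad d w0 x" if "x \<in> W" "x \<noteq> w0" "x \<notin> Xs" for x using that unfolding Xs_def by auto
  define Z where "Z = W - {w0, y, u1, u2}"
  have Z: "x \<in> W" "x \<noteq> w0" if "x \<in> Z" for x using that unfolding Z_def by auto
  have cZ: "card Z \<ge> 5"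
    unfolding Z_def
    using card_Diff_ge[of "{w0, y, u1, u2}" W] cW card_length[of "[w0, y, u1, u2]"] by simp
  have even: "blue_even d g z" if z: "z \<in> Z" for z
  proof (rule ccontr)
    assume "\<not> ?thesis"
    then have b: "blue_odd d g z \<or> mixed d g z" unfolding mixed_def by blast
    show False
    proof (rule mixed_three_odd_neighbours[OF o w0(2) _ _ _ _ _ _ b])
      show "distinct [w0, z, u1, u2, y]" using u y z E unfolding Z_def by auto
      show "{w0, z, u1, u2, y} \<subseteq> W" using u y z E(1) Z(1) w0(1) by auto
      show "ad d w0 y" using nX E y by blast
    qed (use u y E in auto)
  qed
  have "card (Z - Xs) \<ge> 1" using card_Diff_ge[OF finX, of Z] cZ cX by linarith
  then obtain y' where y': "y' \<in> Z" "y' \<notin> Xs" using ex_of_card by blast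
  have "card (Z - {y'}) \<ge> 3" using card_Diff_one[of Z y'] cZ by linarith
  then obtain a b e where abe: "distinct [a, b, e]" "{a, b, e} \<subseteq> Z - {y'}" by (rule three_of_card)
  have odd: "blue_odd d (\<lambda>i. g (i + 1)) z" if "z \<in> Z" for z
    using even[OF that] blue_shift(1)[OF o] by blast
  show False
  proof (rule mixed_three_odd_neighbours[OF octagon_shift[OF o, of 1], of w0 a b e y'])
    show "mixed d (\<lambda>i. g (i + 1)) w0" using mixed_shift[OF o] w0(2) by blast
    show "distinct [w0, a, b, e, y']" "{w0, a, b, e, y'} \<subseteq> W" using abe y' Z w0 by auto
    show "ad d w0 y'" using nX Z y' by blast
  qed (use abe(2) y' odd in auto)
qed

text \<open>Three c-neighbors of a mixed vertex m rule out d-edges at m, and then any d-edge in W;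
  so m misses at most two vertices of W in d. Besides w0 at most two vertices are odd and at most
  two even, so at least five are mixed, and d is dense enough for a 9-cycle.\<close>

lemma octagon_no_mixed:
  assumes o: "octagon c d g W" and cW: "card W \<ge> 9"
    and red: "\<And>m x. m \<in> W \<Longrightarrow> mixed d g m \<Longrightarrow> x \<in> W \<Longrightarrow> x \<noteq> m \<Longrightarrow> \<not> ad d m x \<Longrightarrow> ad c m x"
    and w0: "w0 \<in> W" "mixed d g w0" and xy: "x \<in> W" "y \<in> W" "ad d x y"
  shows False
proof -
  have finW: "finite W" using cW by (metis card.infinite not_numeral_le_zero)
  define Xs where "Xs m = {x \<in> W - {m}. \<not> ad d m x}" for m
  have Xs: "u \<in> W" "u \<noteq> m" "\<not> ad d m u" if "u \<in> Xs m" for u m using that unfolding Xs_def by auto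
  have finX: "finite (Xs m)" for m unfolding Xs_def using finW by auto
  have cX: "card (Xs m) \<le> 2" if m: "m \<in> W" "mixed d g m" for m
  proof (rule ccontr)
    assume "\<not> ?thesis"
    then have "card (Xs m) \<ge> 3" by simp
    then obtain u1 u2 u3 where u: "distinct [u1, u2, u3]" "{u1, u2, u3} \<subseteq> Xs m"
      by (rule three_of_card)
    have redX: "ad c m u" if "u \<in> Xs m" for u using red[OF m] Xs[OF that] by blast
    have no: "\<not> ad d m z" if z: "z \<in> W" "z \<noteq> m" for z
    proof
      assume mz: "ad d m z"
      show False
      proof (rule mixed_three_red_neighbours[OF o m])
        show "ad c m u1" "ad c m u2" "ad c m u3" using u redX by auto
        show "distinct [m, u1, u2, u3, z]" "{m, u1, u2, u3, z} \<subseteq> W" "ad d m z"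
          using u mz z m(1) Xs[of _ m] by auto
      qed
    qed
    have "x \<noteq> m" "y \<noteq> m" using no[of y] no[of x] xy ad_sym ad_irrefl by blast+
    have "x \<noteq> y" using ad_neq[OF xy(3)] .
    have "card (W - {m, x, y}) \<ge> 3"
      using card_Diff_ge[of "{m, x, y}" W] cW card_length[of "[m, x, y]"] by simp
    then obtain a b e where abe: "distinct [a, b, e]" "{a, b, e} \<subseteq> W - {m, x, y}"
      by (rule three_of_card)
    have "v \<in> Xs m" if "v \<in> W" "v \<noteq> m" for v using no that unfolding Xs_def by blast
    then have "ad c m a" "ad c m b" "ad c m e" using abe(2) redX by auto
    then show False
      by (rule mixed_three_red_neighbours[OF o m, of a b e x y])
        (use abe xy \<open>x \<noteq> y\<close> in auto)
  qed
  let ?h = "\<lambda>i. g (i + 1)"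
  define Es where "Es = {x \<in> W - {w0}. blue_odd d g x} \<union> {x \<in> W - {w0}. blue_odd d ?h x}"
  define Ms where "Ms = {x \<in> W. mixed d g x}"
  have M: "m \<in> W" "mixed d g m" if "m \<in> Ms" for m using that unfolding Ms_def by auto
  have "card {x \<in> W - {w0}. \<not> ad d w0 x} \<le> 2" using cX[OF w0] unfolding Xs_def .
  then have "card {x \<in> W - {w0}. blue_odd d g x} \<le> 2" "card {x \<in> W - {w0}. blue_odd d ?h x} \<le> 2"
    using mixed_few_odd[OF o cW w0]
      mixed_few_odd[OF octagon_shift[OF o, of 1] cW w0(1)] mixed_shift[OF o] w0(2) by blast+
  then have "card Es \<le> 4" unfolding Es_def by (intro order.trans[OF card_Un_le]) linarith
  moreover have finE: "finite Es" unfolding Es_def using finW by auto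
  ultimately have "card (W - Es) \<ge> 5" using card_Diff_ge[OF finE, of W] cW by linarith
  moreover have "W - Es \<subseteq> Ms"
    unfolding Es_def Ms_def using w0 blue_shift(1)[OF o] unfolding mixed_def by blast
  moreover have "finite Ms" unfolding Ms_def using finW by auto
  ultimately have cM: "card Ms \<ge> 5" using card_mono[of Ms "W - Es"] by linarith
  then obtain a where a: "a \<in> Ms" using ex_of_card[of Ms] by auto
  have "card (Ms - {a}) \<ge> 4" using card_Diff_one[of Ms a] cM by linarith
  then have "card (Ms - {a} - Xs a) \<ge> 1"
    using card_Diff_ge[OF finX[of a], of "Ms - {a}"] cX[OF M[OF a]] by linarith
  then obtain b where b: "b \<in> Ms" "b \<noteq> a" "b \<notin> Xs a" using ex_of_card by blast
  have ab: "ad d a b" using b M(1)[OF b(1)] unfolding Xs_def by blast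
  have "card (Ms - {a, b}) \<ge> 2" using card_Diff_two[of Ms a b] cM by linarith
  then obtain m m1 where m: "m \<in> Ms - {a, b}" "m1 \<in> Ms - {a, b}" "m \<noteq> m1" by (rule two_of_card)
  have MW: "a \<in> W" "b \<in> W" "m \<in> W" "m1 \<in> W" "mixed d g m" using a b m M by auto
  have c2: "card (Xs a) \<le> 2" "card (Xs b) \<le> 2" "card (Xs m1) \<le> 2" using cX M a b(1) m by auto
  \<comment> \<open>The aim is the d-cycle v1, m1, v2, a, b, v3, p, m, q with p and q on the
    octagon. As m1, a, b miss at most two vertices each, every choice excludes at most four of the
    five candidates.\<close>
  define Fs where "Fs = W - {m, m1, a, b}"
  have cF: "card Fs \<ge> 5"
    unfolding Fs_def
    using card_Diff_ge[of "{m, m1, a, b}" W] cW card_length[of "[m, m1, a, b]"] by simp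
  have F: "v \<in> W" "v \<notin> {m, m1, a, b}" if "v \<in> Fs" for v using that unfolding Fs_def by auto
  have nX: "ad d q v" if "q \<in> {m1, a, b}" "v \<in> Fs" "v \<notin> Xs q" for q v
    using that F[OF that(2)] unfolding Xs_def by auto
  have "card (Xs m1 \<union> Xs a) \<le> 4" using card_Un_le[of "Xs m1" "Xs a"] c2 by linarith
  then have "card (Fs - (Xs m1 \<union> Xs a)) \<ge> 1"
    using card_Diff_ge[of "Xs m1 \<union> Xs a" Fs] finX cF by fastforce
  then obtain v2 where v2: "v2 \<in> Fs" "v2 \<notin> Xs m1" "v2 \<notin> Xs a" using ex_of_card by blast
  have "card (insert v2 (Xs b)) \<le> 3" using card_insert_le_m1[of 3 "Xs b" v2] c2 by simp
  then have "card (Fs - insert v2 (Xs b)) \<ge> 1"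
    using card_Diff_ge[of "insert v2 (Xs b)" Fs] finX cF by fastforce
  then obtain v3 where v3: "v3 \<in> Fs" "v3 \<notin> Xs b" "v3 \<noteq> v2" using ex_of_card by blast
  have "card (insert v3 (Xs m1)) \<le> 3" using card_insert_le_m1[of 3 "Xs m1" v3] c2 by simp
  then have "card (insert v2 (insert v3 (Xs m1))) \<le> 4"
    using card_insert_le_m1[of 4 "insert v3 (Xs m1)" v2] by simp
  then have "card (Fs - insert v2 (insert v3 (Xs m1))) \<ge> 1"
    using card_Diff_ge[of "insert v2 (insert v3 (Xs m1))" Fs] finX cF by fastforce
  then obtain v1 where v1: "v1 \<in> Fs" "v1 \<notin> Xs m1" "v1 \<noteq> v2" "v1 \<noteq> v3" using ex_of_card by blast
  have "card {v \<in> range g. ad d m v \<and> ad d v3 v} \<ge> 1" "card {v \<in> range g. ad d m v \<and> ad d v1 v} \<ge> 2"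
    using mixed_common_neighbours[OF o MW(3,5) F(1)[OF v3(1)]]
      mixed_common_neighbours[OF o MW(3,5) F(1)[OF v1(1)]] by linarith+
  then obtain p q where pq: "p \<in> {v \<in> range g. ad d m v \<and> ad d v3 v}"
    "q \<in> {v \<in> range g. ad d m v \<and> ad d v1 v}" "p \<noteq> q"
    by (rule two_distinct_representatives)
  have e: "ad d m p" "ad d v3 p" "ad d m q" "ad d v1 q" "p \<in> range g" "q \<in> range g"
    using pq by auto
  have "\<forall>x\<in>{v1, m1, v2, a, b, v3, m}. x \<in> W" using F(1) v1 v2 v3 MW by simp
  then have "\<forall>x\<in>{v1, m1, v2, a, b, v3, m}. x \<noteq> p \<and> x \<noteq> q"
    using e(5,6) o unfolding octagon_def by blast
  then have dist: "distinct [v1, m1, v2, a, b, v3, p, m, q]"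
    using v1(3,4) v2 v3(3) m b(2) F(2)[OF v1(1)] F(2)[OF v2(1)] F(2)[OF v3(1)] pq(3) by auto
  have "ad d m1 v1" "ad d m1 v2" "ad d a v2" "ad d b v3" using nX v1 v2 v3 by auto
  then show False
    using C9[of d v1 m1 v2 a b v3 p m q] ab e dist ad_sym by metis
qed

text \<open>T is a c-clique, since its five vertices are d-joined to the four odd octagon vertices.
  If two vertices of T missed different even vertices in d, a c-path of 2 or 4 vertices in T would
  replace an arc of the same length and give a c-cycle of length 9. Hence T is d-joined to nearly
  the whole octagon, and \<open>octagon_path\<close> applies to xy.\<close>

lemma octagon_no_unmixed:
  assumes o: "octagon c d g W" and T: "T \<subseteq> W" "card T \<ge> 5" "\<And>t. t \<in> T \<Longrightarrow> blue_odd d g t"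
    and tc: "\<And>x y. x \<in> T \<Longrightarrow> y \<in> T \<Longrightarrow> x \<noteq> y \<Longrightarrow> ad c x y \<or> ad d x y"
    and xy: "x \<in> W" "y \<in> W" "ad d x y"
  shows False
proof -
  have r: "range g = {g 0, g 1, g 2, g 3, g 4, g 5, g 6, g 7}"
    by (rule octagon_range[OF o])
  have dist: "distinct [g 0, g 1, g 2, g 3, g 4, g 5, g 6, g 7]"
    "distinct [g 7, g 6, g 5, g 4, g 3, g 2, g 1, g 0]" by (rule octagon_distinct[OF o])+
  have "joined d T {g 1, g 3, g 5, g 7}" using T(3) unfolding joined_def blue_odd_def by blast
  moreover have "card {g 1, g 3, g 5, g 7} \<ge> 4" using dist by simp
  ultimately have noT: "\<not> ad d t t'" if "t \<in> T" "t' \<in> T" for t t'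
    using joined_no_edge[OF _ T(2)] that by blast
  then have red: "ad c t t'" if "t \<in> T" "t' \<in> T" "t \<noteq> t'" for t t'
    using tc that by blast
  have diff2: False
    if t: "t \<in> T" "t' \<in> T" "t \<noteq> t'" "\<not> ad d t (g i)" "\<not> ad d t' (g j)" and j: "j mod 8 = (i + 2) mod 8"
    for t t' i j
    using octagon_red_edge[OF o _ _ red[OF t(1-3)] t(4) j] t T(1) by blast
  have diff4: False
    if t: "t \<in> T" "t' \<in> T" "t \<noteq> t'" "\<not> ad d t (g i)" "\<not> ad d t' (g j)" and j: "j mod 8 = (i + 4) mod 8"
    for t t' i j
  proof -
    have "card (T - {t, t'}) \<ge> 2" using card_Diff_two[of T t t'] T(2) by linarith
    then obtain a b where ab: "a \<in> T - {t, t'}" "b \<in> T - {t, t'}" "a \<noteq> b" by (rule two_of_card)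
    have gj: "g j = g (i + 4)" using octagon_eq[OF o] j by simp
    have "t \<in> W" "t' \<in> W" using t T(1) by auto
    then have rr: "ad c t (g i)" "ad c t' (g (i + 4))"
      using o t(4,5) gj unfolding octagon_def by metis+
    have "cyc (ad c) ([t, a, b, t'] @ map g [i + 4..<Suc (i + 8)])"
    proof (rule cyc_reroute)
      show "periodic_cycle (ad c) 8 g" "set [t, a, b, t'] \<inter> range g = {}"
        using o ab t(1,2) T(1) unfolding octagon_def by auto
      show "distinct [t, a, b, t']" using ab t(3) by auto
      show "successively (ad c) [t, a, b, t']" using red ab t(1-3) by auto
      show "ad c (g i) (hd [t, a, b, t'])" using ad_sym[OF rr(1)] by simp
      show "ad c (last [t, a, b, t']) (g (i + 4))" using rr(2) by simp
    qed auto
    then show False using no_C9[of "[t, a, b, t'] @ map g [i + 4..<Suc (i + 8)]" c] by simp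
  qed
  have conflict: "i = j"
    if t: "t \<in> T" "t' \<in> T" "t \<noteq> t'" "\<not> ad d t (g i)" "\<not> ad d t' (g j)"
      and ij: "i \<in> {0, 2, 4, 6}" "j \<in> {0, 2, 4, 6}" for t t' i j
  proof (rule ccontr)
    assume "i \<noteq> j"
    then have "j mod 8 = (i + 2) mod 8 \<or> i mod 8 = (j + 2) mod 8 \<or> j mod 8 = (i + 4) mod 8"
      using ij by auto
    then show False
      using diff2[OF t] diff2[OF t(2,1) t(3)[symmetric] t(5,4)] diff4[OF t] by blast
  qed
  have nonblue: "\<exists>i\<in>{0, 2, 4, 6}. v = g i" if "t \<in> T" "v \<in> range g" "\<not> ad d t v" for t v
    using T(3)[OF that(1)] that(2,3) unfolding r blue_odd_def by blast
  \<comment> \<open>Either one vertex of T misses two octagon vertices, and then the others miss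
    none, or one octagon vertex accounts for all misses.\<close>
  obtain T' D where TD: "T' \<subseteq> T" "card T' \<ge> 4" "D \<subseteq> range g" "card (range g - D) \<le> 1" "joined d T' D"
  proof (cases "\<exists>t\<in>T. \<exists>i\<in>{0, 2, 4, 6}. \<exists>j\<in>{0, 2, 4, 6}. i \<noteq> j \<and> \<not> ad d t (g i) \<and> \<not> ad d t (g j)")
    case True
    then obtain t i j where t: "t \<in> T" "i \<in> {0, 2, 4, 6}" "j \<in> {0, 2, 4, 6}" "i \<noteq> j"
      "\<not> ad d t (g i)" "\<not> ad d t (g j)" by blast
    have "ad d t' v" if t': "t' \<in> T - {t}" "v \<in> range g" for t' v
    proof (rule ccontr)
      assume n: "\<not> ad d t' v"
      then obtain l where l: "l \<in> {0, 2, 4, 6}" "v = g l" using nonblue[of t' v] t' by blast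
      have "i = l" "j = l"
        using conflict[OF t(1) _ _ t(5) _ t(2) l(1), of t'] conflict[OF t(1) _ _ t(6) _ t(3) l(1), of t']
          t' n l(2) by auto
      then show False using t(4) by simp
    qed
    then have "joined d (T - {t}) (range g)" unfolding joined_def by blast
    moreover have "card (T - {t}) \<ge> 4" using card_Diff_one[of T t] T(2) by linarith
    ultimately show thesis using that[of "T - {t}" "range g"] by auto
  next
    case False
    show thesis
    proof (cases "\<exists>t\<in>T. \<exists>i\<in>{0, 2, 4, 6}. \<not> ad d t (g i)")
      case True
      then obtain t i where t: "t \<in> T" "i \<in> {0, 2, 4, 6}" "\<not> ad d t (g i)" by blast
      have "ad d t' v" if t': "t' \<in> T" "v \<in> range g - {g i}" for t' v
      proof (rule ccontr)
        assume n: "\<not> ad d t' v"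
        then obtain l where l: "l \<in> {0, 2, 4, 6}" "v = g l" using nonblue[of t' v] t' by blast
        have "i = l"
        proof (cases "t' = t")
          case True
          then show ?thesis using False t l n by blast
        next
          case f: False
          then show ?thesis using conflict[OF t(1) _ _ t(3) _ t(2) l(1), of t'] t' n l(2) by auto
        qed
        then show False using l(2) t'(2) by blast
      qed
      then have "joined d T (range g - {g i})" unfolding joined_def by blast
      moreover have "range g - (range g - {g i}) = {g i}" by blast
      ultimately show thesis using that[of T "range g - {g i}"] T(2) by auto
    next
      case f: False
      have "ad d t v" if "t \<in> T" "v \<in> range g" for t v
        using nonblue[OF that] f that(1) by metis
      then have "joined d T (range g)" unfolding joined_def by blast
      then show thesis using that[of T "range g"] T(2) by auto
    qed
  qed
  have finr: "finite (range g)" and c8: "card (range g) = 8"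
    using card_range_cycle[of "ad c" 8 g] o unfolding octagon_def by simp_all
  have finD: "finite D" using TD(3) finr finite_subset by blast
  have three: "card {v \<in> D. ad d w v} \<ge> 2" if w: "w \<in> W" for w
  proof -
    obtain p q s where pqs: "p \<in> {g 0, g 1}" "q \<in> {g 2, g 3}" "s \<in> {g 4, g 5}"
      "ad d w p" "ad d w q" "ad d w s"
      using octagon_covers[OF o w] by blast
    have d3: "distinct [p, q, s]" using pqs(1-3) dist by auto
    have "card ({p, q, s} - (range g - D)) \<ge> 2"
      using card_Diff_ge[of "range g - D" "{p, q, s}"] finr TD(4) d3 by fastforce
    moreover have "{p, q, s} - (range g - D) \<subseteq> {v \<in> D. ad d w v}"
      using pqs unfolding r by blast
    moreover have "finite {v \<in> D. ad d w v}" using finD by simp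
    ultimately show ?thesis using card_mono by (meson order.trans)
  qed
  have "card (range g - (range g - D)) \<ge> 7"
    using card_Diff_ge[of "range g - D" "range g"] finr TD(4) c8 by fastforce
  moreover have "range g - (range g - D) = D" using TD(3) by blast
  ultimately have cD: "card D \<ge> 3" "card D \<ge> 4" by simp_all
  have "x \<notin> T \<or> y \<notin> T" using noT xy by blast
  then have "card (T' - {x, y}) \<ge> 3"
  proof
    assume "x \<notin> T"
    then have eq: "T' - {x, y} = T' - {y}" using TD(1) by blast
    show ?thesis unfolding eq using card_Diff_one[of T' y] TD(2) by linarith
  next
    assume "y \<notin> T"
    then have eq: "T' - {x, y} = T' - {x}" using TD(1) by blast
    show ?thesis unfolding eq using card_Diff_one[of T' x] TD(2) by linarith
  qed
  then obtain u1 u2 u3 where u: "distinct [u1, u2, u3]" "{u1, u2, u3} \<subseteq> T' - {x, y}"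
    by (rule three_of_card)
  have c1: "card {v \<in> D. ad d x v} \<ge> 1" and c2: "card {v \<in> D. ad d y v} \<ge> 2"
    using three xy by (force, blast)
  obtain v1 v4 v2 v3 where v: "v1 \<in> {v \<in> D. ad d x v}" "v4 \<in> {v \<in> D. ad d y v}" "v2 \<in> D" "v3 \<in> D"
    "distinct [v1, v4, v2, v3]"
    by (rule four_distinct_representatives[OF c1 c2 cD])
  have e: "ad d t v" if "t \<in> {u1, u2, u3}" "v \<in> D" for t v
    using joinedD[OF TD(5)] that u(2) by blast
  show False
  proof (rule octagon_path[OF o])
    show "distinct [x, u1, u2, u3, y]" using u ad_neq[OF xy(3)] by auto
    show "{x, u1, u2, u3, y} \<subseteq> W" using xy(1,2) u(2) TD(1) T(1) by auto
    show "ad d x y" by fact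
    show "distinct [v1, v2, v3, v4]" using v(5) by auto
    have D: "v1 \<in> D" "v4 \<in> D" using v(1,2) by auto
    then show "{v1, v2, v3, v4} \<subseteq> range g" using v(3,4) TD(3) by blast
    show "ad d x v1" "ad d y v4" using v(1,2) by auto
    show "ad d u1 v1" "ad d u1 v2" "ad d u2 v2" "ad d u2 v3" "ad d u3 v3" "ad d u3 v4"
      using e D v(3,4) by simp_all
  qed
qed

text \<open>S holds d-universal vertices; edges inside S are not controlled, so S has to be kept out
  of the clique arguments. Vertices of S are not mixed, and a parity class of five has a member
  outside S, to which a member in S would send a forbidden d-edge. Without mixed vertices, two
  classes of at most four would cover W.\<close>

theorem octagon_complement:
  assumes o: "octagon c d g W" and cW: "card W \<ge> 9" and S: "S \<subseteq> W" "card S < 5"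
    and tc: "\<And>x y. x \<in> W \<Longrightarrow> y \<in> W \<Longrightarrow> x \<noteq> y \<Longrightarrow> x \<notin> S \<or> y \<notin> S \<Longrightarrow> ad c x y \<or> ad d x y"
    and sd: "\<And>s x. s \<in> S \<Longrightarrow> x \<in> W - S \<Longrightarrow> ad d s x" and sg: "\<And>s i. s \<in> S \<Longrightarrow> ad d s (g i)"
    and xy: "x \<in> W" "y \<in> W" "ad d x y"
  shows False
proof -
  have finW: "finite W" using cW by (metis card.infinite not_numeral_le_zero)
  have big: "card {x \<in> W. blue_odd d h x} < 5" if h: "octagon c d h W" for h
  proof (rule ccontr)
    let ?T = "{x \<in> W. blue_odd d h x}"
    assume "\<not> ?thesis"
    then have cT: "card ?T \<ge> 5" by simp
    have noT: "\<not> ad d t t'" if "t \<in> ?T" "t' \<in> ?T" for t t'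
    proof (rule joined_no_edge[OF _ cT _ that])
      show "joined d ?T {h 1, h 3, h 5, h 7}" unfolding joined_def blue_odd_def by blast
      show "4 \<le> card {h 1, h 3, h 5, h 7}" using octagon_distinct[OF h] by simp
    qed
    have TS: "t \<notin> S" if t: "t \<in> ?T" for t
    proof
      assume "t \<in> S"
      have "\<not> ?T \<subseteq> S" using card_mono[of S ?T] S cT finite_subset[OF S(1) finW] by linarith
      then obtain t' where "t' \<in> ?T" "t' \<notin> S" by blast
      then show False using noT[OF t, of t'] sd[OF \<open>t \<in> S\<close>, of t'] by blast
    qed
    show False
      by (rule octagon_no_unmixed[OF h _ cT _ _ xy]) (use tc TS in blast)+
  qed
  show False
  proof (cases "\<exists>w\<in>W. mixed d g w")
    case True
    then obtain w0 where w0: "w0 \<in> W" "mixed d g w0" by blast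
    show False
    proof (rule octagon_no_mixed[OF o cW _ w0 xy])
      fix m z assume m: "m \<in> W" "mixed d g m" and z: "z \<in> W" "z \<noteq> m" "\<not> ad d m z"
      have "m \<notin> S" using m(2) sg unfolding mixed_def blue_odd_def by blast
      then show "ad c m z" using tc[of m z] m z by blast
    qed
  next
    case False
    let ?h = "\<lambda>i. g (i + 1)"
    have "W \<subseteq> {x \<in> W. blue_odd d g x} \<union> {x \<in> W. blue_odd d ?h x}"
      using False blue_shift(1)[OF o] unfolding mixed_def by blast
    then have "card W \<le> card ({x \<in> W. blue_odd d g x} \<union> {x \<in> W. blue_odd d ?h x})"
      using finW by (intro card_mono) auto
    also have "\<dots> \<le> card {x \<in> W. blue_odd d g x} + card {x \<in> W. blue_odd d ?h x}"
      by (rule card_Un_le)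
    finally show False using big[OF o] big[OF octagon_shift[OF o, of 1]] cW by linarith
  qed
qed

end

section \<open>The two-color bound\<close>

context c9_free
begin

text \<open>With \<open>card A = 3\<close>, \<open>three_universal_vertices\<close> leaves a
  d-clique of at least 17 - 6 - 3 = 8 vertices. If it has only 8, then B is nonempty and one of its
  vertices completes a d-clique of 9.\<close>

lemma universal_triple_bound:
  assumes tc: "two_colored c d V" and j: "joined c A V" "joined d B V"
    and AB: "card B \<le> 3" and n: "card V + card A + card B \<ge> 17" "card A \<le> 3"
  shows "card A \<le> 2"
proof (rule ccontr)
  assume "\<not> card A \<le> 2"
  then have A3: "card A \<ge> 3" by simp
  have V6: "card V \<ge> 6" using AB n by linarith
  obtain R where R: "R \<subseteq> V" "card R \<ge> card V - 3" "\<And>x y. x \<in> R \<Longrightarrow> y \<in> R \<Longrightarrow> \<not> ad c x y"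
    using three_universal_vertices[OF j(1) A3 V6] by metis
  have e: "ad d x y" if "x \<in> R" "y \<in> R" "x \<noteq> y" for x y
    using two_coloredD[OF tc _ _ that(3) R(3)[OF that(1,2)]] R(1) that(1,2) by blast
  show False
  proof (cases "card R \<ge> 9")
    case True
    then show False using no_clique[of R d] e by blast
  next
    case False
    then have "card B \<ge> 1" "card R \<ge> 8" using R(2) n AB by linarith+
    then obtain s where s: "s \<in> B" using ex_of_card by blast
    have se: "ad d s x" "ad d x s" if "x \<in> R" for x
      using joinedD[OF j(2) s, of x] R(1) that ad_sym by blast+
    have "s \<notin> R" using se ad_irrefl by blast
    moreover have "finite R" using \<open>card R \<ge> 8\<close> by (metis card.infinite not_numeral_le_zero)
    ultimately have "card (insert s R) \<ge> 9" using \<open>card R \<ge> 8\<close> by simp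
    then show False
    proof (rule no_clique)
      fix x y assume "x \<in> insert s R" "y \<in> insert s R" "x \<noteq> y"
      then show "ad d x y" using e se by blast
    qed
  qed
qed

text \<open>Two universal vertices can be inserted on the two sides of \<open>g 6\<close>.\<close>

lemma heptagon_universal:
  assumes g: "periodic_cycle (ad c) 7 g" "range g \<subseteq> V" and j: "joined c A V"
  shows "card A \<le> 1"
proof (rule ccontr)
  assume "\<not> card A \<le> 1"
  then have "card A \<ge> 2" by simp
  then obtain s t where st: "s \<in> A" "t \<in> A" "s \<noteq> t" by (rule two_of_card)
  have ge: "ad c (g i) (g (Suc i))" and gm: "g i = g j \<longleftrightarrow> i mod 7 = j mod 7" for i j
    using g(1) unfolding periodic_cycle_def by blast+
  have step: "ad c (g i) (g k)" if "k = Suc i" for i k using ge[of i] that by simp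
  have e: "ad c (g 0) (g 1)" "ad c (g 1) (g 2)" "ad c (g 2) (g 3)" "ad c (g 3) (g 4)"
    "ad c (g 4) (g 5)" by (rule step; simp)+
  have s: "ad c x (g i)" "ad c (g i) x" if "x \<in> {s, t}" for x i
    using joinedD[OF j, of x "g i"] st that g(2) ad_sym by blast+
  have "x \<noteq> g i" if "x \<in> {s, t}" for x i using ad_neq[OF s(1)[OF that]] .
  then have "distinct [g 0, g 1, g 2, g 3, g 4, g 5, s, g 6, t]"
    using st(3) by (auto simp: gm)
  then show False
    using C9[of c "g 0" "g 1" "g 2" "g 3" "g 4" "g 5" s "g 6" t] e s by blast
qed

text \<open>A vertex of A could be inserted into the octagon, so A is empty. With B included, W has
  at least 17 - 8 = 9 vertices and no d-edge by \<open>octagon_complement\<close>; hence B is empty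
  too, and W is a c-clique.\<close>

lemma octagon_bound:
  assumes tc: "two_colored c d V" and j: "joined c A V" "joined d B V" and B: "card B \<le> 3"
    and g: "periodic_cycle (ad c) 8 g" "range g \<subseteq> V"
    and fin: "finite A" "finite B" and n: "card V + card A + card B \<ge> 17"
  shows False
proof -
  have ge: "ad c (g i) (g (Suc i))" and gm: "g i = g j \<longleftrightarrow> i mod 8 = j mod 8" for i j
    using g(1) unfolding periodic_cycle_def by blast+
  have "A = {}"
  proof (rule ccontr)
    assume "A \<noteq> {}"
    then obtain s where s: "s \<in> A" by blast
    have step: "ad c (g i) (g k)" if "k = Suc i" for i k using ge[of i] that by simp
    have e: "ad c (g 0) (g 1)" "ad c (g 1) (g 2)" "ad c (g 2) (g 3)" "ad c (g 3) (g 4)"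
      "ad c (g 4) (g 5)" "ad c (g 5) (g 6)" "ad c (g 6) (g 7)" by (rule step; simp)+
    have s: "ad c s (g i)" "ad c (g i) s" for i
      using joinedD[OF j(1) s, of "g i"] g(2) ad_sym by blast+
    have "s \<noteq> g i" for i using ad_neq[OF s(1)] .
    then have "distinct [g 0, g 1, g 2, g 3, g 4, g 5, g 6, g 7, s]" by (auto simp: gm)
    then show False
      using C9[of c "g 0" "g 1" "g 2" "g 3" "g 4" "g 5" "g 6" "g 7" s] e s by blast
  qed
  have BV: "B \<inter> V = {}" using joined_neq[OF j(2)] by blast
  have "card V > 0" using n B \<open>A = {}\<close> by simp
  then have finV: "finite V" by (rule card_ge_0_finite)
  define W where "W = (V - range g) \<union> B"
  have "card W = card (V - range g) + card B"
    unfolding W_def by (rule card_Un_disjoint) (use fin BV finV in auto)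
  moreover have "card (V - range g) \<ge> card V - 8"
    using card_range_cycle[OF g(1)] card_Diff_ge[of "range g" V] by simp
  ultimately have cW: "card W \<ge> 9" using n \<open>A = {}\<close> by simp
  have o: "octagon c d g W"
    unfolding octagon_def
  proof (intro conjI ballI allI)
    show "W \<inter> range g = {}" unfolding W_def using BV g(2) by blast
    fix w i assume w: "w \<in> W"
    show "ad c w (g i) \<or> ad d w (g i)"
    proof (cases "w \<in> B")
      case True
      then show ?thesis using joinedD[OF j(2)] g(2) by blast
    next
      case False
      then have "w \<in> V" "w \<noteq> g i" "g i \<in> V" using w g(2) unfolding W_def by auto
      then show ?thesis using tc unfolding two_colored_def by blast
    qed
  qed (rule g(1))
  have no: "\<not> ad d x y" if xy: "x \<in> W" "y \<in> W" for x y
  proof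
    assume d: "ad d x y"
    show False
    proof (rule octagon_complement[OF o cW, of B, OF _ _ _ _ _ xy d])
      show "B \<subseteq> W" "card B < 5" unfolding W_def using B by auto
    next
      fix x y assume x: "x \<in> W" "y \<in> W" "x \<noteq> y" "x \<notin> B \<or> y \<notin> B"
      consider "x \<in> B" "y \<in> V" | "x \<in> V" "y \<in> B" | "x \<in> V" "y \<in> V"
        using x unfolding W_def by blast
      then show "ad c x y \<or> ad d x y"
      proof cases
        case 1 then show ?thesis using joinedD[OF j(2)] by blast
      next
        case 2 then show ?thesis using joinedD[OF j(2)] ad_sym by blast
      next
        case 3 then show ?thesis using tc x(3) unfolding two_colored_def by blast
      qed
    next
      fix s x assume "s \<in> B" "x \<in> W - B"
      then show "ad d s x" using joinedD[OF j(2)] unfolding W_def by blast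
    next
      fix s i assume "s \<in> B"
      then show "ad d s (g i)" using joinedD[OF j(2)] g(2) by blast
    qed
  qed
  have "B = {}"
  proof (rule ccontr)
    assume "B \<noteq> {}"
    then obtain s where s: "s \<in> B" by blast
    have "\<not> W \<subseteq> B" using card_mono[OF fin(2), of W] cW B by linarith
    then obtain v where "v \<in> V" "v \<in> W" unfolding W_def by blast
    then show False using joinedD[OF j(2) s] no[of s v] s unfolding W_def by blast
  qed
  show False
  proof (rule no_clique[OF cW, of c])
    fix x y assume "x \<in> W" "y \<in> W" "x \<noteq> y"
    then show "ad c x y"
      using two_coloredD[OF tc] no \<open>B = {}\<close> unfolding W_def by blast
  qed
qed

lemma mono7_or_8:
  assumes tc: "two_colored c d V" and V: "card V \<ge> 13"
  shows "mono_cycle c d V 7 \<or> mono_cycle c d V 8"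
proof -
  have tc': "two_colored d c V" using tc two_colored_sym by blast
  have V': "card V \<ge> 6" "card V \<ge> 7" using V by linarith+
  have "mono_cycle c d V 4"
    using mono_cases[OF mono3[OF tc V'(1)]] mono4_of_triangle[OF tc V'(2)]
      mono4_of_triangle[OF tc' V'(2)] mono_sym by metis
  then have "mono_cycle c d V 5"
    using mono_cases[of c d V 4] mono5_of_square[OF tc V] mono5_of_square[OF tc' V] mono_sym by metis
  then have "mono_cycle c d V 6"
    using mono_cases[of c d V 5] mono6_of_pentagon[OF tc V] mono6_of_pentagon[OF tc' V] mono_sym
    by metis
  then show ?thesis
    using mono_cases[of c d V 6] mono7_or_8_of_hexagon[OF tc V] mono7_or_8_of_hexagon[OF tc' V]
      mono_sym by metis
qed

text \<open>With A and B cut down to 2, there are 13 vertices, enough for a 7-cycle but one short of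
  the step to 8. A 7-cycle in c leaves at most one vertex in A (in d: in B), which supplies the
  fourteenth vertex.\<close>

theorem two_colored_bound:
  assumes tc: "two_colored c d V" and fin: "finite A" "finite B"
    and j: "joined c A V" "joined d B V" and A: "card A \<le> 3" and B: "card B \<le> 3"
  shows "card V + card A + card B \<le> 16"
proof (rule ccontr)
  assume "\<not> ?thesis"
  then have n: "card V + card A + card B \<ge> 17" "card V + card B + card A \<ge> 17" by linarith+
  have tc': "two_colored d c V" using tc two_colored_sym by blast
  have AB: "card A \<le> 2" "card B \<le> 2"
    using universal_triple_bound[OF tc j B n(1) A] universal_triple_bound[OF tc' j(2,1) A n(2) B]
    by blast+
  have no8: "\<not> mono_cycle c d V 8"
    using mono_cases[of c d V 8] octagon_bound[OF tc j B _ _ fin n(1)]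
      octagon_bound[OF tc' j(2,1) A _ _ fin(2,1) n(2)] by metis
  have "card V \<ge> 13" using n AB by linarith
  then have "mono_cycle c d V 7" using mono7_or_8[OF tc] no8 by blast
  then have "card A \<le> 1 \<or> card B \<le> 1"
    using mono_cases[of c d V 7] heptagon_universal[OF _ _ j(1)] heptagon_universal[OF _ _ j(2)] by metis
  then have "card V \<ge> 14" using n AB by linarith
  then have "mono_cycle c d V 8"
    using \<open>mono_cycle c d V 7\<close> mono_cases[of c d V 7] mono8_of_heptagon[OF tc] mono8_of_heptagon[OF tc']
      mono_sym by metis
  then show False using no8 by blast
qed

end

section \<open>Parts with at most 4 vertices\<close>

context c9_free
begin

text \<open>In the doubled pentagon the cycle runs through t1, t2 and their copies, then t3, t4 and
  their copies, and closes with t5.\<close>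

lemma twin_pentagon:
  assumes T: "distinct [t1, t2, t3, t4, t5]" "{t1, t2, t3, t4, t5} \<subseteq> T"
    and tw: "\<And>t u. t \<in> T \<Longrightarrow> u \<in> T \<Longrightarrow> ad c t u \<Longrightarrow> ad c (\<tau> t) u \<and> ad c t (\<tau> u) \<and> ad c (\<tau> t) (\<tau> u)"
    and inj: "inj_on \<tau> T" and out: "\<And>t. t \<in> T \<Longrightarrow> \<tau> t \<notin> T"
    and e: "ad c t1 t2" "ad c t2 t3" "ad c t3 t4" "ad c t4 t5" "ad c t5 t1"
  shows False
proof -
  have t: "t1 \<in> T" "t2 \<in> T" "t3 \<in> T" "t4 \<in> T" "t5 \<in> T" using T(2) by auto
  have n: "\<tau> a \<noteq> b" "b \<noteq> \<tau> a" if "a \<in> T" "b \<in> T" for a b using out that by blast+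
  have m: "\<tau> a \<noteq> \<tau> b" if "a \<in> T" "b \<in> T" "a \<noteq> b" for a b using inj that by (simp add: inj_on_eq_iff)
  have "distinct [t1, t2, \<tau> t1, \<tau> t2, t3, t4, \<tau> t3, \<tau> t4, t5]"
    using T(1) n t m by simp
  then show False
    using C9[of c t1 t2 "\<tau> t1" "\<tau> t2" t3 t4 "\<tau> t3" "\<tau> t4" t5] e ad_sym
      tw[OF t(1,2) e(1)] tw[OF t(2,3) e(2)] tw[OF t(3,4) e(3)] tw[OF t(4,5) e(4)] by blast
qed

text \<open>The cycle goes out along x, s, u, returns by the copies of s and x, and comes back to x
  through y, z and their copies.\<close>

lemma twin_triangle_with_tail:
  assumes T: "distinct [x, y, z, s, u]" "{x, y, z, s, u} \<subseteq> T"
    and tw: "\<And>t u. t \<in> T \<Longrightarrow> u \<in> T \<Longrightarrow> ad c t u \<Longrightarrow> ad c (\<tau> t) u \<and> ad c t (\<tau> u) \<and> ad c (\<tau> t) (\<tau> u)"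
    and inj: "inj_on \<tau> T" and out: "\<And>t. t \<in> T \<Longrightarrow> \<tau> t \<notin> T"
    and e: "ad c x y" "ad c y z" "ad c x z" "ad c x s" "ad c s u"
  shows False
proof -
  have t: "x \<in> T" "y \<in> T" "z \<in> T" "s \<in> T" "u \<in> T" using T(2) by auto
  have n: "\<tau> a \<noteq> b" "b \<noteq> \<tau> a" if "a \<in> T" "b \<in> T" for a b using out that by blast+
  have m: "\<tau> a \<noteq> \<tau> b" if "a \<in> T" "b \<in> T" "a \<noteq> b" for a b using inj that by (simp add: inj_on_eq_iff)
  have "distinct [x, s, u, \<tau> s, \<tau> x, y, z, \<tau> y, \<tau> z]"
    using T(1) n t m by auto
  then show False
    using C9[of c x s u "\<tau> s" "\<tau> x" y z "\<tau> y" "\<tau> z"] e ad_sym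
      tw[OF t(1,2) e(1)] tw[OF t(2,3) e(2)] tw[OF t(1,3) e(3)] tw[OF t(1,4) e(4)] tw[OF t(4,5) e(5)]
    by blast
qed

text \<open>By the two preceding lemmas, T has no monochromatic pentagon and no c-triangle with a
  c-path of length 2 attached. Vertices with a c-edge to the triangle therefore see all of D in d,
  and the others see the triangle in d. However the six vertices of D are distributed, a
  monochromatic pentagon arises.\<close>

lemma twins_with_triangle:
  assumes tc: "two_colored c d T" and cT: "card T \<ge> 9"
    and tw: "\<And>i t u. t \<in> T \<Longrightarrow> u \<in> T \<Longrightarrow> ad i t u \<Longrightarrow> ad i (\<tau> t) u \<and> ad i t (\<tau> u) \<and> ad i (\<tau> t) (\<tau> u)"
    and inj: "inj_on \<tau> T" and out: "\<And>t. t \<in> T \<Longrightarrow> \<tau> t \<notin> T"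
    and xyz: "{x, y, z} \<subseteq> T" "ad c x y" "ad c y z" "ad c x z"
  shows False
proof -
  have finT: "finite T" using cT by (metis card.infinite not_numeral_le_zero)
  have xyz': "x \<in> T" "y \<in> T" "z \<in> T" "distinct [x, y, z]" "ad c y x" "ad c z y" "ad c z x"
    using xyz ad_neq ad_sym by auto
  define D where "D = T - {x, y, z}"
  have D: "t \<in> T" "t \<notin> {x, y, z}" if "t \<in> D" for t using that unfolding D_def by auto
  have cD: "card D \<ge> 6"
    unfolding D_def using card_Diff_ge[of "{x, y, z}" T] cT card_length[of "[x, y, z]"] by simp
  have finD: "finite D" unfolding D_def using finT by simp
  define D1 where "D1 = {t \<in> D. ad c x t \<or> ad c y t \<or> ad c z t}"
  define D0 where "D0 = D - D1"
  have pent: False if "distinct [t1, t2, t3, t4, t5]" "{t1, t2, t3, t4, t5} \<subseteq> T"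
    "ad i t1 t2" "ad i t2 t3" "ad i t3 t4" "ad i t4 t5" "ad i t5 t1" for i t1 t2 t3 t4 t5
    by (rule twin_pentagon[OF that(1,2) tw inj out that(3-7)])
  have d1: "ad d s u" if s: "s \<in> D1" "u \<in> D" "s \<noteq> u" for s u
  proof (rule two_coloredD[OF tc])
    have sD: "s \<in> D" using s(1) unfolding D1_def by blast
    show "s \<in> T" "u \<in> T" "s \<noteq> u" using D sD s by auto
    have ne: "distinct [x, y, z, s, u]" "{x, y, z, s, u} \<subseteq> T"
      using D[OF sD] D[OF s(2)] s(3) xyz'(1-4) by auto
    show "\<not> ad c s u"
    proof
      assume su: "ad c s u"
      have "ad c x s \<or> ad c y s \<or> ad c z s" using s(1) unfolding D1_def by blast
      then show False
      proof (elim disjE)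
        assume xs: "ad c x s"
        show False
          by (rule twin_triangle_with_tail[OF ne tw inj out xyz(2-4) xs su])
      next
        assume ys: "ad c y s"
        show False
          by (rule twin_triangle_with_tail[OF _ _ tw inj out xyz'(5) xyz(4,3) ys su])
            (use ne in auto)
      next
        assume zs: "ad c z s"
        show False
          by (rule twin_triangle_with_tail[OF _ _ tw inj out xyz'(6,5,7) zs su])
            (use ne in auto)
      qed
    qed
  qed
  have d0: "ad d t v" "ad d v t" if t: "t \<in> D0" and v: "v \<in> {x, y, z}" for t v
  proof -
    have "t \<in> D" "\<not> ad c v t" using t v unfolding D0_def D1_def by auto
    then show "ad d v t" using two_coloredD[OF tc, of v t] D[of t] v xyz' by blast
    then show "ad d t v" by (rule ad_sym)
  qed
  have sub: "D1 \<subseteq> D" "D0 \<subseteq> D" "D1 \<inter> D0 = {}" unfolding D1_def D0_def by auto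
  have "card D - card D1 \<le> card D0"
    unfolding D0_def by (rule card_Diff_ge) (use sub finD finite_subset in blast)
  then have c01: "card D1 + card D0 \<ge> 6" using cD by linarith
  consider "card D1 \<ge> 3" | "card D1 \<ge> 2" "card D0 \<ge> 2" | "card D0 \<ge> 5" using c01 by linarith
  then show False
  proof cases
    case 1
    then obtain a b e where abe: "distinct [a, b, e]" "{a, b, e} \<subseteq> D1" by (rule three_of_card)
    have "card (D - {a, b, e}) \<ge> 2"
      using card_Diff_ge[of "{a, b, e}" D] cD card_length[of "[a, b, e]"] by simp
    then obtain f h where fh: "f \<in> D - {a, b, e}" "h \<in> D - {a, b, e}" "f \<noteq> h" by (rule two_of_card)
    have "a \<in> D1" "b \<in> D1" "e \<in> D1" using abe(2) by auto
    then have "ad d a b" "ad d b f" "ad d f e" "ad d e h" "ad d h a"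
      using d1[of a b] d1[of b f] ad_sym[OF d1[of e f]] d1[of e h] ad_sym[OF d1[of a h]] abe(1) fh sub(1)
      by auto
    then show False
      by (rule pent[rotated 2]) (use abe fh sub D in auto)
  next
    case 2
    obtain a b where ab: "a \<in> D1" "b \<in> D1" "a \<noteq> b" using two_of_card[OF 2(1)] by metis
    obtain f h where fh: "f \<in> D0" "h \<in> D0" "f \<noteq> h" using two_of_card[OF 2(2)] by metis
    have ne: "a \<noteq> f" "a \<noteq> h" "b \<noteq> f" "b \<noteq> h" using ab fh sub(3) by blast+
    have DD: "a \<in> D" "b \<in> D" "f \<in> D" "h \<in> D" using ab fh sub by auto
    have "ad d a b" "ad d b f" "ad d f x" "ad d x h" "ad d h a"
      using d1[of a b] d1[of b f] d0[OF fh(1)] d0[OF fh(2)] ad_sym[OF d1[of a h]] ab ne DD by auto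
    then show False
      by (rule pent[rotated 2]) (use ab(3) fh(3) ne D[OF DD(1)] D[OF DD(2)] D[OF DD(3)] D[OF DD(4)] xyz' in auto)
  next
    case 3
    have D0T: "t \<in> T" "t \<notin> {x, y, z}" if "t \<in> D0" for t using D sub that by blast+
    have "ad c f h" if fh: "f \<in> D0" "h \<in> D0" "f \<noteq> h" for f h
    proof (rule ccontr)
      assume "\<not> ad c f h"
      then have fd: "ad d f h" using two_coloredD[OF tc, of f h] D0T fh by blast
      have "card (D0 - {f, h}) \<ge> 1" using card_Diff_two[of D0 f h] 3 by linarith
      then obtain l where l: "l \<in> D0 - {f, h}" using ex_of_card by blast
      have "ad d f h" "ad d h x" "ad d x l" "ad d l y" "ad d y f"
        using fd d0 fh l by auto
      then show False
        by (rule pent[rotated 2])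
          (use fh l D0T[of f] D0T[of h] D0T[of l] xyz' in auto)
    qed
    moreover obtain t1 t2 t3 t4 t5 where t: "distinct [t1, t2, t3, t4, t5]" "{t1, t2, t3, t4, t5} \<subseteq> D0"
      using distinct_list_of_card[OF 3] by (auto simp: length_Suc_conv numeral_eq_Suc)
    ultimately have "ad c t1 t2" "ad c t2 t3" "ad c t3 t4" "ad c t4 t5" "ad c t5 t1" by auto
    then show False
      by (rule pent[rotated 2]) (use t D0T in auto)
  qed
qed

lemma no_twins:
  assumes tc: "two_colored c d T" and cT: "card T \<ge> 9"
    and tw: "\<And>i t u. t \<in> T \<Longrightarrow> u \<in> T \<Longrightarrow> ad i t u \<Longrightarrow> ad i (\<tau> t) u \<and> ad i t (\<tau> u) \<and> ad i (\<tau> t) (\<tau> u)"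
    and inj: "inj_on \<tau> T" and out: "\<And>t. t \<in> T \<Longrightarrow> \<tau> t \<notin> T"
  shows False
proof -
  have tc': "two_colored d c T" using tc two_colored_sym by blast
  have "mono_cycle c d T 3" by (rule mono3[OF tc]) (use cT in simp)
  then obtain i xs where i: "i = c \<or> i = d" and xs: "cyc (ad i) xs" "length xs = 3" "set xs \<subseteq> T"
    unfolding mono_cycle_def by blast
  obtain x y z where "xs = [x, y, z]" using xs(2) by (auto simp: length_Suc_conv numeral_3_eq_3)
  then have t: "{x, y, z} \<subseteq> T" "ad i x y" "ad i y z" "ad i x z"
    using xs(1,3) ad_sym unfolding cyc_def by auto
  show False
    using i
  proof
    assume "i = c"
    then show False using twins_with_triangle[OF tc cT tw inj out] t by blast
  next
    assume "i = d"
    then show False using twins_with_triangle[OF tc' cT tw inj out] t by blast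
  qed
qed

text \<open>\<open>three_universal_vertices\<close> leaves nine vertices without c-edges, on which d
  is complete multipartite with parts of at most 4 vertices.\<close>

lemma parts_universal_triple:
  fixes p :: "'a \<Rightarrow> 'a"
  assumes cross: "\<And>x y. x \<in> V \<Longrightarrow> y \<in> V \<Longrightarrow> p x \<noteq> p y \<Longrightarrow> ad c x y \<or> ad d x y"
    and parts: "\<And>x. x \<in> V \<Longrightarrow> card {y \<in> V. p y = p x} \<le> 4" and finV: "finite V"
    and j: "joined c A R" "card A \<ge> 3" "R \<subseteq> V" "card R \<ge> 12"
  shows False
proof -
  have R6: "card R \<ge> 6" using j(4) by simp
  obtain R' where R: "R' \<subseteq> R" "card R' \<ge> card R - 3"
    "\<And>x y. x \<in> R' \<Longrightarrow> y \<in> R' \<Longrightarrow> \<not> ad c x y"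
    by (rule three_universal_vertices[OF j(1,2) R6]) blast
  show False
  proof (rule no_multipartite[of R' p d])
    show "card R' \<ge> 9" using R(2) j(4) by linarith
    show "ad d x y" if "x \<in> R'" "y \<in> R'" "p x \<noteq> p y" for x y
      using cross[of x y] R(1,3) j(3) that by blast
    show "card {y \<in> R'. p y = p x} \<le> 4" if "x \<in> R'" for x
    proof -
      have "card {y \<in> R'. p y = p x} \<le> card {y \<in> V. p y = p x}"
        using finV R(1) j(3) by (intro card_mono) auto
      then show ?thesis using parts[of x] R(1) j(3) that by fastforce
    qed
  qed
qed

text \<open>For A a part of the partition: four vertices in A remove c from R altogether, while
  three remove it only up to three vertices and need 12 in R.\<close>

lemma parts_large_neighbourhood:
  fixes p :: "'a \<Rightarrow> 'a"
  assumes cross: "\<And>x y. x \<in> V \<Longrightarrow> y \<in> V \<Longrightarrow> p x \<noteq> p y \<Longrightarrow> ad c x y \<or> ad d x y"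
    and parts: "\<And>x. x \<in> V \<Longrightarrow> card {y \<in> V. p y = p x} \<le> 4" and finV: "finite V"
    and j: "joined c A R" "card A \<ge> 3" "R \<subseteq> V" "card R + card A \<ge> 15" "card A \<le> 4"
  shows False
proof (cases "card A = 4")
  case True
  then have A: "card A \<ge> 4" and R9: "card R \<ge> 9" using j(4) by linarith+
  then have R5: "card R \<ge> 5" by simp
  have no: "\<not> ad c x y" if "x \<in> R" "y \<in> R" for x y
    by (rule joined_no_edge[OF joined_sym[OF j(1)] R5 A that])
  show False
  proof (rule no_multipartite[OF R9, of p d])
    show "ad d x y" if "x \<in> R" "y \<in> R" "p x \<noteq> p y" for x y
      using cross[of x y] no j(3) that by blast
    show "card {y \<in> R. p y = p x} \<le> 4" if "x \<in> R" for x
    proof -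
      have "card {y \<in> R. p y = p x} \<le> card {y \<in> V. p y = p x}"
        using finV j(3) by (intro card_mono) auto
      then show ?thesis using parts[of x] j(3) that by fastforce
    qed
  qed
next
  case False
  then have "card R \<ge> 12" using j(4,5) by linarith
  then show False using parts_universal_triple[OF cross parts finV j(1-3)] by blast
qed

text \<open>A part of 3 or 4 vertices would have too large a neighborhood in one color, so parts
  have at most 2 vertices. Representatives are two-colored, so there are at most 16 parts; 26
  vertices then contain at least ten twin pairs, and \<open>no_twins\<close> excludes nine.\<close>

lemma small_parts:
  fixes p :: "'a \<Rightarrow> 'a"
  assumes cross: "\<And>x y. x \<in> V \<Longrightarrow> y \<in> V \<Longrightarrow> p x \<noteq> p y \<Longrightarrow> ad c x y \<or> ad d x y"
    and hom: "\<And>x x' y i. x \<in> V \<Longrightarrow> x' \<in> V \<Longrightarrow> y \<in> V \<Longrightarrow> p x = p x' \<Longrightarrow> p x \<noteq> p y \<Longrightarrow> ad i x y \<Longrightarrow> ad i x' y"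
    and parts: "\<And>x. x \<in> V \<Longrightarrow> card {y \<in> V. p y = p x} \<le> 4"
    and V: "card V \<ge> 26"
  shows False
proof -
  have finV: "finite V" using V by (metis card.infinite not_numeral_le_zero)
  have small: "card {y \<in> V. p y = p x} \<le> 2" if x: "x \<in> V" for x
  proof (rule ccontr)
    let ?A = "{y \<in> V. p y = p x}"
    define R where "R = {y \<in> V. p y \<noteq> p x \<and> ad c x y}"
    define B where "B = {y \<in> V. p y \<noteq> p x \<and> ad d x y}"
    assume "\<not> card ?A \<le> 2"
    then have A: "card ?A \<ge> 3" "card ?A \<le> 4" using parts[OF x] by linarith+
    have "joined i ?A {y \<in> V. p y \<noteq> p x \<and> ad i x y}" for i
      unfolding joined_def
    proof (intro ballI)
      fix a y assume "a \<in> ?A" "y \<in> {y \<in> V. p y \<noteq> p x \<and> ad i x y}"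
      then show "ad i a y" by (intro hom[OF x, of a y]) auto
    qed
    then have j: "joined c ?A R" "joined d ?A B" unfolding R_def B_def by blast+
    have RB: "R \<subseteq> V" "B \<subseteq> V" unfolding R_def B_def by auto
    have "V \<subseteq> ?A \<union> (R \<union> B)" unfolding R_def B_def using cross x by force
    then have "card V \<le> card (?A \<union> (R \<union> B))"
      using finV RB finite_subset by (intro card_mono) auto
    also have "\<dots> \<le> card ?A + (card R + card B)"
      by (meson add_left_mono card_Un_le le_trans)
    \<comment> \<open>If both sums were at most 14, V would have at most 28 - 3 = 25
      vertices.\<close>
    finally have "card R + card ?A \<ge> 15 \<or> card B + card ?A \<ge> 15" using V A by linarith
    then show False
    proof
      assume "card R + card ?A \<ge> 15"
      then show False using parts_large_neighbourhood[OF cross parts finV j(1) A(1) RB(1) _ A(2)] by blast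
    next
      assume "card B + card ?A \<ge> 15"
      moreover have cross': "ad d x y \<or> ad c x y" if "x \<in> V" "y \<in> V" "p x \<noteq> p y" for x y
        using cross[OF that] by blast
      ultimately show False
        using parts_large_neighbourhood[OF cross' parts finV j(2) A(1) RB(2) _ A(2)] by blast
    qed
  qed
  have hom2: "ad i x' y'"
    if v: "x \<in> V" "x' \<in> V" "y \<in> V" "y' \<in> V" "p x = p x'" "p y = p y'" "p x \<noteq> p y" and e: "ad i x y"
    for x x' y y' i
  proof -
    have "ad i x' y" using hom[OF v(1-3,5,7) e] .
    then have "ad i y x'" by (rule ad_sym)
    then have "ad i y' x'" using hom[OF v(3,4,2,6)] v by metis
    then show ?thesis by (rule ad_sym)
  qed
  define \<rho> where "\<rho> q = (SOME x. x \<in> V \<and> p x = q)" for q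
  have \<rho>: "\<rho> q \<in> V" "p (\<rho> q) = q" if "q \<in> p ` V" for q
    using someI_ex[of "\<lambda>x. x \<in> V \<and> p x = q"] that unfolding \<rho>_def by blast+
  have "inj_on \<rho> (p ` V)" by (rule inj_onI) (metis \<rho>(2))
  then have "card (\<rho> ` p ` V) = card (p ` V)" by (rule card_image)
  moreover have "two_colored c d (\<rho> ` p ` V)"
    unfolding two_colored_def using cross \<rho> by (metis imageE)
  then have "card (\<rho> ` p ` V) \<le> 16"
    using two_colored_bound[of c d "\<rho> ` p ` V" "{}" "{}"] by (simp add: joined_def)
  ultimately have q16: "card (p ` V) \<le> 16" by simp
  define D where "D = {q \<in> p ` V. card {y \<in> V. p y = q} = 2}"
  have DpV: "D \<subseteq> p ` V" and finp: "finite (p ` V)" unfolding D_def using finV by auto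
  have finD: "finite D" using DpV finp finite_subset by blast
  have one: "card {y \<in> V. p y = q} \<le> 1" if "q \<in> p ` V - D" for q
  proof -
    have "card {y \<in> V. p y = q} \<le> 2" "card {y \<in> V. p y = q} \<noteq> 2"
      using that small unfolding D_def by auto
    then show ?thesis by linarith
  qed
  have "card V = card (\<Union>q\<in>p ` V. {y \<in> V. p y = q})" by (rule arg_cong[of _ _ card]) auto
  also have "\<dots> \<le> (\<Sum>q\<in>p ` V. card {y \<in> V. p y = q})" by (rule card_UN_le[OF finp])
  also have "\<dots> = (\<Sum>q\<in>p ` V - D. card {y \<in> V. p y = q}) + (\<Sum>q\<in>D. card {y \<in> V. p y = q})"
    by (rule sum.subset_diff[OF DpV finp])
  also have "\<dots> \<le> card (p ` V - D) * 1 + card D * 2"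
  proof (rule add_mono)
    show "(\<Sum>q\<in>p ` V - D. card {y \<in> V. p y = q}) \<le> card (p ` V - D) * 1"
      using sum_bounded_above[of "p ` V - D" "\<lambda>q. card {y \<in> V. p y = q}" 1] one by simp
    have "card {y \<in> V. p y = q} \<le> 2" if "q \<in> D" for q using that unfolding D_def by simp
    then show "(\<Sum>q\<in>D. card {y \<in> V. p y = q}) \<le> card D * 2"
      using sum_bounded_above[of D "\<lambda>q. card {y \<in> V. p y = q}" 2] by simp
  qed
  finally have "card V \<le> card (p ` V - D) + card D * 2" by simp
  moreover have "card (p ` V - D) = card (p ` V) - card D" by (rule card_Diff_subset[OF finD DpV])
  moreover have "card D \<le> card (p ` V)" by (rule card_mono[OF finp DpV])
  ultimately have cD: "card D \<ge> 9" using V q16 by linarith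
  have "\<exists>x y. x \<in> V \<and> y \<in> V \<and> x \<noteq> y \<and> p x = q \<and> p y = q" if "q \<in> D" for q
  proof -
    have "card {y \<in> V. p y = q} \<ge> 2" using that unfolding D_def by simp
    then obtain x y where "x \<in> {y \<in> V. p y = q}" "y \<in> {y \<in> V. p y = q}" "x \<noteq> y" by (rule two_of_card)
    then show ?thesis by blast
  qed
  then obtain \<alpha> \<beta> where ab: "\<And>q. q \<in> D \<Longrightarrow> \<alpha> q \<in> V \<and> \<beta> q \<in> V \<and> \<beta> q \<noteq> \<alpha> q \<and> p (\<alpha> q) = q \<and> p (\<beta> q) = q"
    by metis
  define T where "T = \<alpha> ` D"
  define \<tau> where "\<tau> x = \<beta> (p x)" for x
  have T: "x \<in> V" "\<tau> x \<in> V" "\<tau> x \<noteq> x" "p (\<tau> x) = p x" "\<alpha> (p x) = x" if xT: "x \<in> T" for x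
  proof -
    obtain q where "q \<in> D" "x = \<alpha> q" using xT unfolding T_def by blast
    then show "x \<in> V" "\<tau> x \<in> V" "\<tau> x \<noteq> x" "p (\<tau> x) = p x" "\<alpha> (p x) = x"
      using ab[of q] unfolding \<tau>_def by simp_all
  qed
  have T_inj: "p x \<noteq> p y" if "x \<in> T" "y \<in> T" "x \<noteq> y" for x y
    using T(5)[OF that(1)] T(5)[OF that(2)] that(3) by metis
  have "inj_on \<alpha> D" by (rule inj_onI) (metis ab)
  then have cT: "card T \<ge> 9" unfolding T_def using cD by (simp add: card_image)
  show False
  proof (rule no_twins[of c d T \<tau>])
    show "two_colored c d T" unfolding two_colored_def using cross T(1) T_inj by blast
    show "card T \<ge> 9" by fact
    fix i t u assume tu: "t \<in> T" "u \<in> T" "ad i t u"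
    have "p t \<noteq> p u" using T_inj[OF tu(1,2)] ad_neq[OF tu(3)] by blast
    then show "ad i (\<tau> t) u \<and> ad i t (\<tau> u) \<and> ad i (\<tau> t) (\<tau> u)"
      using hom2 T(1,2,4) tu by metis
  next
    show "inj_on \<tau> T" by (rule inj_onI) (metis T(4) T_inj)
    show "\<tau> t \<notin> T" if "t \<in> T" for t using T_inj[of "\<tau> t" t] T(3,4)[OF that] that by blast
  qed
qed

end

section \<open>A part with at least 5 vertices\<close>

context c9_free
begin

definition colored_by :: "'c set \<Rightarrow> 'a set \<Rightarrow> bool" where
  "colored_by K V \<longleftrightarrow> (\<forall>x\<in>V. \<forall>y\<in>V. x \<noteq> y \<longrightarrow> (\<exists>i\<in>K. ad i x y))"

lemma colored_by_subset: "colored_by K V \<Longrightarrow> W \<subseteq> V \<Longrightarrow> colored_by K W"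
  unfolding colored_by_def by blast

lemma colored_by_remove:
  "colored_by K V \<Longrightarrow> (\<And>x y. x \<in> V \<Longrightarrow> y \<in> V \<Longrightarrow> \<not> ad i x y) \<Longrightarrow> colored_by (K - {i}) V"
  unfolding colored_by_def by blast

text \<open>S is quantified inside, so that the bound for a smaller vertex set can be used with
  enlarged universal sets.\<close>

definition bounded :: "'c set \<Rightarrow> 'a set \<Rightarrow> bool" where
  "bounded K V \<longleftrightarrow> (\<forall>S. (\<forall>i\<in>K. joined i (S i) V \<and> finite (S i) \<and> card (S i) \<le> 6) \<longrightarrow>
     card V + (\<Sum>i\<in>K. card (S i)) \<le> 4 * 2 ^ card K)"

lemma boundedD: "bounded K V \<Longrightarrow> card V \<le> 4 * 2 ^ card K"
  unfolding bounded_def by (drule spec[of _ "\<lambda>_. {}"]) (simp add: joined_def)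

text \<open>A as one part and the vertices of V as singleton parts form a complete multipartite
  graph.\<close>

lemma one_color_bound:
  assumes col: "colored_by {i} V" and j: "joined i A V" and A: "finite A" "card A \<le> 4"
  shows "card V + card A \<le> 8"
proof (rule ccontr)
  assume n: "\<not> ?thesis"
  have AV: "A \<inter> V = {}" using joined_neq[OF j] by blast
  have "card V > 0" using n A by linarith
  then have finV: "finite V" by (rule card_ge_0_finite)
  have "card (A \<union> V) = card A + card V" by (rule card_Un_disjoint[OF A(1) finV AV])
  then have c9: "card (A \<union> V) \<ge> 9" using n by linarith
  define p where "p x = (if x \<in> A then None else Some x)" for x
  show False
  proof (rule no_multipartite[OF c9, of p i])
    fix x y assume "x \<in> A \<union> V" "y \<in> A \<union> V" "p x \<noteq> p y"
    then show "ad i x y"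
      using joinedD[OF j] ad_sym col unfolding p_def colored_by_def
      by (auto split: if_splits)
  next
    fix x assume x: "x \<in> A \<union> V"
    show "card {y \<in> A \<union> V. p y = p x} \<le> 4"
    proof (cases "x \<in> A")
      case True
      then have "{y \<in> A \<union> V. p y = p x} = A" unfolding p_def by auto
      then show ?thesis using A(2) by (simp only:)
    next
      case False
      then have "{y \<in> A \<union> V. p y = p x} = {x}" using x unfolding p_def by auto
      then show ?thesis by simp
    qed
  qed
qed

text \<open>The vertex \<open>p\<close> is counted as a new universal vertex of \<open>B\<close>: this saves the unit
  that makes the final estimate sharp.\<close>

lemma attached_parts_universal:
  assumes K: "finite K" "r \<in> K" "b \<in> K" "r \<noteq> b" and col: "colored_by K (W \<union> R \<union> B)"
    and dis: "W \<inter> R = {}" "W \<inter> B = {}" "R \<inter> B = {}"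
    and cross: "\<And>u v. u \<in> R \<Longrightarrow> v \<in> B \<Longrightarrow> ad r u v \<or> ad b u v"
    and j: "joined r W R" "joined b W B" and c: "card W \<ge> 5" "card R \<ge> 5" "card B \<ge> 5"
    and noR: "\<And>x y. x \<in> R \<Longrightarrow> y \<in> R \<Longrightarrow> \<not> ad r x y" and noB: "\<And>x y. x \<in> B \<Longrightarrow> y \<in> B \<Longrightarrow> \<not> ad b x y"
    and bnd: "\<And>U K'. U \<subseteq> R \<or> U \<subseteq> B \<Longrightarrow> K' \<subset> K \<Longrightarrow> colored_by K' U \<Longrightarrow> card U \<ge> 5 \<Longrightarrow> bounded K' U"
    and p: "p \<in> R" "\<And>v. v \<in> B \<Longrightarrow> ad r p v" and q: "q1 \<in> B" "q2 \<in> B" "ad r q1 q2"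
  shows "card B + 1 \<le> 4 * 2 ^ (card K - 1)" and "card R \<le> 4 * 2 ^ (card K - 2) + 1"
proof -
  let ?S = "\<lambda>i. if i = r then {p} else {}"
  have "colored_by (K - {b}) B"
    using noB by (intro colored_by_remove[OF colored_by_subset[OF col]]) auto
  then have "bounded (K - {b}) B" using bnd[of B "K - {b}"] K c by auto
  then have "card B + (\<Sum>i\<in>K - {b}. card (?S i)) \<le> 4 * 2 ^ card (K - {b})"
    unfolding bounded_def using p(2) by (auto simp: joined_def)
  moreover have "(\<Sum>i\<in>K - {b}. card (?S i)) = 1"
  proof -
    have "(\<Sum>i\<in>K - {b}. card (?S i)) = (\<Sum>i\<in>K - {b}. if i = r then 1 else 0)"
      by (rule sum.cong) auto
    also have "\<dots> = 1" using K by simp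
    finally show ?thesis .
  qed
  ultimately show "card B + 1 \<le> 4 * 2 ^ (card K - 1)" using K by simp
  have W3: "card W \<ge> 3" "card R \<ge> 4" "card B \<ge> 4" using c by linarith+
  have q12: "q1 \<noteq> q2" using ad_neq[OF q(3)] .
  \<comment> \<open>The r-edge q1 q2 would have the disjoint attachments x and p in R.\<close>
  have red: "\<not> ad r v x" if x: "x \<in> R - {p}" and v: "v \<in> {q1, q2}" for x v
  proof
    assume vx: "ad r v x"
    obtain v' where v': "v' \<in> {q1, q2}" "ad r v v'" using v q ad_sym by blast
    have "ad r v' p" "p \<noteq> x" "v \<in> B" "v' \<in> B" using v' v q p ad_sym x by auto
    then show False
      using no_disjoint_attachments[OF j(1) W3(1,2) v'(2), of x p] vx x p(1) dis by blast
  qed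
  \<comment> \<open>By \<open>red\<close>, x and y are b-joined to q1 and q2, which would be
    disjoint attachments in B.\<close>
  have noblue: "\<not> ad b x y" if "x \<in> R - {p}" "y \<in> R - {p}" for x y
  proof
    assume xy: "ad b x y"
    have "ad b x q1" "ad b y q2"
      using cross[of x q1] cross[of y q2] red[of x q1] red[of y q2] that q ad_sym by blast+
    then show False
      using no_disjoint_attachments[OF j(2) W3(1,3) xy, of q1 q2] that q q12 dis by blast
  qed
  have col': "colored_by (K - {r} - {b}) (R - {p})"
    using noR noblue by (intro colored_by_remove colored_by_subset[OF col]) auto
  have cRp: "card (R - {p}) = card R - 1" using p(1) by (rule card_Diff_singleton)
  have "card (R - {p}) \<le> 4 * 2 ^ card (K - {r} - {b})"
  proof (cases "card (R - {p}) \<ge> 5")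
    case True
    then show ?thesis using col' K by (intro boundedD bnd) auto
  next
    case False
    have "(1 :: nat) \<le> 2 ^ card (K - {r} - {b})" by simp
    then show ?thesis using False by linarith
  qed
  moreover have "card (K - {r} - {b}) = card K - 2" using K by simp
  ultimately show "card R \<le> 4 * 2 ^ (card K - 2) + 1" using cRp c by simp
qed

text \<open>Distinct b-neighbors of p1 and p2 in B would be disjoint attachments, so both have the
  same single b-neighbor v1. The rest of B is r-joined to p1 and p2, and an r-edge inside it would
  have these as attachments; so the rest has lost both colors.\<close>

lemma attached_parts_nonuniversal:
  assumes K: "finite K" "r \<in> K" "b \<in> K" "r \<noteq> b" and col: "colored_by K (W \<union> R \<union> B)"
    and dis: "W \<inter> R = {}" "W \<inter> B = {}" "R \<inter> B = {}"
    and cross: "\<And>u v. u \<in> R \<Longrightarrow> v \<in> B \<Longrightarrow> ad r u v \<or> ad b u v"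
    and j: "joined r W R" "joined b W B" and c: "card W \<ge> 5" "card R \<ge> 5" "card B \<ge> 5"
    and noB: "\<And>x y. x \<in> B \<Longrightarrow> y \<in> B \<Longrightarrow> \<not> ad b x y"
    and bnd: "\<And>U K'. U \<subseteq> R \<or> U \<subseteq> B \<Longrightarrow> K' \<subset> K \<Longrightarrow> colored_by K' U \<Longrightarrow> card U \<ge> 5 \<Longrightarrow> bounded K' U"
    and p: "p1 \<in> R" "p2 \<in> R" "ad b p1 p2"
    and n: "v1 \<in> B" "\<not> ad r p1 v1" "v2 \<in> B" "\<not> ad r p2 v2"
  shows "card B \<le> 4 * 2 ^ (card K - 2) + 1"
proof -
  have W3: "card W \<ge> 3" "card R \<ge> 4" "card B \<ge> 4" using c by linarith+
  have p12: "p1 \<noteq> p2" using ad_neq[OF p(3)] .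
  have bl: "ad b p1 v1" "ad b p2 v2" using cross p n by blast+
  have same: "v = v'" if "v \<in> B" "v' \<in> B" "ad b p1 v" "ad b p2 v'" for v v'
    using no_disjoint_attachments[OF j(2) W3(1,3) p(3), of v v'] that p dis by blast
  have v12: "v1 = v2" using same[OF n(1,3) bl] .
  have red: "ad r v p1" "ad r v p2" if v: "v \<in> B - {v1}" for v
  proof -
    have "\<not> ad b p1 v" using same[of v v2] v n(3) bl(2) v12 by blast
    then show "ad r v p1" using cross[of p1 v] p v ad_sym by blast
    have "\<not> ad b p2 v" using same[of v1 v] v n(1) bl(1) by blast
    then show "ad r v p2" using cross[of p2 v] p v ad_sym by blast
  qed
  have nored: "\<not> ad r x y" if "x \<in> B - {v1}" "y \<in> B - {v1}" for x y
  proof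
    assume xy: "ad r x y"
    show False
      using no_disjoint_attachments[OF j(1) W3(1,2) xy, of p1 p2] red[OF that(1)] red[OF that(2)]
        that p p12 dis by blast
  qed
  have col': "colored_by (K - {r} - {b}) (B - {v1})"
    using noB nored by (intro colored_by_remove colored_by_subset[OF col]) auto
  have cB: "card (B - {v1}) = card B - 1" using n(1) by (rule card_Diff_singleton)
  have "card (B - {v1}) \<le> 4 * 2 ^ card (K - {r} - {b})"
  proof (cases "card (B - {v1}) \<ge> 5")
    case True
    then show ?thesis using col' K by (intro boundedD bnd) auto
  next
    case False
    have "(1 :: nat) \<le> 2 ^ card (K - {r} - {b})" by simp
    then show ?thesis using False by linarith
  qed
  moreover have "card (K - {r} - {b}) = card K - 2" using K by simp
  ultimately show ?thesis using cB c by simp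
qed

text \<open>W will have lost both colors and contribute at most 4 * P, which must add up to exactly
  16 * P. If R or B contains neither r nor b, its bound is 4 * P and the other is 8 * P. Otherwise
  there are a b-edge in R and an r-edge in B, and the two preceding lemmas distinguish whether an
  end of one of them sees the opposite side in one color only.\<close>

lemma attached_parts_bound:
  assumes K: "finite K" "r \<in> K" "b \<in> K" "r \<noteq> b" "card K \<ge> 3" and col: "colored_by K (W \<union> R \<union> B)"
    and dis: "W \<inter> R = {}" "W \<inter> B = {}" "R \<inter> B = {}"
    and cross: "\<And>u v. u \<in> R \<Longrightarrow> v \<in> B \<Longrightarrow> ad r u v \<or> ad b u v"
    and j: "joined r W R" "joined b W B" and c: "card W \<ge> 5" "card R \<ge> 4" "card B \<ge> 4"
    and bnd: "\<And>U K'. U \<subseteq> R \<or> U \<subseteq> B \<Longrightarrow> K' \<subset> K \<Longrightarrow> colored_by K' U \<Longrightarrow> card U \<ge> 5 \<Longrightarrow> bounded K' U"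
  shows "card R + card B \<le> 12 * 2 ^ (card K - 2)"
proof -
  define P :: nat where "P = 2 ^ (card K - 2)"
  have "(2 :: nat) ^ 1 \<le> 2 ^ (card K - 2)" using K(5) by (intro power_increasing) auto
  then have P2: "P \<ge> 2" unfolding P_def by simp
  have Pe: "2 ^ (card K - 1) = 2 * P"
  proof -
    have "card K - 1 = Suc (card K - 2)" using K(5) by simp
    then show ?thesis unfolding P_def by simp
  qed
  have W4: "card W \<ge> 4" using c by simp
  have noR: "\<not> ad r x y" if "card R \<ge> 5" "x \<in> R" "y \<in> R" for x y
    by (rule joined_no_edge[OF joined_sym[OF j(1)] that(1) W4 that(2,3)])
  have noB: "\<not> ad b x y" if "card B \<ge> 5" "x \<in> B" "y \<in> B" for x y
    by (rule joined_no_edge[OF joined_sym[OF j(2)] that(1) W4 that(2,3)])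
  have R2: "card R \<le> 8 * P"
  proof (cases "card R \<ge> 5")
    case True
    have "colored_by (K - {r}) R"
      using noR[OF True] by (intro colored_by_remove colored_by_subset[OF col]) auto
    then have "card R \<le> 4 * 2 ^ card (K - {r})" using K True by (intro boundedD bnd) auto
    then show ?thesis using K Pe by simp
  qed (use P2 in simp)
  have B2: "card B \<le> 8 * P"
  proof (cases "card B \<ge> 5")
    case True
    have "colored_by (K - {b}) B"
      using noB[OF True] by (intro colored_by_remove colored_by_subset[OF col]) auto
    then have "card B \<le> 4 * 2 ^ card (K - {b})" using K True by (intro boundedD bnd) auto
    then show ?thesis using K Pe by simp
  qed (use P2 in simp)
  show ?thesis
  proof (cases "card R \<ge> 5 \<and> card B \<ge> 5")
    case False
    then show ?thesis using R2 B2 P2 unfolding P_def[symmetric] by linarith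
  next
    case True
    then have c5: "card R \<ge> 5" "card B \<ge> 5" by blast+
    have Krb: "card (K - {r} - {b}) = card K - 2" "K - {r} - {b} \<subset> K" using K by auto
    show ?thesis
    proof (cases "(\<exists>x\<in>R. \<exists>y\<in>R. ad b x y) \<and> (\<exists>x\<in>B. \<exists>y\<in>B. ad r x y)")
      case False
      then consider "\<And>x y. x \<in> R \<Longrightarrow> y \<in> R \<Longrightarrow> \<not> ad b x y" | "\<And>x y. x \<in> B \<Longrightarrow> y \<in> B \<Longrightarrow> \<not> ad r x y"
        by blast
      then show ?thesis
      proof cases
        case 1
        have "colored_by (K - {r} - {b}) R"
          using noR[OF c5(1)] 1 by (intro colored_by_remove colored_by_subset[OF col]) auto
        then have "card R \<le> 4 * 2 ^ card (K - {r} - {b})" using Krb c5 by (intro boundedD bnd) auto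
        then show ?thesis using B2 unfolding Krb P_def[symmetric] by linarith
      next
        case 2
        have "colored_by (K - {r} - {b}) B"
          using noB[OF c5(2)] 2 by (intro colored_by_remove colored_by_subset[OF col]) auto
        then have "card B \<le> 4 * 2 ^ card (K - {r} - {b})" using Krb c5 by (intro boundedD bnd) auto
        then show ?thesis using R2 unfolding Krb P_def[symmetric] by linarith
      qed
    next
      case True
      then obtain p1 p2 q1 q2 where p: "p1 \<in> R" "p2 \<in> R" "ad b p1 p2"
        and q: "q1 \<in> B" "q2 \<in> B" "ad r q1 q2" by blast
      have col': "colored_by K (W \<union> B \<union> R)" using col by (simp add: Un_ac)
      have dis': "B \<inter> R = {}" using dis(3) by blast
      have cross': "ad b u v \<or> ad r u v" if "u \<in> B" "v \<in> R" for u v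
        using cross[OF that(2,1)] ad_sym by blast
      have bnd': "bounded K' U"
        if "U \<subseteq> B \<or> U \<subseteq> R" "K' \<subset> K" "colored_by K' U" "card U \<ge> 5" for U K'
        using bnd[of U K'] that by blast
      have uni: ?thesis if u: "u \<in> R" "\<And>v. v \<in> B \<Longrightarrow> ad r u v" for u
        using attached_parts_universal[OF K(1-4) col dis cross j c(1) c5 noR[OF c5(1)] noB[OF c5(2)] bnd u q]
          P2 unfolding Pe P_def[symmetric] by linarith
      have uni': ?thesis if u: "u \<in> B" "\<And>v. v \<in> R \<Longrightarrow> ad b u v" for u
        using attached_parts_universal[OF K(1,3,2) K(4)[symmetric] col' dis(2,1) dis' cross' j(2,1) c(1)
            c5(2,1) noB[OF c5(2)] noR[OF c5(1)] bnd' u p]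
          P2 unfolding Pe P_def[symmetric] by linarith
      show ?thesis
      proof (cases "(\<exists>u\<in>{p1, p2}. \<forall>v\<in>B. ad r u v) \<or> (\<exists>u\<in>{q1, q2}. \<forall>v\<in>R. ad b u v)")
        case True
        then show ?thesis using uni uni' p q by blast
      next
        case False
        then obtain v1 v2 w1 w2 where v: "v1 \<in> B" "\<not> ad r p1 v1" "v2 \<in> B" "\<not> ad r p2 v2"
          and w: "w1 \<in> R" "\<not> ad b q1 w1" "w2 \<in> R" "\<not> ad b q2 w2" by blast
        have "card B \<le> 4 * P + 1"
          using attached_parts_nonuniversal[OF K(1-4) col dis cross j c(1) c5 noB[OF c5(2)] bnd p v]
          unfolding P_def .
        moreover have "card R \<le> 4 * P + 1"
          using attached_parts_nonuniversal[OF K(1,3,2) K(4)[symmetric] col' dis(2,1) dis' cross' j(2,1) c(1)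
            c5(2,1) noR[OF c5(1)] bnd' q w]
          unfolding P_def .
        ultimately show ?thesis using P2 unfolding P_def[symmetric] by linarith
      qed
    qed
  qed
qed

lemma sum_remove_two:
  fixes h :: "'c \<Rightarrow> nat"
  assumes "finite K" "r \<in> K" "b \<in> K" "r \<noteq> b"
  shows "(\<Sum>i\<in>K. h i) = h r + h b + (\<Sum>i\<in>K - {r} - {b}. h i)"
  using assms sum.remove[of K r h] sum.remove[of "K - {r}" b h] by simp

text \<open>Color b is absent inside W, and also inside B once B has 5 vertices. The vertices of R
  count as further r-universal vertices of W. So W with its universal sets, and B alone, each fit
  into half of the bound.\<close>

lemma absorb_small_neighbourhood:
  assumes K: "finite K" "r \<in> K" "b \<in> K" "r \<noteq> b" "card K \<ge> 3" and col: "colored_by K (W \<union> R \<union> B)"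
    and fin: "finite R" and j: "joined r W R" "joined b W B"
    and c: "card W \<ge> 5" "card R \<le> 3" "card B \<ge> 4"
    and S: "\<And>i. i \<in> K \<Longrightarrow> joined i (S i) (W \<union> R \<union> B) \<and> finite (S i) \<and> card (S i) \<le> 3"
    and bnd: "\<And>U K'. U \<subseteq> W \<or> U \<subseteq> B \<Longrightarrow> K' \<subset> K \<Longrightarrow> colored_by K' U \<Longrightarrow> card U \<ge> 5 \<Longrightarrow> bounded K' U"
  shows "card W + card R + card B + (\<Sum>i\<in>K. card (S i)) \<le> 4 * 2 ^ card K"
proof -
  have c4: "card W \<ge> 4" using c by simp
  have Sb: "S b = {}"
  proof (rule ccontr)
    assume "S b \<noteq> {}"
    then obtain s where "s \<in> S b" by blast
    then have "joined b {s} W" "joined b {s} B"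
      using S[OF K(3)] unfolding joined_def by blast+
    then show False using joined_universal_vertex[OF j(2) c4 c(3)] by blast
  qed
  have noW: "\<not> ad b x y" if "x \<in> W" "y \<in> W" for x y
    by (rule joined_no_edge[OF j(2) c(1,3) that])
  have card_b: "card (K - {b}) = card K - 1" using K by simp
  have Kb: "K - {b} \<subset> K" using K by blast
  have Pe: "4 * 2 ^ card K = 2 * (4 * 2 ^ (card K - 1) :: nat)"
  proof -
    have "card K = Suc (card K - 1)" using K(5) by simp
    then show ?thesis by (metis mult.left_commute power_Suc)
  qed
  have B2: "card B \<le> 4 * 2 ^ (card K - 1)"
  proof (cases "card B \<ge> 5")
    case True
    have "\<not> ad b x y" if "x \<in> B" "y \<in> B" for x y
      by (rule joined_no_edge[OF joined_sym[OF j(2)] True c4 that])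
    then have "colored_by (K - {b}) B"
      by (intro colored_by_remove colored_by_subset[OF col]) auto
    then have "card B \<le> 4 * 2 ^ card (K - {b})" using Kb True by (intro boundedD bnd) auto
    then show ?thesis unfolding card_b .
  next
    case False
    have "(1 :: nat) \<le> 2 ^ (card K - 1)" by simp
    then show ?thesis using False by linarith
  qed
  define S' where "S' = S(r := S r \<union> R)"
  have SR: "S r \<inter> R = {}" using joined_neq[of r "S r" "W \<union> R \<union> B"] S[OF K(2)] by blast
  have cSR: "card (S r \<union> R) = card (S r) + card R"
    using S[OF K(2)] fin SR by (intro card_Un_disjoint) auto
  have "colored_by (K - {b}) W"
    using noW by (intro colored_by_remove colored_by_subset[OF col]) auto
  then have bW: "bounded (K - {b}) W" using bnd[of W "K - {b}"] Kb c by blast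
  have "joined i (S' i) W \<and> finite (S' i) \<and> card (S' i) \<le> 6" if "i \<in> K - {b}" for i
  proof (cases "i = r")
    case True
    have "joined r (S r \<union> R) W"
      using S[OF K(2)] joined_sym[OF j(1)] unfolding joined_def by blast
    then show ?thesis using True cSR S[OF K(2)] fin c(2) unfolding S'_def by simp
  next
    case False
    have "joined i (S i) W" using S[of i] that unfolding joined_def by blast
    moreover have "card (S i) \<le> 6" "finite (S i)" using S[of i] that by fastforce+
    ultimately show ?thesis using False unfolding S'_def by simp
  qed
  then have "card W + (\<Sum>i\<in>K - {b}. card (S' i)) \<le> 4 * 2 ^ (card K - 1)"
    using bW unfolding bounded_def card_b by blast
  moreover have "(\<Sum>i\<in>K - {b}. card (S' i)) = card (S r) + card R + (\<Sum>i\<in>K - {r} - {b}. card (S i))"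
  proof -
    have "(\<Sum>i\<in>K - {b}. card (S' i)) = card (S' r) + (\<Sum>i\<in>K - {b} - {r}. card (S' i))"
      using K by (intro sum.remove) auto
    also have "(\<Sum>i\<in>K - {b} - {r}. card (S' i)) = (\<Sum>i\<in>K - {r} - {b}. card (S i))"
      unfolding S'_def by (rule sum.cong) auto
    finally show ?thesis using cSR unfolding S'_def by simp
  qed
  moreover have "(\<Sum>i\<in>K. card (S i)) = card (S r) + card (S b) + (\<Sum>i\<in>K - {r} - {b}. card (S i))"
    by (rule sum_remove_two[OF K(1-4)])
  ultimately show ?thesis using B2 Sb unfolding Pe by simp
qed

lemma large_part_bound:
  assumes K: "finite K" "r \<in> K" "b \<in> K" "r \<noteq> b" "card K \<ge> 3" and col: "colored_by K (W \<union> R \<union> B)"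
    and dis: "W \<inter> R = {}" "W \<inter> B = {}" "R \<inter> B = {}" and fin: "finite R" "finite B"
    and cross: "\<And>u v. u \<in> R \<Longrightarrow> v \<in> B \<Longrightarrow> ad r u v \<or> ad b u v"
    and j: "joined r W R" "joined b W B" and c: "card W \<ge> 5" and proper: "R \<union> B \<noteq> {}"
    and S: "\<And>i. i \<in> K \<Longrightarrow> joined i (S i) (W \<union> R \<union> B) \<and> finite (S i) \<and> card (S i) \<le> 3"
    and bnd: "\<And>U K'. U \<subseteq> W \<union> R \<union> B \<Longrightarrow> K' \<subseteq> K \<Longrightarrow> U \<noteq> W \<union> R \<union> B \<or> K' \<noteq> K \<Longrightarrow>
      colored_by K' U \<Longrightarrow> card U \<ge> 5 \<Longrightarrow> bounded K' U"
  shows "card W + card R + card B + (\<Sum>i\<in>K. card (S i)) \<le> 4 * 2 ^ card K"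
proof -
  have bndK: "bounded K' U"
    if "U \<subseteq> W \<or> U \<subseteq> R \<or> U \<subseteq> B" "K' \<subset> K" "colored_by K' U" "card U \<ge> 5" for U K'
    by (rule bnd) (use that in blast)+
  have sums: "(\<Sum>i\<in>K. card (S i)) = card (S r) + card (S b) + (\<Sum>i\<in>K - {r} - {b}. card (S i))"
    by (rule sum_remove_two[OF K(1-4)])
  consider "card R \<ge> 4" "card B \<ge> 4" | "card R \<le> 3" "card B \<ge> 4" | "card R \<ge> 4" "card B \<le> 3"
    | "card R \<le> 3" "card B \<le> 3" by linarith
  then show ?thesis
  proof cases
    case 1
    have c4: "card W \<ge> 4" using c by simp
    have Sr: "S r = {}"
    proof (rule ccontr)
      assume "S r \<noteq> {}"
      then obtain s where "s \<in> S r" by blast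
      then have "joined r {s} W" "joined r {s} R" using S[OF K(2)] unfolding joined_def by blast+
      then show False using joined_universal_vertex[OF j(1) c4 1(1)] by blast
    qed
    have Sb: "S b = {}"
    proof (rule ccontr)
      assume "S b \<noteq> {}"
      then obtain s where "s \<in> S b" by blast
      then have "joined b {s} W" "joined b {s} B" using S[OF K(3)] unfolding joined_def by blast+
      then show False using joined_universal_vertex[OF j(2) c4 1(2)] by blast
    qed
    have "\<not> ad r x y" "\<not> ad b x y" if "x \<in> W" "y \<in> W" for x y
      using joined_no_edge[OF j(1) c 1(1) that] joined_no_edge[OF j(2) c 1(2) that] by blast+
    then have "colored_by (K - {r} - {b}) W"
      by (intro colored_by_remove colored_by_subset[OF col]) auto
    then have "bounded (K - {r} - {b}) W" using K c by (intro bndK) auto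
    moreover have "joined i (S i) W \<and> finite (S i) \<and> card (S i) \<le> 6" if "i \<in> K - {r} - {b}" for i
      using S[of i] that unfolding joined_def by force
    ultimately have "card W + (\<Sum>i\<in>K - {r} - {b}. card (S i)) \<le> 4 * 2 ^ card (K - {r} - {b})"
      unfolding bounded_def by blast
    moreover have "card (K - {r} - {b}) = card K - 2" using K by simp
    moreover have "card R + card B \<le> 12 * 2 ^ (card K - 2)"
      by (rule attached_parts_bound[OF K col dis cross j c 1]) (use bndK in blast)+
    moreover have "4 * 2 ^ card K = (16 * 2 ^ (card K - 2) :: nat)"
    proof -
      have "2 + (card K - 2) = card K" using K(5) by simp
      then show ?thesis using power_add[of "2 :: nat" 2 "card K - 2"] by simp
    qed
    ultimately show ?thesis using sums Sr Sb by simp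
  next
    case 2
    show ?thesis
      by (rule absorb_small_neighbourhood[OF K col fin(1) j c 2 S]) (use bndK in blast)+
  next
    case 3
    have eq: "W \<union> B \<union> R = W \<union> R \<union> B" by blast
    have "card W + card B + card R + (\<Sum>i\<in>K. card (S i)) \<le> 4 * 2 ^ card K"
    proof (rule absorb_small_neighbourhood[OF K(1,3,2) K(4)[symmetric] K(5) _ fin(2) j(2,1) c 3(2,1)])
      show "colored_by K (W \<union> B \<union> R)" unfolding eq by (rule col)
      show "joined i (S i) (W \<union> B \<union> R) \<and> finite (S i) \<and> card (S i) \<le> 3" if "i \<in> K" for i
        unfolding eq by (rule S[OF that])
      show "bounded K' U" if "U \<subseteq> W \<or> U \<subseteq> R" "K' \<subset> K" "colored_by K' U" "card U \<ge> 5" for U K'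
        by (rule bndK) (use that in blast)+
    qed
    then show ?thesis by simp
  next
    case 4
    \<comment> \<open>No color disappears from W here; the induction applies because W is a proper
      subset, and the enlarged sets have at most 3 + 3 vertices.\<close>
    define S' where "S' = S(r := S r \<union> R, b := S b \<union> B)"
    have neq: "W \<noteq> W \<union> R \<union> B" using dis proper by blast
    have "bounded K W"
      using neq c by (intro bnd colored_by_subset[OF col]) auto
    moreover have disS: "S r \<inter> R = {}" "S b \<inter> B = {}"
      using joined_neq[of r "S r" "W \<union> R \<union> B"] joined_neq[of b "S b" "W \<union> R \<union> B"] S K by blast+
    have cS: "card (S r \<union> R) = card (S r) + card R" "card (S b \<union> B) = card (S b) + card B"
      using S[OF K(2)] S[OF K(3)] fin disS by (auto intro!: card_Un_disjoint)
    have jS: "joined r (S r \<union> R) W" "joined b (S b \<union> B) W"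
      using S[OF K(2)] S[OF K(3)] joined_sym[OF j(1)] joined_sym[OF j(2)] unfolding joined_def by blast+
    have "joined i (S' i) W \<and> finite (S' i) \<and> card (S' i) \<le> 6" if "i \<in> K" for i
    proof -
      consider "i = r" | "i = b" | "i \<noteq> r" "i \<noteq> b" by blast
      then show ?thesis
      proof cases
        case 1
        then show ?thesis using jS(1) cS(1) S[OF K(2)] fin 4 K(4) unfolding S'_def by simp
      next
        case 2
        then show ?thesis using jS(2) cS(2) S[OF K(3)] fin 4 unfolding S'_def by simp
      next
        case 3
        have "joined i (S i) W" using S[OF that] unfolding joined_def by blast
        then show ?thesis using 3 S[OF that] unfolding S'_def by simp
      qed
    qed
    ultimately have "card W + (\<Sum>i\<in>K. card (S' i)) \<le> 4 * 2 ^ card K"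
      unfolding bounded_def by blast
    moreover have "(\<Sum>i\<in>K. card (S' i)) = card (S' r) + card (S' b) + (\<Sum>i\<in>K - {r} - {b}. card (S' i))"
      by (rule sum_remove_two[OF K(1-4)])
    moreover have "(\<Sum>i\<in>K - {r} - {b}. card (S' i)) = (\<Sum>i\<in>K - {r} - {b}. card (S i))"
      unfolding S'_def by (rule sum.cong) auto
    ultimately show ?thesis using sums cS K(4) unfolding S'_def by simp
  qed
qed

end

section \<open>The induction\<close>

text \<open>The Gallai partition enters as an assumption on all subsets of X, phrased by
  \<open>ad\<close> alone, so the induction never refers to a coloring function.\<close>

locale gallai_c9_free = c9_free ad for ad :: "'c \<Rightarrow> 'a \<Rightarrow> 'a \<Rightarrow> bool" +
  fixes X :: "'a set"
  assumes ad_unique: "ad c x y \<Longrightarrow> ad d x y \<Longrightarrow> c = d"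
    and partition: "V \<subseteq> X \<Longrightarrow> finite V \<Longrightarrow> card V \<ge> 2 \<Longrightarrow>
      \<exists>(p :: 'a \<Rightarrow> 'a) c d. (\<exists>x\<in>V. \<exists>y\<in>V. p x \<noteq> p y) \<and>
        (\<forall>x\<in>V. \<forall>y\<in>V. p x \<noteq> p y \<longrightarrow> ad c x y \<or> ad d x y) \<and>
        (\<forall>x\<in>V. \<forall>x'\<in>V. \<forall>y\<in>V. p x = p x' \<longrightarrow> p x \<noteq> p y \<longrightarrow> (\<forall>i. ad i x y \<longrightarrow> ad i x' y))"
begin

lemma bounded_of_three_colors:
  assumes K: "finite K" "card K \<ge> 3" and V: "V \<subseteq> X" "card V \<ge> 5" and col: "colored_by K V"
    and S: "\<And>i. i \<in> K \<Longrightarrow> joined i (S i) V \<and> finite (S i) \<and> card (S i) \<le> 3"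
    and bnd: "\<And>U K'. U \<subseteq> V \<Longrightarrow> K' \<subseteq> K \<Longrightarrow> U \<noteq> V \<or> K' \<noteq> K \<Longrightarrow> colored_by K' U \<Longrightarrow>
      card U \<ge> 5 \<Longrightarrow> bounded K' U"
  shows "card V + (\<Sum>i\<in>K. card (S i)) \<le> 4 * 2 ^ card K"
proof (rule ccontr)
  assume contr: "\<not> ?thesis"
  have finV: "finite V" and V2: "card V \<ge> 2" using V(2) by (auto intro: card_ge_0_finite)
  obtain p :: "'a \<Rightarrow> 'a" and c d where p: "\<exists>x\<in>V. \<exists>y\<in>V. p x \<noteq> p y"
    "\<forall>x\<in>V. \<forall>y\<in>V. p x \<noteq> p y \<longrightarrow> ad c x y \<or> ad d x y"
    "\<forall>x\<in>V. \<forall>x'\<in>V. \<forall>y\<in>V. p x = p x' \<longrightarrow> p x \<noteq> p y \<longrightarrow> (\<forall>i. ad i x y \<longrightarrow> ad i x' y)"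
    using partition[OF V(1) finV V2] by (elim exE conjE) (rule that; assumption)
  have hom: "ad i x' y" if "x \<in> V" "x' \<in> V" "y \<in> V" "p x = p x'" "p x \<noteq> p y" "ad i x y" for x x' y i
    using p(3) that by blast
  \<comment> \<open>The colors c and d may coincide or lie outside K; Q completes those in K to
    exactly two.\<close>
  have "card (K \<inter> {c, d}) \<le> 2"
    using card_mono[of "{c, d}" "K \<inter> {c, d}"] card_length[of "[c, d]"] by simp
  then obtain Q where Q: "K \<inter> {c, d} \<subseteq> Q" "Q \<subseteq> K" "card Q = 2"
    using exists_subset_between[of "K \<inter> {c, d}" 2 K] K by auto
  then obtain r b where rb: "Q = {r, b}" "r \<noteq> b" by (auto simp: card_2_iff)
  then have Krb: "r \<in> K" "b \<in> K" using Q by auto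
  have cross: "ad r x y \<or> ad b x y" if xy: "x \<in> V" "y \<in> V" "p x \<noteq> p y" for x y
  proof -
    have "ad c x y \<or> ad d x y" using p(2) xy by blast
    moreover obtain i where "i \<in> K" "ad i x y" using col xy unfolding colored_by_def by metis
    ultimately have "i \<in> K \<inter> {c, d}" using ad_unique by blast
    then show ?thesis using \<open>ad i x y\<close> Q(1) rb(1) by blast
  qed
  have sums: "(\<Sum>i\<in>K. card (S i)) = card (S r) + card (S b) + (\<Sum>i\<in>K - {r} - {b}. card (S i))"
    by (rule sum_remove_two[OF K(1) Krb rb(2)])
  define part where "part x = {y \<in> V. p y = p x}" for x
  show False
  proof (cases "\<exists>x\<in>V. card (part x) \<ge> 5")
    case True
    then obtain x where x: "x \<in> V" "card (part x) \<ge> 5" by blast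
    define R where "R = {y \<in> V. p y \<noteq> p x \<and> ad r x y}"
    define B where "B = {y \<in> V. p y \<noteq> p x \<and> ad b x y}"
    have V_eq: "V = part x \<union> R \<union> B" unfolding part_def R_def B_def using cross x(1) by force
    have dis: "part x \<inter> R = {}" "part x \<inter> B = {}" "R \<inter> B = {}"
      unfolding part_def R_def B_def using ad_unique rb(2) by blast+
    have RB: "R \<subseteq> V" "B \<subseteq> V" "part x \<subseteq> V" unfolding part_def R_def B_def by auto
    then have fin: "finite R" "finite B" "finite (part x)" using finV finite_subset by blast+
    have "joined i (part x) {y \<in> V. p y \<noteq> p x \<and> ad i x y}" for i
      unfolding joined_def part_def
    proof (intro ballI)
      fix a y assume "a \<in> {y \<in> V. p y = p x}" "y \<in> {y \<in> V. p y \<noteq> p x \<and> ad i x y}"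
      then show "ad i a y" by (intro hom[OF x(1), of a y]) auto
    qed
    then have j: "joined r (part x) R" "joined b (part x) B" unfolding R_def B_def by blast+
    have cross': "ad r u v \<or> ad b u v" if uv: "u \<in> R" "v \<in> B" for u v
    proof (rule cross)
      show "u \<in> V" "v \<in> V" using uv RB by auto
      show "p u \<noteq> p v"
      proof
        assume eq: "p u = p v"
        have u: "u \<in> V" "p u \<noteq> p x" "ad r x u" and v: "v \<in> V" "ad b x v"
          using uv unfolding R_def B_def by auto
        have "ad r v x" using hom[OF u(1) v(1) x(1) eq u(2) ad_sym[OF u(3)]] .
        then show False using ad_unique[OF _ ad_sym[OF v(2)]] rb(2) by blast
      qed
    qed
    have "card (part x) + card R + card B + (\<Sum>i\<in>K. card (S i)) \<le> 4 * 2 ^ card K"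
    proof (rule large_part_bound[OF K(1) Krb rb(2) K(2) _ dis fin(1,2) cross' j x(2)])
      show "colored_by K (part x \<union> R \<union> B)" using col V_eq by simp
      show "R \<union> B \<noteq> {}"
      proof
        assume "R \<union> B = {}"
        then have "V = part x" using V_eq by blast
        then have "p y = p x" if "y \<in> V" for y using that unfolding part_def by blast
        then show False using p(1) by metis
      qed
      show "joined i (S i) (part x \<union> R \<union> B) \<and> finite (S i) \<and> card (S i) \<le> 3" if "i \<in> K" for i
        using S[OF that] V_eq by simp
      show "bounded K' U"
        if "U \<subseteq> part x \<union> R \<union> B" "K' \<subseteq> K" "U \<noteq> part x \<union> R \<union> B \<or> K' \<noteq> K" "colored_by K' U" "card U \<ge> 5"
        for U K'
        using bnd[of U K'] that V_eq by simp
    qed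
    moreover have "card V = card (part x) + card R + card B"
    proof -
      have "card (part x \<union> R \<union> B) = card (part x \<union> R) + card B"
        using fin dis by (intro card_Un_disjoint) auto
      also have "card (part x \<union> R) = card (part x) + card R"
        using fin dis by (intro card_Un_disjoint) auto
      finally show ?thesis using V_eq by simp
    qed
    ultimately show False using contr by simp
  next
    case False
    then have parts: "card {y \<in> V. p y = p x} \<le> 4" if "x \<in> V" for x
      using that unfolding part_def by force
    have cross': "ad b x y \<or> ad r x y" if "x \<in> V" "y \<in> V" "p x \<noteq> p y" for x y
      using cross[OF that] by blast
    obtain n where n: "card K = n + 3" using K(2) by (metis add.commute le_Suc_ex)
    have pow: "4 * 2 ^ card K \<ge> (32 + 32 * n :: nat)"
    proof -
      have "Suc n \<le> 2 ^ n" by (induction n) auto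
      then show ?thesis unfolding n power_add by simp
    qed
    have sum': "(\<Sum>i\<in>K - {r} - {b}. card (S i)) \<le> 3 * (n + 1)"
    proof -
      have "(\<Sum>i\<in>K - {r} - {b}. card (S i)) \<le> of_nat (card (K - {r} - {b})) * 3"
        by (rule sum_bounded_above) (use S in auto)
      moreover have "card (K - {r} - {b}) = n + 1" using K Krb rb(2) n by simp
      ultimately show ?thesis by simp
    qed
    have S3: "card (S r) \<le> 3" "card (S b) \<le> 3" using S Krb by auto
    define s where "s = (\<Sum>i\<in>K - {r} - {b}. card (S i))"
    have total: "card V + (card (S r) + card (S b) + s) > 4 * 2 ^ card K"
      using contr sums unfolding s_def by simp
    have s_le: "s \<le> 3 * (n + 1)" using sum' unfolding s_def .
    have V12: "card V \<ge> 12" using total s_le S3 pow by simp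
    have "card (S r) \<le> 2"
    proof (rule ccontr)
      assume "\<not> ?thesis"
      then have c3: "card (S r) \<ge> 3" by simp
      have jS: "joined r (S r) V" using S[OF Krb(1)] by blast
      show False by (rule parts_universal_triple[OF cross parts finV jS c3 subset_refl V12])
    qed
    moreover have "card (S b) \<le> 2"
    proof (rule ccontr)
      assume "\<not> ?thesis"
      then have c3: "card (S b) \<ge> 3" by simp
      have jS: "joined b (S b) V" using S[OF Krb(2)] by blast
      show False by (rule parts_universal_triple[OF cross' parts finV jS c3 subset_refl V12])
    qed
    \<comment> \<open>For three colors this is 33 - 3 - 2 - 2; every further color gains at least 32
      and costs at most 3.\<close>
    ultimately have V26: "card V \<ge> 26" using total s_le pow by simp
    show False by (rule small_parts[OF cross hom parts V26])
  qed
qed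

text \<open>Five vertices in V ensure that a set S i of four or more removes color i from V. For
  four the bound fails: a one-color clique of 4 vertices joined to 6 independent ones has no C9,
  because 4 vertices meet all edges, yet 4 + 6 > 8.\<close>

theorem bounded_colored_by:
  assumes "finite K" "V \<subseteq> X" "card V \<ge> 5" "colored_by K V"
  shows "bounded K V"
  using assms
proof (induction "card V + card K" arbitrary: V K rule: less_induct)
  case less
  have finV: "finite V" using less.prems(3) by (auto intro: card_ge_0_finite)
  have IH: "bounded K' U"
    if U: "U \<subseteq> V" "K' \<subseteq> K" "U \<noteq> V \<or> K' \<noteq> K" "colored_by K' U" "card U \<ge> 5" for U K'
  proof (rule less.hyps)
    have le: "card U \<le> card V" "card K' \<le> card K"
      using U(1,2) finV less.prems(1) by (auto intro: card_mono)
    from U(3) show "card U + card K' < card V + card K"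
    proof
      assume "U \<noteq> V"
      then have "card U < card V" using U(1) finV by (intro psubset_card_mono) auto
      then show ?thesis using le by simp
    next
      assume "K' \<noteq> K"
      then have "card K' < card K" using U(2) less.prems(1) by (intro psubset_card_mono) auto
      then show ?thesis using le by simp
    qed
    show "finite K'" using U(2) less.prems(1) by (rule finite_subset)
    show "U \<subseteq> X" using U(1) less.prems(2) by blast
  qed (use U in auto)
  show ?case
    unfolding bounded_def
  proof (intro allI impI)
    fix S assume S: "\<forall>i\<in>K. joined i (S i) V \<and> finite (S i) \<and> card (S i) \<le> 6"
    show "card V + (\<Sum>i\<in>K. card (S i)) \<le> 4 * 2 ^ card K"
    proof (cases "\<exists>i\<in>K. card (S i) \<ge> 4")
      case True
      then obtain i where i: "i \<in> K" "card (S i) \<ge> 4" by blast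
      have "\<not> ad i x y" if "x \<in> V" "y \<in> V" for x y
        using joined_no_edge[OF joined_sym _ i(2) that] S i(1) less.prems(3) by blast
      then have "colored_by (K - {i}) V" using less.prems(4) by (intro colored_by_remove)
      then have "bounded (K - {i}) V" using IH[of V "K - {i}"] i(1) less.prems(3) by blast
      then have b: "card V + (\<Sum>i\<in>K - {i}. card (S i)) \<le> 4 * 2 ^ card (K - {i})"
        unfolding bounded_def using S by blast
      have cK: "card K = Suc (card (K - {i}))" by (rule card_Suc_Diff1[OF less.prems(1) i(1), symmetric])
      have s: "(\<Sum>i\<in>K. card (S i)) = card (S i) + (\<Sum>i\<in>K - {i}. card (S i))"
        by (rule sum.remove[OF less.prems(1) i(1)])
      \<comment> \<open>Without a further color, b would bound at least 5 vertices by 4. So dropping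
        i halves a bound of at least 16, and the freed half, at least 8, pays for the at most 6
        vertices of S i.\<close>
      have "card (K - {i}) \<noteq> 0" using b less.prems(3) by (intro notI) simp
      then have "(2 :: nat) ^ 1 \<le> 2 ^ card (K - {i})" by (intro power_increasing) auto
      moreover have "card (S i) \<le> 6" using S i(1) by blast
      ultimately show ?thesis using b s cK by simp
    next
      case False
      then have S3: "joined i (S i) V \<and> finite (S i) \<and> card (S i) \<le> 3" if "i \<in> K" for i
        using S that by force
      consider "card K = 0" | "card K = 1" | "card K = 2" | "card K \<ge> 3" by linarith
      then show ?thesis
      proof cases
        case 1
        then have "K = {}" using less.prems(1) by simp
        moreover have V2: "card V \<ge> 2" using less.prems(3) by simp
        obtain x y where "x \<in> V" "y \<in> V" "x \<noteq> y" by (rule two_of_card[OF V2])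
        ultimately show ?thesis using less.prems(4) unfolding colored_by_def by blast
      next
        case 2
        then obtain i where i: "K = {i}" by (auto simp: card_1_singleton_iff)
        have "card V + card (S i) \<le> 8"
          using one_color_bound[of i V "S i"] less.prems(4) S3[of i] unfolding i by simp
        then show ?thesis unfolding i by simp
      next
        case 3
        then obtain c d where cd: "K = {c, d}" "c \<noteq> d" by (auto simp: card_2_iff)
        have "two_colored c d V"
          using less.prems(4) unfolding cd two_colored_def colored_by_def by blast
        then have "card V + card (S c) + card (S d) \<le> 16"
          using two_colored_bound[of c d V "S c" "S d"] S3 unfolding cd by simp
        then show ?thesis using cd by simp
      next
        case 4
        show ?thesis
          by (rule bounded_of_three_colors[OF less.prems(1) 4 less.prems(2-4) S3 IH])
      qed
    qed
  qed
qed

end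

lemma gallai_ramsey_prop_C9:
  "gallai_ramsey_prop k (cycle_graph 9) (4 * 2 ^ k + 1)"
  unfolding gallai_ramsey_prop_def
proof (intro allI impI)
  fix f
  let ?n = "4 * 2 ^ k + 1 :: nat"
  let ?X = "{..<?n}"
  assume col: "edge_coloring k (complete_graph ?n) f"
  have edge: "{x, y} \<in> edges (complete_graph ?n) \<longleftrightarrow> x \<in> ?X \<and> y \<in> ?X \<and> x \<noteq> y" for x y :: nat
    unfolding complete_graph_def nsets_def by (auto simp: card_insert_if)
  show "has_rainbow_triangle (complete_graph ?n) f \<or> has_mono_copy k (cycle_graph 9) (complete_graph ?n) f"
  proof (rule ccontr)
    assume contr: "\<not> ?thesis"
    \<comment> \<open>Membership in the vertex set and distinctness are built in, so cycles of
      \<open>ad\<close> lie in the complete graph automatically.\<close>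
    define ad where "ad c x y \<longleftrightarrow> x \<in> ?X \<and> y \<in> ?X \<and> x \<noteq> y \<and> f {x, y} = c" for c x y
    have fk: "f {x, y} < k" if "x \<in> ?X" "y \<in> ?X" "x \<noteq> y" for x y
      using col edge[of x y] that unfolding edge_coloring_def by blast
    have rf: "rainbow_free f ?X"
      using contr unfolding rainbow_free_def has_rainbow_triangle_def edge by blast
    interpret gallai_c9_free ad ?X
    proof
      show "ad c y x" if "ad c x y" for c x y using that unfolding ad_def by (auto simp: insert_commute)
      show "\<not> ad c x x" for c x unfolding ad_def by simp
      show "c = d" if "ad c x y" "ad d x y" for c d x y using that unfolding ad_def by blast
      show "\<not> cyc (ad c) xs" if len: "length xs = 9" for c xs
      proof
        assume cyc: "cyc (ad c) xs"
        have "periodic_cycle (ad c) 9 (\<lambda>i. xs ! (i mod 9))"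
          using periodic_cycle_of_list[OF cyc] len by simp
        then have e: "ad c (xs ! i) (xs ! (Suc i mod 9))" if "i < 9" for i
          using that unfolding periodic_cycle_def by (metis mod_less)
        have "has_mono_copy k (cycle_graph 9) (complete_graph ?n) f"
          unfolding has_mono_copy_def
        proof (intro exI conjI ballI)
          show "(!) xs \<in> verts (cycle_graph 9) \<rightarrow> verts (complete_graph ?n)"
            using e unfolding cycle_graph_def complete_graph_def ad_def by simp
          show "inj_on ((!) xs) (verts (cycle_graph 9))"
            using cyc len unfolding cyc_def cycle_graph_def by (simp add: inj_on_nth)
          show "c < k" using e[of 0] fk unfolding ad_def by fastforce
          fix u assume "u \<in> edges (cycle_graph 9)"
          then obtain i where i: "u = {i, Suc i mod 9}" "i < 9" unfolding cycle_graph_def by auto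
          have im: "(!) xs ` u = {xs ! i, xs ! (Suc i mod 9)}" unfolding i(1) by simp
          show "(!) xs ` u \<in> edges (complete_graph ?n)" "f ((!) xs ` u) = c"
            unfolding im edge using e[OF i(2)] unfolding ad_def by blast+
        qed
        then show False using contr by blast
      qed
      fix V :: "nat set" assume V: "V \<subseteq> ?X" "finite V" "card V \<ge> 2"
      obtain p :: "nat \<Rightarrow> nat" and c d where p: "\<exists>x\<in>V. \<exists>y\<in>V. p x \<noteq> p y"
        "\<forall>x\<in>V. \<forall>y\<in>V. p x \<noteq> p y \<longrightarrow> f {x, y} \<in> {c, d}"
        "\<forall>x\<in>V. \<forall>x'\<in>V. \<forall>y\<in>V. p x = p x' \<longrightarrow> p x \<noteq> p y \<longrightarrow> f {x, y} = f {x', y}"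
        using gallai_partition[OF V(2,3) rainbow_free_subset[OF rf V(1)]]
        by (elim exE conjE) (rule that; assumption)
      have ad_p: "ad i x y \<longleftrightarrow> f {x, y} = i" if "x \<in> V" "y \<in> V" "p x \<noteq> p y" for x y i
        using that V(1) unfolding ad_def by blast
      have "\<forall>x\<in>V. \<forall>y\<in>V. p x \<noteq> p y \<longrightarrow> ad c x y \<or> ad d x y"
        using p(2) ad_p by simp
      moreover have "\<forall>x\<in>V. \<forall>x'\<in>V. \<forall>y\<in>V. p x = p x' \<longrightarrow> p x \<noteq> p y \<longrightarrow> (\<forall>i. ad i x y \<longrightarrow> ad i x' y)"
        using p(3) ad_p by metis
      ultimately show "\<exists>(p :: nat \<Rightarrow> nat) c d. (\<exists>x\<in>V. \<exists>y\<in>V. p x \<noteq> p y) \<and>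
        (\<forall>x\<in>V. \<forall>y\<in>V. p x \<noteq> p y \<longrightarrow> ad c x y \<or> ad d x y) \<and>
        (\<forall>x\<in>V. \<forall>x'\<in>V. \<forall>y\<in>V. p x = p x' \<longrightarrow> p x \<noteq> p y \<longrightarrow> (\<forall>i. ad i x y \<longrightarrow> ad i x' y))"
        using p(1) by (intro exI conjI)
    qed
    have "colored_by {..<k} ?X"
      unfolding colored_by_def ad_def using fk by blast
    moreover have "(1 :: nat) \<le> 2 ^ k" by simp
    then have "card ?X \<ge> 5" by simp
    ultimately have "bounded {..<k} ?X" by (intro bounded_colored_by) auto
    then have "card ?X \<le> 4 * 2 ^ card {..<k}" by (rule boundedD)
    then show False by simp
  qed
qed

theorem theorem1p8:
  fixes k :: nat
  assumes "k \<ge> 1"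
  shows "gallai_ramsey k (cycle_graph 9) = 4 * 2 ^ k + 1"
  unfolding gallai_ramsey_def
proof (rule Least_equality)
  show "(4 * 2 ^ k + 1 :: nat) > 0 \<and> gallai_ramsey_prop k (cycle_graph 9) (4 * 2 ^ k + 1)"
    using gallai_ramsey_prop_C9 by simp
  fix n assume "n > 0 \<and> gallai_ramsey_prop k (cycle_graph 9) n"
  then show "4 * 2 ^ k + 1 \<le> n"
    using not_gallai_ramsey_prop[OF assms, of n] by (metis Suc_eq_plus1 not_less_eq_eq)
qed

end
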